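(* Let $\rho$ be a quantum state, let $k$ be a positive integer, let $\epsilon>0$ and $\delta\in(0,1)$, and put $t=\lceil\ln(2k/\epsilon)\rceil$. To estimate $\mathrm{Tr}(\rho^i)$ for all $i\le k$ within an additive error of $\epsilon$ and with success probability at least $1-\delta$, it suffices to estimate each $\mathrm{Tr}(\rho^j)$, $j\le t$, within an additive error $\varepsilon_j<\dfrac{\epsilon}{2k\,t\ln t}$. This can be achieved by using, for each $j\le t$, $$\widetilde{\mathcal{O}}\left(\frac{k^2\ln(1/\delta)}{\epsilon^2}\right)$$ runs on a constant-depth quantum circuit consisting of $\mathcal{O}(j)$ qubits and $\mathcal{O}(j)$ controlled-SWAP operations. Here $\widetilde{\mathcal O}(\cdot)$ hides polylogarithmic factors in $k$.
   Context: A quantum state is a positive semidefinite trace-one matrix, here on a fixed number $n$ of qubits (dimension $2^n$); the $\mathcal O(\cdot)$ counts of qubits and gates are in terms of $j$. Access to $\rho$ is through independent identical copies; one run of the circuit for the index $j$ consumes $j$ copies of $\rho$ and ends with a measurement, and outcomes of different runs are independent. Classical post-processing (including of the estimates of $\mathrm{Tr}(\rho),\dots,\mathrm{Tr}(\rho^t)$ to obtain the estimates of $\mathrm{Tr}(\rho^i)$ for $t<i\le k$) is free. A controlled-SWAP operation swaps two registers conditioned on a control qubit. Circuits may use mid-circuit measurement and classical feedback; depth refers to quantum depth.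
   Formalization: The constants in the run counts may depend on an upper bound δ0<1 for δ (as δ→1 the bound would force zero runs); for reaching the errors ε_j the hidden factor is a power of t=⌈ln(2k/ε)⌉, not polylog in k alone, though the overall goal is shown with polylog(k). *)

theory Defs
  imports
    "HOL-Probability.Probability"
    "Jordan_Normal_Form.Matrix"
    "Jordan_Normal_Form.Schur_Decomposition"
begin

definition mtrace :: "complex mat \<Rightarrow> complex" where
  "mtrace A = (\<Sum>i<dim_row A. A $$ (i, i))"

definition pos_semidef :: "complex mat \<Rightarrow> bool" where
  "pos_semidef A \<longleftrightarrow> mat_adjoint A = A \<and>
     (\<forall>v \<in> carrier_vec (dim_row A). 0 \<le> Re ((A *\<^sub>v v) \<bullet>c v))"

definition quantum_state :: "nat \<Rightarrow> complex mat \<Rightarrow> bool" where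
  "quantum_state n \<rho> \<longleftrightarrow>
     \<rho> \<in> carrier_mat (2 ^ n) (2 ^ n) \<and> pos_semidef \<rho> \<and> mtrace \<rho> = 1"

text \<open>\<open>approx_power_trace \<rho> i \<epsilon> q\<close>: the number \<open>q\<close> approximates the trace of the \<open>i\<close>-th power of
  \<open>\<rho>\<close> within the additive error \<open>\<epsilon>\<close>.\<close>

definition approx_power_trace :: "complex mat \<Rightarrow> nat \<Rightarrow> real \<Rightarrow> real \<Rightarrow> bool" where
  "approx_power_trace \<rho> i \<epsilon> q \<longleftrightarrow> cmod (complex_of_real q - mtrace (\<rho> ^\<^sub>m i)) \<le> \<epsilon>"

text \<open>For a negative logarithm the truncation index is \<open>0\<close>; no \<open>j\<close> satisfies \<open>1 \<le> j \<le> t\<close> then.\<close>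

definition trunc_index :: "nat \<Rightarrow> real \<Rightarrow> nat" where
  "trunc_index k \<epsilon> = nat \<lceil>ln (2 * real k / \<epsilon>)\<rceil>"

text \<open>The condition \<open>e < \<epsilon> / (2 k t ln t)\<close>, multiplied out. For \<open>t \<ge> 2\<close> this is the same; for
  \<open>t = 1\<close>, where \<open>ln t = 0\<close>, the bound is to be read as infinite (and not as \<open>x / 0 = 0\<close>).\<close>

definition admissible_error :: "nat \<Rightarrow> real \<Rightarrow> real \<Rightarrow> bool" where
  "admissible_error k \<epsilon> e \<longleftrightarrow>
     e * (2 * real k * real (trunc_index k \<epsilon>) * ln (real (trunc_index k \<epsilon>))) < \<epsilon>"


section \<open>Quantum circuits with mid-circuit measurement and classical feedback\<close>

text \<open>
  A circuit acts on \<open>j\<close> registers of \<open>n\<close> qubits, each holding a copy of \<open>\<rho>\<close>, and on some ancilla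
  qubits. Register \<open>r\<close> consists of the qubits \<open>r * n, \<dots>, r * n + n - 1\<close>; the ancillas are the qubits
  from \<open>j * n\<close> on. A computational basis state of \<open>m\<close> qubits is a number \<open>x < 2 ^ m\<close>, and qubit \<open>p\<close>
  is bit \<open>p\<close> of \<open>x\<close>.

  \<^item> \<open>Gate U qs\<close> applies the unitary \<open>U\<close> to the qubits \<open>qs\<close> (one or two, the head being the least
    significant one);
  \<^item> \<open>CSwap c r s\<close> swaps the whole \<open>n\<close>-qubit registers \<open>r\<close> and \<open>s\<close> if the control qubit \<open>c\<close> is set;
  \<^item> \<open>Meas q\<close> measures qubit \<open>q\<close> in the computational basis and appends the outcome to the record.

  A layer consists of operations on pairwise disjoint sets of qubits and is chosen, by free classical
  processing, depending on the record of all outcomes of the previous layers. The quantum depth is the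
  number of layers.
\<close>

datatype qop = Gate "complex mat" "nat list" | CSwap nat nat nat | Meas nat

datatype circuit = Circuit (ancillas: nat) (layers: "(bool list \<Rightarrow> qop list) list")

definition num_qubits :: "nat \<Rightarrow> nat \<Rightarrow> circuit \<Rightarrow> nat" where
  "num_qubits n j Q = j * n + ancillas Q"

definition depth :: "circuit \<Rightarrow> nat" where
  "depth Q = length (layers Q)"

definition is_cswap :: "qop \<Rightarrow> bool" where
  "is_cswap g \<longleftrightarrow> (\<exists>c r s. g = CSwap c r s)"

text \<open>The histories \<open>h l\<close> of different layers need not be consistent, so this bounds the number of
  controlled swaps in every run.\<close>

definition num_cswaps_le :: "circuit \<Rightarrow> nat \<Rightarrow> bool" where
  "num_cswaps_le Q B \<longleftrightarrow>
     (\<forall>h. (\<Sum>l<length (layers Q). length (filter is_cswap ((layers Q ! l) (h l)))) \<le> B)"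

fun qop_qubits :: "nat \<Rightarrow> qop \<Rightarrow> nat list" where
  "qop_qubits n (Gate U qs) = qs"
| "qop_qubits n (CSwap c r s) = c # [r * n ..< r * n + n] @ [s * n ..< s * n + n]"
| "qop_qubits n (Meas q) = [q]"

fun wf_qop :: "nat \<Rightarrow> qop \<Rightarrow> bool" where
  "wf_qop j (Gate U qs) \<longleftrightarrow> length qs \<in> {1, 2} \<and>
     U \<in> carrier_mat (2 ^ length qs) (2 ^ length qs) \<and> U * mat_adjoint U = 1\<^sub>m (2 ^ length qs)"
| "wf_qop j (CSwap c r s) \<longleftrightarrow> r < j \<and> s < j \<and> r \<noteq> s"
| "wf_qop j (Meas q) \<longleftrightarrow> True"

definition wf_layer :: "nat \<Rightarrow> nat \<Rightarrow> nat \<Rightarrow> qop list \<Rightarrow> bool" where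
  "wf_layer n j m gs \<longleftrightarrow> (\<forall>g \<in> set gs. wf_qop j g \<and> set (qop_qubits n g) \<subseteq> {..<m}) \<and>
     distinct (concat (map (qop_qubits n) gs))"

definition wf_circuit :: "nat \<Rightarrow> nat \<Rightarrow> circuit \<Rightarrow> bool" where
  "wf_circuit n j Q \<longleftrightarrow>
     (\<forall>L \<in> set (layers Q). \<forall>h. wf_layer n j (num_qubits n j Q) (L h)) \<and>
     layers Q \<noteq> [] \<and> (\<forall>h. \<exists>qs. qs \<noteq> [] \<and> last (layers Q) h = map Meas qs)"

subsection \<open>Semantics\<close>

definition sub_index :: "nat list \<Rightarrow> nat \<Rightarrow> nat" where
  "sub_index qs x = (\<Sum>i<length qs. of_bool (bit x (qs ! i)) * 2 ^ i)"

definition gate_mat :: "nat \<Rightarrow> complex mat \<Rightarrow> nat list \<Rightarrow> complex mat" where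
  "gate_mat m U qs = Matrix.mat (2 ^ m) (2 ^ m) (\<lambda>(x, y).
     if \<forall>p<m. p \<notin> set qs \<longrightarrow> bit x p = bit y p then U $$ (sub_index qs x, sub_index qs y) else 0)"

definition swap_pos :: "nat \<Rightarrow> nat \<Rightarrow> nat \<Rightarrow> nat \<Rightarrow> nat" where
  "swap_pos n r s p =
     (if p div n = r then s * n + p mod n else if p div n = s then r * n + p mod n else p)"

definition cswap_mat :: "nat \<Rightarrow> nat \<Rightarrow> nat \<Rightarrow> nat \<Rightarrow> nat \<Rightarrow> complex mat" where
  "cswap_mat n m c r s = Matrix.mat (2 ^ m) (2 ^ m) (\<lambda>(x, y).
     of_bool (\<forall>p<m. bit x p = bit y (if bit y c then swap_pos n r s p else p)))"

definition proj_mat :: "nat \<Rightarrow> nat \<Rightarrow> bool \<Rightarrow> complex mat" where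
  "proj_mat m q b = Matrix.mat (2 ^ m) (2 ^ m) (\<lambda>(x, y). of_bool (x = y \<and> bit x q = b))"

text \<open>A branch is a record of measurement outcomes together with the unnormalised density matrix
  obtained on these outcomes; the trace of the latter is the probability of the branch.\<close>

type_synonym branch = "bool list \<times> complex mat"

definition conj_by :: "complex mat \<Rightarrow> complex mat \<Rightarrow> complex mat" where
  "conj_by K \<sigma> = K * \<sigma> * mat_adjoint K"

fun exec_qop :: "nat \<Rightarrow> nat \<Rightarrow> qop \<Rightarrow> branch \<Rightarrow> branch list" where
  "exec_qop n m (Gate U qs) (h, \<sigma>) = [(h, conj_by (gate_mat m U qs) \<sigma>)]"
| "exec_qop n m (CSwap c r s) (h, \<sigma>) = [(h, conj_by (cswap_mat n m c r s) \<sigma>)]"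
| "exec_qop n m (Meas q) (h, \<sigma>) = map (\<lambda>b. (h @ [b], conj_by (proj_mat m q b) \<sigma>)) [False, True]"

fun exec_layer :: "nat \<Rightarrow> nat \<Rightarrow> qop list \<Rightarrow> branch \<Rightarrow> branch list" where
  "exec_layer n m [] br = [br]"
| "exec_layer n m (g # gs) br = concat (map (exec_layer n m gs) (exec_qop n m g br))"

fun exec_layers :: "nat \<Rightarrow> nat \<Rightarrow> (bool list \<Rightarrow> qop list) list \<Rightarrow> branch \<Rightarrow> branch list" where
  "exec_layers n m [] br = [br]"
| "exec_layers n m (L # Ls) br =
     concat (map (exec_layers n m Ls) (exec_layer n m (L (fst br)) br))"

text \<open>The tensor product of \<open>j\<close> copies of \<open>\<rho>\<close> and of \<open>a\<close> ancillas in the zero state; the bits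
  \<open>r * n, \<dots>, r * n + n - 1\<close> of an index are the index into the \<open>r\<close>-th factor.\<close>

definition init_state :: "nat \<Rightarrow> nat \<Rightarrow> nat \<Rightarrow> complex mat \<Rightarrow> complex mat" where
  "init_state n j a \<rho> = Matrix.mat (2 ^ (j * n + a)) (2 ^ (j * n + a)) (\<lambda>(x, y).
     (\<Prod>r<j. \<rho> $$ (take_bit n (drop_bit (r * n) x), take_bit n (drop_bit (r * n) y))) *
     of_bool (drop_bit (j * n) x = 0 \<and> drop_bit (j * n) y = 0))"

text \<open>Distribution of the record of measurement outcomes of one run.\<close>

definition run_pmf :: "nat \<Rightarrow> nat \<Rightarrow> circuit \<Rightarrow> complex mat \<Rightarrow> bool list pmf" where
  "run_pmf n j Q \<rho> = pmf_of_list (map (\<lambda>(h, \<sigma>). (h, Re (mtrace \<sigma>)))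
     (exec_layers n (num_qubits n j Q) (layers Q) ([], init_state n j (ancillas Q) \<rho>)))"

text \<open>Joint distribution of the records of independent runs, \<open>N j\<close> of them on the circuit \<open>Q j\<close> for
  each \<open>j = 1, \<dots>, t\<close>.\<close>

definition runs_pmf ::
  "nat \<Rightarrow> (nat \<Rightarrow> circuit) \<Rightarrow> complex mat \<Rightarrow> nat \<Rightarrow> (nat \<Rightarrow> nat) \<Rightarrow> (nat \<times> nat \<Rightarrow> bool list) pmf" where
  "runs_pmf n Q \<rho> t N =
     Pi_pmf (SIGMA j:{1..t}. {..<N j}) [] (\<lambda>(j, r). run_pmf n j (Q j) \<rho>)"

end

theory Submission
  imports Defs
begin

text \<open>
  Recovery. Let \<open>F\<close> and \<open>G\<close> be the polynomials \<open>\<Prod>(1 - x X)\<close> over the spectra of two states. Their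
  coefficients are bounded by \<open>1 / a!\<close>, and the power sums \<open>p i\<close> of the two spectra differ by at most \<open>i\<close> times the
  sum of the coefficient differences up to \<open>i\<close>. Above \<open>t\<close> these sum to at most \<open>2 / e^t\<close>, that is
  \<open>\<epsilon> / k\<close>. Below \<open>t\<close> they are read off from \<open>F / G = exp (- \<Sum>(p j - p' j) X^j / j)\<close>: power sums that agree up to
  \<open>\<eta>\<close> give a contribution of order \<open>\<eta> (1 / 2 + ... + 1 / t)\<close>, hence of order \<open>\<eta> ln t\<close>. So any two spectra
  consistent with the estimates have power sums at distance at most \<open>2 \<epsilon>\<close>, and the midpoint of the consistent values
  is an estimate within \<open>\<epsilon>\<close>.

  Circuit. A cyclic shift of \<open>j\<close> registers is the product of the two reflections \<open>r \<mapsto> j - 1 - r\<close> and \<open>r \<mapsto> - r mod j\<close>, each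
  a product of disjoint transpositions. No entangled control register is needed: give every transposition its own control
  qubit in the state \<open>|+>\<close> and measure all controls in the \<open>X\<close> basis. The expectation of the parity is the average over
  the control strings \<open>c\<close> of the trace of \<open>j\<close> copies of \<open>\<rho>\<close> against the permutation obtained by applying the swaps
  selected by \<open>c\<close> on one side and the remaining ones on the other side. This permutation is always conjugate to the
  cyclic shift, so each term is the trace of \<open>\<rho>^j\<close>. Hoeffding's inequality and a union bound then give the numbers of runs;
  the bound that is polylogarithmic in \<open>k\<close> alone skips the circuits with \<open>j > k\<close>.
\<close>

unbundle no vec_syntax
no_notation Matrix.vec_index (infixl "$" 100)
unbundle fps_syntax

section \<open>Stability of power sums\<close>

definition state_spectrum :: "real list \<Rightarrow> bool" where
  "state_spectrum l \<longleftrightarrow> (\<forall>x\<in>set l. 0 \<le> x) \<and> sum_list l = 1"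

definition power_sum :: "real list \<Rightarrow> nat \<Rightarrow> real" where
  "power_sum l i = (\<Sum>x\<leftarrow>l. x ^ i)"

text \<open>Coefficient \<open>a\<close> is \<open>(- 1) ^ a\<close> times the \<open>a\<close>-th
  elementary symmetric polynomial of the spectrum.\<close>

definition elem_fps :: "real list \<Rightarrow> real fps" where
  "elem_fps l = (\<Prod>x\<leftarrow>l. 1 - fps_const x * fps_X)"

text \<open>The shift by one makes this minus the logarithmic derivative of
  \<open>elem_fps l\<close>.\<close>

definition power_sum_fps :: "real list \<Rightarrow> real fps" where
  "power_sum_fps l = Abs_fps (\<lambda>m. power_sum l (Suc m))"

lemma elem_fps_Nil [simp]: "elem_fps [] = 1"
  by (simp add: elem_fps_def)

lemma elem_fps_Cons: "elem_fps (x # l) = (1 - fps_const x * fps_X) * elem_fps l"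
  by (simp add: elem_fps_def)

lemma elem_fps_nth_0 [simp]: "elem_fps l $ 0 = 1"
  by (induction l) (auto simp: elem_fps_Cons)

lemma elem_fps_Cons_nth_Suc:
  "elem_fps (x # l) $ Suc a = elem_fps l $ Suc a - x * elem_fps l $ a"
  by (simp add: elem_fps_Cons left_diff_distrib mult.assoc)

text \<open>The expansion of \<open>sum_list l ^ a\<close> contains every squarefree monomial
  \<open>fact a\<close> times. In the induction the bounds for the degrees \<open>Suc b\<close> and
  \<open>b\<close> add up, after division by the factorial, to two terms of the binomial expansion
  of \<open>(sum_list l + x) ^ Suc b\<close>.\<close>

lemma elem_fps_nth_bounds:
  assumes "\<forall>x\<in>set l. 0 \<le> x"
  shows "0 \<le> (- 1) ^ a * elem_fps l $ a \<and> (- 1) ^ a * elem_fps l $ a \<le> sum_list l ^ a / fact a"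
  using assms
proof (induction l arbitrary: a)
  case Nil
  then show ?case by (cases a) auto
next
  case (Cons x l)
  have s: "0 \<le> sum_list l" using Cons.prems by (auto intro: sum_list_nonneg)
  show ?case
  proof (cases a)
    case (Suc b)
    let ?f = "\<lambda>a. (- 1) ^ a * elem_fps l $ a"
    have IH: "0 \<le> ?f a \<and> ?f a \<le> sum_list l ^ a / fact a" for a using Cons by simp
    have eq: "(- 1) ^ a * elem_fps (x # l) $ a = ?f (Suc b) + x * ?f b"
      by (simp add: Suc elem_fps_Cons_nth_Suc algebra_simps)
    have x: "0 \<le> x" using Cons.prems by simp
    have "?f (Suc b) + x * ?f b \<le> sum_list l ^ Suc b / fact (Suc b) + x * (sum_list l ^ b / fact b)"
      using IH[of "Suc b"] IH[of b] x by (intro add_mono mult_left_mono) auto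
    also have "\<dots> = (sum_list l ^ Suc b + real (Suc b) * x * sum_list l ^ b) / fact (Suc b)"
      by (simp add: field_simps del: of_nat_Suc)
    also have "\<dots> \<le> (sum_list l + x) ^ Suc b / fact (Suc b)"
    proof (intro divide_right_mono)
      have "(\<Sum>k\<in>{b, Suc b}. real (Suc b choose k) * sum_list l ^ k * x ^ (Suc b - k))
          \<le> (\<Sum>k\<le>Suc b. real (Suc b choose k) * sum_list l ^ k * x ^ (Suc b - k))"
        using s x by (intro sum_mono2) auto
      then show "sum_list l ^ Suc b + real (Suc b) * x * sum_list l ^ b \<le> (sum_list l + x) ^ Suc b"
        by (subst binomial_ring) (simp add: algebra_simps)
    qed simp
    finally have "?f (Suc b) + x * ?f b \<le> (x + sum_list l) ^ a / fact a"
      by (simp only: Suc add.commute[of x])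
    moreover have "0 \<le> ?f (Suc b) + x * ?f b"
      using IH[of "Suc b"] IH[of b] x by (intro add_nonneg_nonneg mult_nonneg_nonneg[of x]) blast+
    ultimately show ?thesis unfolding eq by simp
  qed auto
qed

lemma abs_elem_fps_nth_le:
  assumes "state_spectrum l"
  shows "\<bar>elem_fps l $ a\<bar> \<le> 1 / fact a"
proof -
  have "\<bar>elem_fps l $ a\<bar> = \<bar>(- 1) ^ a * elem_fps l $ a\<bar>" by (simp add: abs_mult)
  also have "\<dots> \<le> 1 / fact a"
    using elem_fps_nth_bounds[of l a] assms by (auto simp: state_spectrum_def)
  finally show ?thesis .
qed

text \<open>Multiplied by \<open>(- 1) ^ a\<close>, both coefficients lie between 0 and
  \<open>1 / fact a\<close>, so no factor 2 arises.\<close>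

lemma abs_diff_elem_fps_nth_le:
  assumes "state_spectrum l" "state_spectrum l'"
  shows "\<bar>elem_fps l $ a - elem_fps l' $ a\<bar> \<le> 1 / fact a"
proof -
  have "\<bar>elem_fps l $ a - elem_fps l' $ a\<bar> = \<bar>(- 1) ^ a * elem_fps l $ a - (- 1) ^ a * elem_fps l' $ a\<bar>"
    by (simp add: abs_mult flip: right_diff_distrib)
  also have "\<dots> \<le> 1 / fact a"
    using elem_fps_nth_bounds[of l a] elem_fps_nth_bounds[of l' a] assms by (auto simp: state_spectrum_def)
  finally show ?thesis .
qed

text \<open>The coefficients of the inverse are the complete homogeneous symmetric polynomials, and
  each of their monomials occurs in \<open>sum_list l ^ m\<close>. The proof uses the recursion that
  results from cancelling the factor of \<open>x\<close>.\<close>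

lemma inverse_elem_fps_nth_bounds:
  assumes "\<forall>x\<in>set l. 0 \<le> x"
  shows "0 \<le> inverse (elem_fps l) $ m \<and> inverse (elem_fps l) $ m \<le> sum_list l ^ m"
  using assms
proof (induction l arbitrary: m)
  case Nil
  then show ?case by (cases m) auto
next
  case (Cons x l)
  let ?H = "inverse (elem_fps l)" and ?H' = "inverse (elem_fps (x # l))"
  have s: "0 \<le> sum_list l" "0 \<le> x" using Cons.prems by (auto intro: sum_list_nonneg)
  have "?H' * elem_fps (x # l) = 1" by (rule inverse_mult_eq_1) simp
  then have "?H' * (1 - fps_const x * fps_X) * elem_fps l * ?H = ?H"
    by (simp add: elem_fps_Cons mult_ac)
  moreover have "elem_fps l * ?H = 1" by (rule inverse_mult_eq_1') simp
  ultimately have H: "?H' * (1 - fps_const x * fps_X) = ?H"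
    by (simp add: mult.assoc)
  have rec: "?H' $ Suc m = ?H $ Suc m + x * ?H' $ m" for m
  proof -
    have "?H = ?H' - fps_const x * (fps_X * ?H')" by (simp add: algebra_simps flip: H)
    then show ?thesis by simp
  qed
  show ?case
  proof (induction m)
    case (Suc m)
    have IH: "0 \<le> ?H $ Suc m \<and> ?H $ Suc m \<le> sum_list l ^ Suc m"
      using Cons.IH[of "Suc m"] Cons.prems by auto
    have "?H' $ Suc m \<le> sum_list l ^ Suc m + x * (x + sum_list l) ^ m"
      unfolding rec using IH Suc s by (intro add_mono mult_left_mono) auto
    also have "\<dots> \<le> sum_list l * (x + sum_list l) ^ m + x * (x + sum_list l) ^ m"
      using s by (auto intro!: mult_left_mono power_mono)
    finally show ?case using IH Suc s by (auto simp: rec algebra_simps)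
  qed auto
qed

lemma abs_inverse_elem_fps_nth_le:
  assumes "state_spectrum l"
  shows "\<bar>inverse (elem_fps l) $ m\<bar> \<le> 1"
  using inverse_elem_fps_nth_bounds[of l m] assms by (auto simp: state_spectrum_def)

text \<open>The entry \<open>x\<close> contributes the geometric series
  \<open>x / (1 - x X)\<close>, here cleared of its denominator.\<close>

lemma power_sum_fps_Cons:
  "(1 - fps_const x * fps_X) * power_sum_fps (x # l) = fps_const x + (1 - fps_const x * fps_X) * power_sum_fps l"
proof (rule fps_ext)
  fix n show "((1 - fps_const x * fps_X) * power_sum_fps (x # l)) $ n = (fps_const x + (1 - fps_const x * fps_X) * power_sum_fps l) $ n"
    by (cases n) (auto simp: power_sum_fps_def power_sum_def left_diff_distrib mult.assoc algebra_simps)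
qed

text \<open>Newton's identities as a differential equation, by the product rule along the
  list.\<close>

lemma fps_deriv_elem_fps: "fps_deriv (elem_fps l) = - power_sum_fps l * elem_fps l"
proof (induction l)
  case Nil
  have "power_sum_fps [] = 0" by (rule fps_ext) (simp add: power_sum_fps_def power_sum_def)
  then show ?case by simp
next
  case (Cons x l)
  let ?c = "1 - fps_const x * fps_X :: real fps"
  have "fps_deriv (elem_fps (x # l)) = - (fps_const x + ?c * power_sum_fps l) * elem_fps l"
    by (simp add: elem_fps_Cons Cons algebra_simps)
  also have "\<dots> = - (?c * power_sum_fps (x # l)) * elem_fps l"
    unfolding power_sum_fps_Cons ..
  finally show ?case by (simp add: elem_fps_Cons mult_ac)
qed

lemma power_sum_bounds:
  assumes "state_spectrum l" "1 \<le> i"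
  shows "0 \<le> power_sum l i" "power_sum l i \<le> 1"
proof -
  have pos: "0 \<le> x" and le: "x \<le> 1" if "x \<in> set l" for x
    using assms that member_le_sum_list[of x l] by (auto simp: state_spectrum_def)
  show "0 \<le> power_sum l i" unfolding power_sum_def using pos by (intro sum_list_nonneg) auto
  have "power_sum l i \<le> (\<Sum>x\<leftarrow>l. x)"
    unfolding power_sum_def
  proof (intro sum_list_mono)
    fix x assume "x \<in> set l"
    then show "x ^ i \<le> x" using pos[of x] le[of x] power_decreasing[of 1 i x] assms by auto
  qed
  then show "power_sum l i \<le> 1" using assms by (simp add: state_spectrum_def)
qed

lemma power_sum_1 [simp]: "state_spectrum l \<Longrightarrow> power_sum l (Suc 0) = 1"
  by (simp add: power_sum_def state_spectrum_def)

section \<open>Stability of all power sums under perturbation of the first \<open>t\<close> of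
  them\<close>

lemma sum_abs_fps_mult_le:
  fixes f g :: "real fps"
  shows "(\<Sum>a\<le>t. \<bar>(f * g) $ a\<bar>) \<le> (\<Sum>a\<le>t. \<bar>f $ a\<bar>) * (\<Sum>a\<le>t. \<bar>g $ a\<bar>)"
proof -
  have "(\<Sum>a\<le>t. \<bar>(f * g) $ a\<bar>) \<le> (\<Sum>a\<le>t. \<Sum>i\<le>a. \<bar>f $ i\<bar> * \<bar>g $ (a - i)\<bar>)"
    by (intro sum_mono) (auto simp: fps_mult_nth atLeast0AtMost abs_mult intro: order_trans[OF sum_abs])
  also have "\<dots> = (\<Sum>(i, j)\<in>{(i, j). i + j \<le> t}. \<bar>f $ i\<bar> * \<bar>g $ j\<bar>)"
    by (rule sum.triangle_reindex_eq[symmetric])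
  \<comment> \<open>The triangle of index pairs is enlarged to the square, on which the sum
    factorises.\<close>
  also have "\<dots> \<le> (\<Sum>(i, j)\<in>{..t} \<times> {..t}. \<bar>f $ i\<bar> * \<bar>g $ j\<bar>)"
    by (intro sum_mono2) auto
  finally show ?thesis by (simp add: sum_product sum.cartesian_product)
qed

text \<open>If \<open>D\<close> is the difference of the generating functions \<open>F\<close>, \<open>G\<close> and \<open>P\<close>, \<open>Q\<close> are the power sum series,
  then \<open>(P - Q) F = - (D' + Q D)\<close>, and the coefficients of \<open>1 / F\<close> lie in the unit interval.\<close>

lemma abs_power_sum_diff_le:
  assumes "state_spectrum l" "state_spectrum l'"
  shows "\<bar>power_sum l (Suc i) - power_sum l' (Suc i)\<bar>
    \<le> real (Suc i) * (\<Sum>a\<le>Suc i. \<bar>elem_fps l $ a - elem_fps l' $ a\<bar>)"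
proof -
  let ?F = "elem_fps l" and ?G = "elem_fps l'"
  let ?P = "power_sum_fps l" and ?Q = "power_sum_fps l'"
  define D where "D = ?F - ?G"
  define W where "W = fps_deriv D + ?Q * D"
  have "(?P - ?Q) * ?F = - W"
    unfolding W_def D_def by (simp add: fps_deriv_elem_fps algebra_simps)
  then have "(?P - ?Q) * (?F * inverse ?F) = - (W * inverse ?F)"
    by (simp flip: mult.assoc)
  then have PQ: "?P - ?Q = - (W * inverse ?F)"
    by (simp add: inverse_mult_eq_1')
  have W: "\<bar>W $ m\<bar> \<le> real (Suc m) * \<bar>D $ Suc m\<bar> + (\<Sum>a\<le>m. \<bar>D $ a\<bar>)" for m
  proof -
    have "\<bar>(D * ?Q) $ m\<bar> \<le> (\<Sum>a\<le>m. \<bar>D $ a * ?Q $ (m - a)\<bar>)"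
      by (simp add: fps_mult_nth atLeast0AtMost)
    also have "\<dots> \<le> (\<Sum>a\<le>m. \<bar>D $ a\<bar>)"
      using power_sum_bounds[OF assms(2)]
      by (intro sum_mono) (auto simp: power_sum_fps_def abs_mult intro!: mult_left_le)
    finally show ?thesis unfolding W_def by (simp add: mult.commute[of ?Q] abs_mult abs_triangle_ineq[THEN order_trans])
  qed
  have "\<bar>power_sum l (Suc i) - power_sum l' (Suc i)\<bar> = \<bar>(?P - ?Q) $ i\<bar>"
    by (simp add: power_sum_fps_def)
  also have "\<dots> \<le> (\<Sum>m\<le>i. \<bar>W $ m * inverse ?F $ (i - m)\<bar>)"
    unfolding PQ by (simp add: fps_mult_nth atLeast0AtMost)
  also have "\<dots> \<le> (\<Sum>m\<le>i. \<bar>W $ m\<bar>)"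
    using abs_inverse_elem_fps_nth_le[OF assms(1)]
    by (intro sum_mono) (auto simp: abs_mult intro!: mult_left_le)
  also have "\<dots> \<le> (\<Sum>m\<le>i. real (Suc m) * \<bar>D $ Suc m\<bar> + (\<Sum>a\<le>m. \<bar>D $ a\<bar>))"
    by (intro sum_mono W)
  \<comment> \<open>The term for \<open>a\<close> is counted \<open>a\<close> times by the first
    summands and \<open>Suc i - a\<close> times by the inner sums.\<close>
  also have "\<dots> = real (Suc i) * (\<Sum>a\<le>Suc i. \<bar>D $ a\<bar>)"
    by (induction i) (auto simp: D_def algebra_simps)
  finally show ?thesis by (simp add: D_def)
qed

text \<open>Here \<open>R = F / G\<close> and \<open>d = Q - P\<close>.\<close>

lemma sum_abs_ratio_le:
  fixes R d :: "real fps"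
  assumes R: "fps_deriv R = d * R" "R $ 0 = 1" and d0: "d $ 0 = 0"
    and d: "\<And>j. j < t \<Longrightarrow> \<bar>d $ j\<bar> \<le> \<eta>"
    and L: "(\<Sum>a=2..t. 1 / real a) \<le> L" "\<eta> * L < 1" "0 \<le> \<eta>"
  shows "(\<Sum>a=1..t. \<bar>R $ a\<bar>) \<le> \<eta> * L / (1 - \<eta> * L)"
proof -
  let ?S = "\<Sum>a=1..t. \<bar>R $ a\<bar>"
  have S0: "0 \<le> ?S" by (intro sum_nonneg) auto
  \<comment> \<open>Comparing coefficients in the differential equation expresses
    \<open>R $ a\<close> by earlier coefficients; the division by \<open>a\<close> is the source of
    the harmonic sum.\<close>
  have Ra: "real a * R $ a = (\<Sum>b\<le>a-1. d $ b * R $ (a - 1 - b))" if "1 \<le> a" for a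
    using that arg_cong[OF R(1), of "\<lambda>f. f $ (a - 1)"] by (simp add: fps_mult_nth atLeast0AtMost)
  have bnd: "\<bar>R $ a\<bar> \<le> 1 / real a * (\<eta> * (1 + ?S))" if a: "1 \<le> a" "a \<le> t" for a
  proof -
    have "real a * \<bar>R $ a\<bar> = \<bar>\<Sum>b\<le>a-1. d $ b * R $ (a - 1 - b)\<bar>"
      using Ra[OF a(1)] by (metis abs_mult abs_of_nat)
    also have "\<dots> \<le> (\<Sum>b\<le>a-1. \<eta> * \<bar>R $ (a - 1 - b)\<bar>)"
      using a d by (intro order_trans[OF sum_abs] sum_mono) (auto simp: abs_mult intro!: mult_right_mono)
    also have "\<dots> = \<eta> * (\<Sum>b\<le>a-1. \<bar>R $ (a - 1 - b)\<bar>)" by (simp add: sum_distrib_left)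
    also have "\<dots> \<le> \<eta> * (1 + ?S)"
    proof (rule mult_left_mono[OF _ L(3)])
    have "(\<Sum>b\<le>a-1. \<bar>R $ (a - 1 - b)\<bar>) = (\<Sum>b\<le>a-1. \<bar>R $ b\<bar>)"
    proof -
      have "{..a - 1} = {..<a}" using a by auto
      then show ?thesis using sum.nat_diff_reindex[of "\<lambda>b. \<bar>R $ b\<bar>" a] by simp
    qed
    also have "\<dots> \<le> (\<Sum>b\<in>insert 0 {1..t}. \<bar>R $ b\<bar>)"
      using a by (intro sum_mono2) auto
      finally show "(\<Sum>b\<le>a-1. \<bar>R $ (a - 1 - b)\<bar>) \<le> 1 + ?S" using R by simp
    qed
    finally show ?thesis using a L by (simp add: field_simps)
  qed
  \<comment> \<open>\<open>d $ 0 = 0\<close> reflects that both spectra have sum 1. It removes the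
    term \<open>a = 1\<close>, so that the harmonic sum starts at 2.\<close>
  have R1: "R $ 1 = 0" using Ra[of 1] d0 by simp
  have "?S = (\<Sum>a=2..t. \<bar>R $ a\<bar>)"
  proof (rule sum.mono_neutral_right)
    show "\<forall>a\<in>{1..t} - {2..t}. \<bar>R $ a\<bar> = 0"
    proof
      fix a assume "a \<in> {1..t} - {2..t}"
      then have "a = 1" by auto
      then show "\<bar>R $ a\<bar> = 0" using R1 by simp
    qed
  qed auto
  also have "\<dots> \<le> (\<Sum>a=2..t. 1 / real a * (\<eta> * (1 + ?S)))"
    by (intro sum_mono bnd) auto
  also have "\<dots> = (\<Sum>a=2..t. 1 / real a) * (\<eta> * (1 + ?S))" by (rule sum_distrib_right[symmetric])
  \<comment> \<open>The resulting inequality \<open>?S \<le> L * (\<eta> * (1 + ?S))\<close> is then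
    solved for \<open>?S\<close>.\<close>
  also have "\<dots> \<le> L * (\<eta> * (1 + ?S))"
    using L S0 by (intro mult_right_mono) auto
  finally show ?thesis using L by (simp add: field_simps)
qed

text \<open>Telescoping with \<open>1 / (n + 1) \<le> ln (n + 1) - ln n\<close>; as the sum starts
  at 2, no additive constant appears.\<close>

lemma sum_inverse_le_ln: "1 \<le> t \<Longrightarrow> (\<Sum>a=2..t. 1 / real a) \<le> ln (real t)"
proof (induction t rule: nat_induct_at_least)
  case (Suc n)
  have "ln (real n / real (Suc n)) \<le> real n / real (Suc n) - 1"
    using Suc by (intro ln_le_minus_one) auto
  also have "\<dots> = - 1 / real (Suc n)" by (simp add: field_simps)
  finally have "1 / real (Suc n) \<le> ln (real (Suc n)) - ln (real n)"
    using Suc by (simp add: ln_div)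
  then show ?case using Suc by simp
qed simp

text \<open>Equality holds at \<open>a = 3\<close>; afterwards the left side grows by the factor 4
  and the right side by at least 4.\<close>

lemma power4_le_fact: "3 \<le> a \<Longrightarrow> 3 * 4 ^ a \<le> (32 * fact a :: real)"
proof (induction a rule: nat_induct_at_least)
  case base
  then show ?case by (simp add: fact_numeral)
next
  case (Suc n)
  have "3 * 4 ^ Suc n \<le> (4 * (32 * fact n) :: real)" using Suc by simp
  also have "\<dots> \<le> real (Suc n) * (32 * fact n)" using Suc by (intro mult_right_mono) auto
  finally show ?case by simp
qed

text \<open>Comparison with a geometric series of ratio 1/4. The bound is put in powers of 3 because
  \<open>exp 1 \<le> 3\<close>, which later makes \<open>3 ^ t\<close> at least
  \<open>2 k / \<epsilon>\<close>.\<close>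

lemma sum_inverse_fact_le:
  assumes "3 \<le> t"
  shows "(\<Sum>a=Suc t..n. 1 / fact a) \<le> (2 / 3 ^ t :: real)"
proof -
  \<comment> \<open>The subtracted term is the geometric remainder beyond \<open>n\<close>; with it
    the bound passes through the induction on \<open>n\<close>.\<close>
  have "(\<Sum>a=Suc t..n. 1 / fact a) \<le> (32 / 9 / 4 ^ t - (if n \<le> t then 0 else 32 / 9 / 4 ^ n) :: real)"
  proof (induction n)
    case (Suc n)
    show ?case
    proof (cases "t \<le> n")
      case True
      have "(1 / fact (Suc n) :: real) \<le> 32 / 3 / 4 ^ Suc n"
        using power4_le_fact[of "Suc n"] True assms by (simp add: field_simps del: fact_Suc power_Suc)
      then show ?thesis using Suc True by (cases "n = t") (auto simp del: fact_Suc)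
    qed (use Suc in auto)
  qed auto
  also have "\<dots> \<le> 32 / 9 / 4 ^ t" by simp
  also have "\<dots> \<le> 2 / 3 ^ t"
  proof -
    have "(16 / 9 :: real) \<le> (4 / 3) ^ 3" by (simp add: power3_eq_cube)
    also have "\<dots> \<le> (4 / 3) ^ t" using assms by (intro power_increasing) auto
    finally show ?thesis by (simp add: field_simps power_divide)
  qed
  finally show ?thesis .
qed

text \<open>A rational bound for e, from 8/3 + 2/27. The value 11/4 cancels against the 12/11 in
  \<open>power_sum_stability\<close>.\<close>

lemma sum_inverse_fact_le': "(\<Sum>a\<le>n. 1 / fact a) \<le> (11 / 4 :: real)"
proof -
  have "(\<Sum>a\<le>n. 1 / fact a) \<le> (\<Sum>a\<in>{..3} \<union> {Suc 3..n}. 1 / fact a :: real)"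
    by (intro sum_mono2) auto
  also have "\<dots> = (\<Sum>a\<le>3. 1 / fact a) + (\<Sum>a=Suc 3..n. 1 / fact a)"
    by (intro sum.union_disjoint) auto
  also have "(\<Sum>a\<le>3. 1 / fact a :: real) = 8 / 3" by (simp add: numeral_eq_Suc)
  also have "(\<Sum>a=Suc 3..n. 1 / fact a :: real) \<le> 2 / 3 ^ 3" by (rule sum_inverse_fact_le) simp
  finally show ?thesis by (simp add: power3_eq_cube)
qed

text \<open>By \<open>abs_power_sum_diff_le\<close> it suffices to sum the coefficient differences.
  Up to \<open>t\<close> they come from \<open>?F - ?G = ?G * (R - 1)\<close>, which gives 11/4
  times 12/11, that is 3, times \<open>u\<close>; above \<open>t\<close> the factorial bound gives
  the exponentially small term.\<close>

lemma power_sum_stability: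
  assumes l: "state_spectrum l" "state_spectrum l'" and t: "3 \<le> t" and i: "1 \<le> i"
    and \<eta>: "\<And>j. j \<in> {1..t} \<Longrightarrow> \<bar>power_sum l j - power_sum l' j\<bar> \<le> \<eta>"
    and small: "12 * (\<eta> * ln (real t)) \<le> 1"
  shows "\<bar>power_sum l i - power_sum l' i\<bar> \<le> real i * (3 * (\<eta> * ln (real t)) + 2 / 3 ^ t)"
proof -
  let ?F = "elem_fps l" and ?G = "elem_fps l'"
  define R where "R = ?F * inverse ?G"
  define d where "d = power_sum_fps l' - power_sum_fps l"
  define u where "u = \<eta> * ln (real t)"
  have GG: "?G * inverse ?G = 1" by (rule inverse_mult_eq_1') simp
  have GR: "?G * R = ?F" using GG by (simp add: R_def mult_ac)
  have "fps_deriv (?G * R) = - power_sum_fps l * (?G * R)" by (simp only: GR fps_deriv_elem_fps)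
  then have "?G * fps_deriv R = ?G * (d * R)"
    by (simp add: fps_deriv_elem_fps d_def algebra_simps)
  then have dR: "fps_deriv R = d * R"
  proof -
    have "?G \<noteq> 0" by (metis elem_fps_nth_0 fps_zero_nth zero_neq_one)
    then show ?thesis using \<open>?G * fps_deriv R = _\<close> by simp
  qed
  have \<eta>0: "0 \<le> \<eta>" using \<eta>[of 1] t by force
  then have u: "0 \<le> u" "u \<le> 1 / 12" using t small by (auto simp: u_def)
  have S: "(\<Sum>a=1..t. \<bar>R $ a\<bar>) \<le> u / (1 - u)"
    unfolding u_def
  proof (rule sum_abs_ratio_le[OF dR])
    show "R $ 0 = 1" by (simp add: R_def)
    show "d $ 0 = 0" using l by (simp add: d_def power_sum_fps_def)
    show "\<bar>d $ j\<bar> \<le> \<eta>" if "j < t" for j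
      using \<eta>[of "Suc j"] that by (simp add: d_def power_sum_fps_def abs_minus_commute)
    show "(\<Sum>a=2..t. 1 / real a) \<le> ln (real t)" using sum_inverse_le_ln t by simp
  qed (use u \<eta>0 in \<open>auto simp: u_def\<close>)
  \<comment> \<open>Since \<open>u \<le> 1 / 12\<close>, the denominator is at least 11/12.\<close>
  also have "\<dots> \<le> 12 / 11 * u" using u mult_left_mono[of "12*u" 1 u] by (simp add: field_simps)
  finally have S: "(\<Sum>a=1..t. \<bar>R $ a\<bar>) \<le> 12 / 11 * u" .
  have "(\<Sum>a\<le>t. \<bar>(R - 1) $ a\<bar>) = (\<Sum>a=1..t. \<bar>R $ a\<bar>)"
    by (rule sum.mono_neutral_cong_right) (auto simp: R_def)
  then have "(\<Sum>a\<le>t. \<bar>(?G * (R - 1)) $ a\<bar>) \<le> (\<Sum>a\<le>t. \<bar>?G $ a\<bar>) * (\<Sum>a=1..t. \<bar>R $ a\<bar>)"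
    using sum_abs_fps_mult_le[of ?G "R - 1" t] by simp
  also have "\<dots> \<le> 11 / 4 * (12 / 11 * u)"
    using abs_elem_fps_nth_le[OF l(2)]
    by (intro mult_mono S order_trans[OF sum_mono sum_inverse_fact_le']) (auto intro: sum_nonneg)
  finally have bound: "(\<Sum>a\<le>t. \<bar>(?G * (R - 1)) $ a\<bar>) \<le> 11 / 4 * (12 / 11 * u)" .
  have low: "(\<Sum>a\<le>t. \<bar>?F $ a - ?G $ a\<bar>) \<le> 3 * u"
  proof -
    have "?G * (R - 1) = ?F - ?G" by (simp add: right_diff_distrib GR)
    then show ?thesis using bound by simp
  qed
  have "(\<Sum>a\<le>i. \<bar>?F $ a - ?G $ a\<bar>) \<le> (\<Sum>a\<in>{..t} \<union> {Suc t..i}. \<bar>?F $ a - ?G $ a\<bar>)"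
    by (intro sum_mono2) auto
  also have "\<dots> = (\<Sum>a\<le>t. \<bar>?F $ a - ?G $ a\<bar>) + (\<Sum>a=Suc t..i. \<bar>?F $ a - ?G $ a\<bar>)"
    by (intro sum.union_disjoint) auto
  also have "\<dots> \<le> 3 * u + 2 / 3 ^ t"
    using abs_diff_elem_fps_nth_le[OF l]
    by (intro add_mono low order_trans[OF sum_mono sum_inverse_fact_le[OF t]]) auto
  finally have "(\<Sum>a\<le>i. \<bar>?F $ a - ?G $ a\<bar>) \<le> 3 * u + 2 / 3 ^ t" .
  then have b: "real i * (\<Sum>a\<le>i. \<bar>?F $ a - ?G $ a\<bar>) \<le> real i * (3 * u + 2 / 3 ^ t)"
    by (intro mult_left_mono) auto
  have a: "\<bar>power_sum l i - power_sum l' i\<bar> \<le> real i * (\<Sum>a\<le>i. \<bar>?F $ a - ?G $ a\<bar>)"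
    using abs_power_sum_diff_le[OF l, of "i - 1"] i by simp
  show ?thesis by (rule order_trans[OF a b[unfolded u_def]])
qed

unbundle no fps_syntax
unbundle vec_syntax
notation Matrix.vec_index (infixl "$" 100)

section \<open>Recovery of the higher power traces\<close>

text \<open>\<open>Sup S - Inf S \<le> 2 * e\<close>, and \<open>x\<close> lies between the two; so
  the midpoint is off by at most half of this.\<close>

lemma midpoint_close:
  fixes S :: "real set"
  assumes "x \<in> S" and S: "\<And>x y. x \<in> S \<Longrightarrow> y \<in> S \<Longrightarrow> \<bar>x - y\<bar> \<le> 2 * e"
  shows "\<bar>(Inf S + Sup S) / 2 - x\<bar> \<le> e"
proof -
  have bdd: "bdd_above S" "bdd_below S"
    using S[OF _ assms(1)]
    by (auto intro!: bdd_aboveI[of _ "x + 2 * e"] bdd_belowI[of _ "x - 2 * e"] simp: abs_le_iff algebra_simps)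
  have "Sup S \<le> y + 2 * e" if "y \<in> S" for y
  proof (rule cSup_least)
    show "z \<le> y + 2 * e" if "z \<in> S" for z using S[OF that \<open>y \<in> S\<close>] by linarith
  qed (use assms(1) in auto)
  then have "Sup S - 2 * e \<le> Inf S"
    using assms(1) by (intro cInf_greatest) (auto simp: diff_le_eq)
  moreover have "Inf S \<le> x" "x \<le> Sup S"
    using assms(1) bdd by (auto intro: cInf_lower cSup_upper)
  ultimately have "(Inf S + Sup S) / 2 - x \<le> e" "- e \<le> (Inf S + Sup S) / 2 - x" by argo+
  then show ?thesis by linarith
qed

text \<open>Optimal recovery: the centre of the set of the values that are consistent with the data, over spectra
  of any length, so that the recovery does not depend on the dimension.\<close>

definition central_power_sum :: "nat set \<Rightarrow> (nat \<Rightarrow> real \<Rightarrow> bool) \<Rightarrow> (nat \<Rightarrow> real) \<Rightarrow> nat \<Rightarrow> real" where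
  "central_power_sum J tol q i =
     (let S = {power_sum l i |l. state_spectrum l \<and> (\<forall>j\<in>J. tol j \<bar>q j - power_sum l j\<bar>)} in (Inf S + Sup S) / 2)"

text \<open>The true spectrum is itself consistent with the data, hence its power sum belongs to the
  set whose midpoint is taken.\<close>

lemma central_power_sum_close:
  assumes "state_spectrum l" "\<forall>j\<in>J. tol j \<bar>q j - power_sum l j\<bar>"
    and "\<And>l l'. state_spectrum l \<Longrightarrow> state_spectrum l' \<Longrightarrow>
      (\<forall>j\<in>J. tol j \<bar>q j - power_sum l j\<bar>) \<Longrightarrow> (\<forall>j\<in>J. tol j \<bar>q j - power_sum l' j\<bar>) \<Longrightarrow>
      \<bar>power_sum l i - power_sum l' i\<bar> \<le> 2 * e"
  shows "\<bar>central_power_sum J tol q i - power_sum l i\<bar> \<le> e"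
  unfolding central_power_sum_def Let_def by (rule midpoint_close) (use assms in auto)

section \<open>Truncation index and error budget\<close>

lemma trunc_index_ge_3:
  assumes "2 \<le> k" "0 < \<epsilon>" "\<epsilon> < 1 / 2"
  shows "3 \<le> trunc_index k \<epsilon>"
proof -
  \<comment> \<open>The threshold 8 serves since \<open>ln 8 = 3 * ln 2\<close> is at least 2,
    whence the ceiling exceeds 2.\<close>
  have "8 < 2 * real k / \<epsilon>" using assms by (simp add: field_simps)
  then have "ln 8 < ln (2 * real k / \<epsilon>)" by (subst ln_less_cancel_iff) auto
  moreover have "ln (8 :: real) = 3 * ln 2" using ln_realpow[of 2 3] by simp
  ultimately have "2 < ln (2 * real k / \<epsilon>)" using ln2_ge_two_thirds by simp
  then show ?thesis unfolding trunc_index_def by linarith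
qed

lemma exp_trunc_index_ge:
  assumes "1 \<le> k" "0 < \<epsilon>"
  shows "2 * real k / \<epsilon> \<le> exp (real (trunc_index k \<epsilon>))"
proof -
  have "ln (2 * real k / \<epsilon>) \<le> real (trunc_index k \<epsilon>)" unfolding trunc_index_def by linarith
  then have "exp (ln (2 * real k / \<epsilon>)) \<le> exp (real (trunc_index k \<epsilon>))" by simp
  then show ?thesis using assms by simp
qed

text \<open>For \<open>k = 1\<close> only the trace itself occurs, and for
  \<open>\<epsilon> \<ge> 1 / 2\<close> any two numbers of the unit interval are close enough. In
  the remaining range \<open>t \<ge> 3\<close>, and both terms of \<open>power_sum_stability\<close>
  are at most \<open>\<epsilon>\<close> after multiplication by \<open>k\<close>.\<close>

lemma power_sum_diff_le:
  assumes l: "state_spectrum l" "state_spectrum l'" and i: "1 \<le> i" "i \<le> k" and \<epsilon>: "0 < \<epsilon>"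
    and \<eta>: "\<And>j. 3 \<le> trunc_index k \<epsilon> \<Longrightarrow> j \<in> {1..trunc_index k \<epsilon>} \<Longrightarrow> \<bar>power_sum l j - power_sum l' j\<bar> \<le> \<eta>"
    and small: "2 \<le> k \<Longrightarrow> \<epsilon> < 1 / 2 \<Longrightarrow> 3 * real k * (\<eta> * ln (real (trunc_index k \<epsilon>))) \<le> \<epsilon>"
  shows "\<bar>power_sum l i - power_sum l' i\<bar> \<le> 2 * \<epsilon>"
proof -
  consider "k < 2" | "1 / 2 \<le> \<epsilon>" | "2 \<le> k" "\<epsilon> < 1 / 2" by linarith
  then show ?thesis
  proof cases
    case 1
    then have "i = 1" using i by simp
    then show ?thesis using l \<epsilon> by simp
  next
    case 2
    then show ?thesis using power_sum_bounds[OF l(1) i(1)] power_sum_bounds[OF l(2) i(1)] by linarith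
  next
    case 3
    define t where "t = trunc_index k \<epsilon>"
    have t: "3 \<le> t" using trunc_index_ge_3 3 \<epsilon> by (simp add: t_def)
    have k: "1 \<le> k" using 3 by simp
    define u where "u = \<eta> * ln (real t)"
    have u: "3 * (real k * u) \<le> \<epsilon>" using small 3 by (simp add: u_def t_def)
    have "0 \<le> \<eta>" using \<eta>[of 1] t unfolding t_def by (smt (verit) abs_ge_zero atLeastAtMost_iff le_refl le_trans one_le_numeral)
    then have u0: "0 \<le> u" using t by (simp add: u_def)
    \<comment> \<open>With \<open>\<epsilon> < 1 / 2\<close> this gives the smallness condition
      \<open>12 * u \<le> 1\<close>.\<close>
    have "2 * u \<le> real k * u" using 3 u0 by (intro mult_right_mono) auto
    then have "12 * u \<le> 1" using u 3 by simp
    then have "\<bar>power_sum l i - power_sum l' i\<bar> \<le> real i * (3 * u + 2 / 3 ^ t)"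
      unfolding u_def using t \<eta> by (intro power_sum_stability[OF l t i(1)]) (auto simp: t_def)
    also have "\<dots> \<le> real k * (3 * u + 2 / 3 ^ t)"
      using i u0 by (intro mult_right_mono) auto
    also have "\<dots> = 3 * (real k * u) + 2 * real k / 3 ^ t" by (simp add: algebra_simps)
    also have "2 * real k / 3 ^ t \<le> \<epsilon>"
    proof -
      have "2 * real k / \<epsilon> \<le> exp 1 ^ t"
        using exp_trunc_index_ge[OF k \<epsilon>] by (simp add: t_def flip: exp_of_nat_mult)
      also have "\<dots> \<le> 3 ^ t" by (intro power_mono exp_le) auto
      finally show ?thesis using \<epsilon> by (simp add: field_simps)
    qed
    finally show ?thesis using u by simp
  qed
qed

text \<open>Two spectra consistent with the same data differ by at most twice the admissible error,
  that is \<open>\<epsilon> / c\<close>. The constant 3 is absorbed by the factor \<open>t\<close>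
  in \<open>c\<close>, as \<open>t \<ge> 3\<close>.\<close>

lemma power_sum_diff_le_admissible:
  assumes l: "state_spectrum l" "state_spectrum l'" and i: "1 \<le> i" "i \<le> k" and \<epsilon>: "0 < \<epsilon>"
    and "\<forall>j\<in>{1..trunc_index k \<epsilon>}. admissible_error k \<epsilon> \<bar>q j - power_sum l j\<bar>"
    and "\<forall>j\<in>{1..trunc_index k \<epsilon>}. admissible_error k \<epsilon> \<bar>q j - power_sum l' j\<bar>"
  shows "\<bar>power_sum l i - power_sum l' i\<bar> \<le> 2 * \<epsilon>"
proof -
  define t where "t = trunc_index k \<epsilon>"
  define c where "c = real k * real t * ln (real t)"
  show ?thesis
  proof (rule power_sum_diff_le[OF l i \<epsilon>, where \<eta> = "\<epsilon> / c"])
    fix j assume t: "3 \<le> trunc_index k \<epsilon>" and j: "j \<in> {1..trunc_index k \<epsilon>}"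
    have c: "0 < c" using t i by (simp add: c_def t_def)
    have "\<bar>q j - power_sum l j\<bar> * (2 * c) < \<epsilon>" "\<bar>q j - power_sum l' j\<bar> * (2 * c) < \<epsilon>"
      using assms(6,7) j by (auto simp: admissible_error_def c_def t_def mult_ac)
    then have "(\<bar>q j - power_sum l j\<bar> + \<bar>q j - power_sum l' j\<bar>) * c \<le> \<epsilon>" by (simp add: algebra_simps)
    then have "\<bar>q j - power_sum l j\<bar> + \<bar>q j - power_sum l' j\<bar> \<le> \<epsilon> / c" using c by (simp add: field_simps)
    then show "\<bar>power_sum l j - power_sum l' j\<bar> \<le> \<epsilon> / c" by linarith
  next
    assume "2 \<le> k" "\<epsilon> < 1 / 2"
    then have t: "3 \<le> t" using trunc_index_ge_3 \<epsilon> by (simp add: t_def)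
    then have "3 * real k * (\<epsilon> / c * ln (real t)) = 3 * \<epsilon> / real t"
      using i by (simp add: c_def)
    also have "\<dots> \<le> \<epsilon>" using t \<epsilon> by (simp add: field_simps)
    finally show "3 * real k * (\<epsilon> / c * ln (real (trunc_index k \<epsilon>))) \<le> \<epsilon>" by (simp add: t_def)
  qed
qed

text \<open>A tolerance in terms of \<open>k\<close>, for the run count that is polylogarithmic in
  \<open>k\<close> alone. If \<open>k < t\<close>, all power sums up to \<open>k\<close> are given
  directly; otherwise \<open>ln t \<le> ln k\<close>.\<close>

lemma power_sum_diff_le_min:
  assumes l: "state_spectrum l" "state_spectrum l'" and i: "1 \<le> i" "i \<le> k" and \<epsilon>: "0 < \<epsilon>"
    and \<eta>: "\<And>j. j \<in> {1..min k (trunc_index k \<epsilon>)} \<Longrightarrow>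
      \<bar>power_sum l j - power_sum l' j\<bar> \<le> \<epsilon> / (3 * real k * (1 + ln (real k)))"
  shows "\<bar>power_sum l i - power_sum l' i\<bar> \<le> 2 * \<epsilon>"
proof -
  define c where "c = 3 * real k * (1 + ln (real k))"
  have c: "1 \<le> 3 * real k" "0 \<le> ln (real k)" using i by auto
  have c1: "1 \<le> c" unfolding c_def using mult_mono[of 1 "3 * real k" 1 "1 + ln (real k)"] c by linarith
  show ?thesis
  proof (cases "k < trunc_index k \<epsilon>")
    case True
    have "\<epsilon> / c \<le> \<epsilon> / 1" using c1 \<epsilon> by (intro divide_left_mono) auto
    moreover have "\<bar>power_sum l i - power_sum l' i\<bar> \<le> \<epsilon> / c"
      unfolding c_def using i True by (intro \<eta>) auto
    ultimately show ?thesis using \<epsilon> by simp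
  next
    case False
    show ?thesis
    proof (rule power_sum_diff_le[OF l i \<epsilon>])
      show "\<bar>power_sum l j - power_sum l' j\<bar> \<le> \<epsilon> / c" if "j \<in> {1..trunc_index k \<epsilon>}" for j
        using \<eta>[of j] False that by (simp add: c_def)
      assume "2 \<le> k" "\<epsilon> < 1 / 2"
      then have "3 \<le> trunc_index k \<epsilon>" using trunc_index_ge_3 \<epsilon> by simp
      then have "ln (real (trunc_index k \<epsilon>)) \<le> ln (real k)"
        using False by (subst ln_le_cancel_iff) auto
      then have "ln (real (trunc_index k \<epsilon>)) \<le> 1 + ln (real k)" by simp
      then have "3 * real k * (\<epsilon> / c * ln (real (trunc_index k \<epsilon>))) \<le> 3 * real k * (\<epsilon> / c * (1 + ln (real k)))"
        using \<epsilon> c1 by (intro mult_left_mono) auto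
      also have "\<dots> = \<epsilon> / c * c" unfolding c_def by (simp only: mult_ac)
      also have "\<dots> = \<epsilon>" using c1 by simp
      finally show "3 * real k * (\<epsilon> / c * ln (real (trunc_index k \<epsilon>))) \<le> \<epsilon>" .
    qed
  qed
qed

section \<open>Spectra and Gram representations\<close>

lemma mat_adjoint_index [simp]:
  "i < dim_col A \<Longrightarrow> j < dim_row A \<Longrightarrow> mat_adjoint (A :: complex mat) $$ (i, j) = cnj (A $$ (j, i))"
  by (simp add: mat_adjoint_def mat_of_rows_index)

lemma mat_adjoint_dim [simp]: "dim_row (mat_adjoint A) = dim_col A" "dim_col (mat_adjoint A) = dim_row A"
  by (auto simp: mat_adjoint_def)

lemma index_mult_mat_sum:
  "i < dim_row A \<Longrightarrow> j < dim_col B \<Longrightarrow> dim_row B = dim_col A \<Longrightarrow>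
    (A * B) $$ (i, j) = (\<Sum>k<dim_col A. A $$ (i, k) * B $$ (k, j))"
  by (simp add: scalar_prod_def atLeast0LessThan)

lemma mtrace_mult_commute:
  assumes "A \<in> carrier_mat n m" "B \<in> carrier_mat m n"
  shows "mtrace (A * B) = mtrace (B * A)"
proof -
  have "mtrace (A * B) = (\<Sum>i<n. \<Sum>k<m. A $$ (i, k) * B $$ (k, i))"
    using assms by (auto simp: mtrace_def index_mult_mat_sum simp del: index_mult_mat(1) intro!: sum.cong)
  also have "\<dots> = (\<Sum>k<m. \<Sum>i<n. A $$ (i, k) * B $$ (k, i))" by (rule sum.swap)
  also have "\<dots> = mtrace (B * A)"
    using assms by (auto simp: mtrace_def index_mult_mat_sum mult.commute simp del: index_mult_mat(1) intro!: sum.cong)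
  finally show ?thesis .
qed

text \<open>Triangularity of the powers is carried along in the induction: it leaves a single
  summand in each diagonal entry.\<close>

lemma upper_triangular_pow_diag:
  assumes "(B :: complex mat) \<in> carrier_mat n n" "upper_triangular B"
  shows "upper_triangular (B ^\<^sub>m i) \<and> (\<forall>a<n. (B ^\<^sub>m i) $$ (a, a) = (B $$ (a, a)) ^ i)"
proof (induction i)
  case 0
  show ?case using assms by auto
next
  case (Suc i)
  let ?C = "B ^\<^sub>m i"
  have C: "?C \<in> carrier_mat n n" using assms by simp
  have 0: "?C $$ (a, k) = 0" if "k < a" "a < n" for a k
    using Suc C that by (auto elim!: upper_triangularD)
  have B0: "B $$ (a, k) = 0" if "k < a" "a < n" for a k
    using assms that by (auto elim!: upper_triangularD)
  have "(?C * B) $$ (a, b) = (if b < a then 0 else (\<Sum>k=a..b. ?C $$ (a, k) * B $$ (k, b)))"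
    if "a < n" "b < n" for a b
  proof -
    have "(?C * B) $$ (a, b) = (\<Sum>k<n. ?C $$ (a, k) * B $$ (k, b))"
      using that assms C by (simp add: index_mult_mat_sum del: index_mult_mat(1))
    also have "\<dots> = (\<Sum>k=a..b. ?C $$ (a, k) * B $$ (k, b))"
      using that 0[of _ a] B0[of b] by (intro sum.mono_neutral_right) (auto simp: not_le)
    finally show ?thesis by simp
  qed
  then show ?case using Suc assms C by auto
qed

text \<open>Schur triangularisation puts the eigenvalues on the diagonal of \<open>B\<close>, and
  cyclicity of the trace removes \<open>P\<close> and \<open>Q\<close>.\<close>

lemma mtrace_pow_eq_sum_eigenvalues:
  assumes A: "(A :: complex mat) \<in> carrier_mat n n" and es: "char_poly A = (\<Prod>a\<leftarrow>es. [:- a, 1:])"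
  shows "mtrace (A ^\<^sub>m i) = (\<Sum>e\<leftarrow>es. e ^ i)"
proof -
  obtain B P Q where S: "schur_decomposition A es = (B, P, Q)" by (metis prod_cases3)
  from schur_decomposition[OF A es S]
  have sim: "similar_mat_wit A B P Q" and ut: "upper_triangular B" and dg: "diag_mat B = es" by auto
  note D = similar_mat_witD2[OF A sim]
  have "mtrace (A ^\<^sub>m i) = mtrace (P * (B ^\<^sub>m i * Q))"
    using similar_mat_wit_pow_id[OF sim, of i] D by (simp add: assoc_mult_mat[of _ n n _ n _ n])
  also have "\<dots> = mtrace ((B ^\<^sub>m i * Q) * P)"
    using D by (intro mtrace_mult_commute[of _ n n]) auto
  also have "(B ^\<^sub>m i * Q) * P = B ^\<^sub>m i"
    using D by (simp add: assoc_mult_mat[of _ n n _ n _ n])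
  also have "mtrace (B ^\<^sub>m i) = (\<Sum>a<n. (B $$ (a, a)) ^ i)"
    using upper_triangular_pow_diag[OF D(5) ut, of i] D by (auto simp: mtrace_def intro!: sum.cong)
  also have "\<dots> = (\<Sum>e\<leftarrow>es. e ^ i)"
    using D(5) unfolding dg[symmetric] by (simp add: diag_mat_def sum_list_sum_nth atLeast0LessThan)
  finally show ?thesis .
qed

section \<open>Positive semidefinite matrices: eigenvalues and Gram vectors\<close>

lemma inner_mult_mat_vec:
  assumes "A \<in> carrier_mat n n" "v \<in> carrier_vec n"
  shows "(A *\<^sub>v v) \<bullet>c v = (\<Sum>x<n. \<Sum>y<n. cnj (v $ x) * A $$ (x, y) * v $ y)"
  using assms by (auto simp: scalar_prod_def atLeast0LessThan sum_distrib_left sum_distrib_right mult_ac intro!: sum.cong)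

lemma pos_semidef_hermitian:
  assumes "pos_semidef A" "A \<in> carrier_mat n n" "x < n" "y < n"
  shows "A $$ (y, x) = cnj (A $$ (x, y))"
  using assms unfolding pos_semidef_def by (metis carrier_matD mat_adjoint_index)

text \<open>At an eigenvector the quadratic form has the value \<open>e * N\<close>, where
  \<open>N > 0\<close> is the squared norm; this value is real by Hermitian symmetry and nonnegative
  by positivity.\<close>

lemma pos_semidef_eigenvalue:
  assumes psd: "pos_semidef A" and A: "A \<in> carrier_mat n n" and e: "eigenvalue A e"
  shows "\<exists>r\<ge>0. e = complex_of_real r"
proof -
  obtain v where v: "v \<in> carrier_vec n" "v \<noteq> 0\<^sub>v n" "A *\<^sub>v v = e \<cdot>\<^sub>v v"
    using e A by (auto simp: eigenvalue_def eigenvector_def)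
  define N where "N = v \<bullet>c v"
  have N: "0 < N" unfolding N_def using v by simp
  then have NR: "0 < Re N" "Im N = 0" by (auto simp: less_complex_def)
  have eN: "e * N = (A *\<^sub>v v) \<bullet>c v" unfolding N_def v(3) using v by simp
  have "cnj ((A *\<^sub>v v) \<bullet>c v) = (\<Sum>x<n. \<Sum>y<n. v $ x * A $$ (y, x) * cnj (v $ y))"
    unfolding inner_mult_mat_vec[OF A v(1)] cnj_sum
    by (intro sum.cong refl) (simp add: pos_semidef_hermitian[OF psd A, symmetric])
  also have "\<dots> = (A *\<^sub>v v) \<bullet>c v"
    unfolding inner_mult_mat_vec[OF A v(1)] by (subst sum.swap) (simp add: mult_ac)
  finally have "cnj (e * N) = e * N" unfolding eN .
  then have "e * N \<in> \<real>" by (simp only: Reals_cnj_iff)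
  then have "Im (e * N) = 0" by (simp only: complex_is_Real_iff)
  then have "Im e * Re N = 0" using NR(2) by simp
  moreover have "0 \<le> Re (e * N)" unfolding eN using psd A v by (auto simp: pos_semidef_def)
  then have "0 \<le> Re e * Re N" using NR(2) by simp
  ultimately have "Im e = 0" "0 \<le> Re e" using NR(1) by (simp_all add: zero_le_mult_iff)
  then show ?thesis by (intro exI[of _ "Re e"]) (auto simp: complex_eq_iff)
qed

text \<open>Passes from matrices to lists of reals: the characteristic polynomial splits over the
  complex numbers, positivity makes its roots real and nonnegative, and trace one makes them sum to
  1.\<close>

lemma quantum_state_spectrum:
  assumes "quantum_state n \<rho>"
  shows "\<exists>l. state_spectrum l \<and> (\<forall>i. mtrace (\<rho> ^\<^sub>m i) = complex_of_real (power_sum l i))"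
proof -
  have \<rho>: "\<rho> \<in> carrier_mat (2 ^ n) (2 ^ n)" "pos_semidef \<rho>" "mtrace \<rho> = 1"
    using assms by (auto simp: quantum_state_def)
  obtain es where es: "char_poly \<rho> = (\<Prod>a\<leftarrow>es. [:- a, 1:])" using char_poly_factorized[OF \<rho>(1)] by blast
  have ev: "\<exists>r\<ge>0. e = complex_of_real r" if "e \<in> set es" for e
  proof (rule pos_semidef_eigenvalue[OF \<rho>(2,1)])
    show "eigenvalue \<rho> e"
      using that unfolding eigenvalue_root_char_poly[OF \<rho>(1)] es poly_prod_list by (auto simp: prod_list_zero_iff)
  qed
  define l where "l = map Re es"
  have es_l: "es = map complex_of_real l"
    unfolding l_def map_map by (rule map_idI[symmetric]) (use ev in fastforce)
  have tr: "mtrace (\<rho> ^\<^sub>m i) = complex_of_real (power_sum l i)" for i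
    unfolding mtrace_pow_eq_sum_eigenvalues[OF \<rho>(1) es] power_sum_def es_l
    by (induction l) auto
  moreover have "state_spectrum l"
  proof -
    have "\<rho> ^\<^sub>m 1 = \<rho>" using \<rho> by simp
    then have "power_sum l 1 = 1" using tr[of 1] \<rho>(3) by (metis of_real_eq_1_iff)
    then show ?thesis using ev by (fastforce simp: state_spectrum_def power_sum_def l_def)
  qed
  ultimately show ?thesis by blast
qed

text \<open>Cholesky elimination; it also covers a vanishing pivot, since then \<open>a x z * a z y / 0 = 0\<close>.\<close>

lemma psd_gram:
  fixes a :: "'a \<Rightarrow> 'a \<Rightarrow> complex"
  assumes "finite I" "\<And>x y. x \<in> I \<Longrightarrow> y \<in> I \<Longrightarrow> a y x = cnj (a x y)"
    and "\<And>v. 0 \<le> Re (\<Sum>x\<in>I. \<Sum>y\<in>I. cnj (v x) * a x y * v y)"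
  shows "\<exists>w. \<forall>x\<in>I. \<forall>y\<in>I. a x y = (\<Sum>l\<in>I. w l x * cnj (w l y))"
  using assms
proof (induction I arbitrary: a rule: finite_induct)
  case empty
  then show ?case by simp
next
  case (insert z I)
  note herm = insert.prems(1) and psd = insert.prems(2)
  define Q where "Q v = (\<Sum>x\<in>insert z I. \<Sum>y\<in>insert z I. cnj (v x) * a x y * v y)" for v
  define \<alpha> where "\<alpha> = Re (a z z)"
  have azz: "a z z = of_real \<alpha>" using herm[of z z] unfolding \<alpha>_def by (auto simp: complex_eq_iff)
  define S where "S v = (\<Sum>x\<in>I. \<Sum>y\<in>I. cnj (v x) * a x y * v y)" for v
  define \<beta> where "\<beta> v = (\<Sum>y\<in>I. a z y * v y)" for v
  have cb: "(\<Sum>x\<in>I. cnj (v x) * a x z) = cnj (\<beta> v)" for v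
    unfolding \<beta>_def cnj_sum by (intro sum.cong) (auto simp: herm[of z] mult.commute)
  \<comment> \<open>The form is split according to the coordinate at the new index
    \<open>z\<close>.\<close>
  have Q: "Q v = S v + cnj (v z) * \<beta> v + cnj (\<beta> v) * v z + of_real \<alpha> * v z * cnj (v z)" for v
  proof -
    have "Q v = cnj (v z) * a z z * v z + (\<Sum>y\<in>I. cnj (v z) * a z y * v y)
        + ((\<Sum>x\<in>I. cnj (v x) * a x z * v z) + S v)"
      unfolding Q_def S_def using insert.hyps by (simp add: sum.distrib)
    also have "(\<Sum>y\<in>I. cnj (v z) * a z y * v y) = cnj (v z) * \<beta> v"
      by (simp add: \<beta>_def sum_distrib_left mult.assoc)
    also have "(\<Sum>x\<in>I. cnj (v x) * a x z * v z) = cnj (\<beta> v) * v z"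
      by (simp add: cb[symmetric] sum_distrib_right)
    finally show ?thesis by (simp add: azz algebra_simps)
  qed
  have Qpos: "0 \<le> Re (Q v)" for v using psd[of v] by (simp add: Q_def)
  have \<alpha>0: "0 \<le> \<alpha>"
  proof -
    let ?v = "\<lambda>x. if x = z then 1 else 0 :: complex"
    have "?v x = 0" if "x \<in> I" for x using that insert.hyps by auto
    then have "S ?v = 0" "\<beta> ?v = 0" unfolding S_def \<beta>_def by (auto intro!: sum.neutral)
    then show ?thesis using Qpos[of ?v] unfolding Q by simp
  qed
  have unit: "\<beta> v = a z y" "S v = a y y" if "y \<in> I" and v: "\<And>x. x \<in> I \<Longrightarrow> v x = (if x = y then 1 else 0)" for v y
  proof -
    have "\<beta> v = (\<Sum>x\<in>I. if x = y then a z y else 0)" unfolding \<beta>_def using v by (intro sum.cong) auto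
    then show "\<beta> v = a z y" using that insert.hyps by simp
    have "S v = (\<Sum>x\<in>I. \<Sum>y'\<in>I. if x = y then (if y' = y then a y y else 0) else 0)"
      unfolding S_def using v by (intro sum.cong) auto
    also have "\<dots> = (\<Sum>x\<in>I. if x = y then a y y else 0)"
      using that insert.hyps by (intro sum.cong) auto
    finally show "S v = a y y" using that insert.hyps by simp
  qed
  have zero: "a z y = 0" if "\<alpha> = 0" "y \<in> I" for y
  proof (rule ccontr)
    assume ne: "a z y \<noteq> 0"
    \<comment> \<open>With a zero pivot, the coordinate at \<open>z\<close> can be moved against a
      nonzero \<open>a z y\<close> at no quadratic cost; this \<open>K\<close> yields
      \<open>Re (Q v) = - Re (a y y) - 2\<close>.\<close>
    define K where "K = (Re (a y y) + 1) / (cmod (a z y))\<^sup>2"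
    define v where "v = (\<lambda>x. if x = z then - of_real K * a z y else if x = y then 1 else 0)"
    have yz: "y \<noteq> z" using that insert.hyps by auto
    have vI: "v x = (if x = y then 1 else 0)" if "x \<in> I" for x using that insert.hyps by (auto simp: v_def)
    have vz: "v z = - of_real K * a z y" by (simp add: v_def)
    have b: "\<beta> v = a z y" and s: "S v = a y y" by (rule unit[OF that(2)]; erule vI)+
    have n: "a z y * cnj (a z y) = of_real ((cmod (a z y))\<^sup>2)" by (rule complex_norm_square[symmetric])
    have "Q v = a y y - 2 * of_real K * (a z y * cnj (a z y))"
      unfolding Q b s vz using that by (simp add: algebra_simps)
    then have "Re (Q v) = Re (a y y) - 2 * (Re (a y y) + 1)"
      unfolding n using ne by (simp add: K_def)
    moreover have "0 \<le> Re (a y y)"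
    proof -
      let ?u = "\<lambda>x. if x = y then 1 else 0 :: complex"
      have "Q ?u = a y y" unfolding Q unit[OF that(2), of ?u, OF refl] using yz by simp
      then show ?thesis using Qpos[of ?u] by simp
    qed
    ultimately show False using Qpos[of v] by simp
  qed
  \<comment> \<open>The Schur complement of the pivot.\<close>
  define a' where "a' x y = a x y - a x z * a z y / of_real \<alpha>" for x y
  have "\<exists>w. \<forall>x\<in>I. \<forall>y\<in>I. a' x y = (\<Sum>l\<in>I. w l x * cnj (w l y))"
  proof (rule insert.IH)
    show "a' y x = cnj (a' x y)" if "x \<in> I" "y \<in> I" for x y
      using that herm[of x y] herm[of x z] herm[of z y] by (simp add: a'_def mult.commute)
    show "0 \<le> Re (\<Sum>x\<in>I. \<Sum>y\<in>I. cnj (v x) * a' x y * v y)" for v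
    proof -
      \<comment> \<open>For a nonzero pivot this coordinate completes the square, so that
        \<open>Q u\<close> is the form of the Schur complement at \<open>v\<close>.\<close>
      define u where "u = v(z := - \<beta> v / of_real \<alpha>)"
      have uI: "S u = S v" "\<beta> u = \<beta> v"
        using insert.hyps unfolding S_def \<beta>_def u_def by (auto intro!: sum.cong)
      have "(\<Sum>x\<in>I. \<Sum>y\<in>I. cnj (v x) * a' x y * v y)
          = S v - (\<Sum>x\<in>I. \<Sum>y\<in>I. (cnj (v x) * a x z) * (a z y * v y)) / of_real \<alpha>"
        unfolding a'_def S_def by (simp add: algebra_simps sum_subtractf sum_divide_distrib)
      also have "(\<Sum>x\<in>I. \<Sum>y\<in>I. (cnj (v x) * a x z) * (a z y * v y)) = cnj (\<beta> v) * \<beta> v"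
        unfolding cb[symmetric] unfolding \<beta>_def by (simp only: sum_product)
      also have "S v - cnj (\<beta> v) * \<beta> v / of_real \<alpha> = Q u"
        unfolding Q uI by (cases "\<alpha> = 0") (auto simp: u_def field_simps)
      finally show ?thesis using Qpos[of u] by simp
    qed
  qed
  then obtain w where "\<forall>x\<in>I. \<forall>y\<in>I. a' x y = (\<Sum>l\<in>I. w l x * cnj (w l y))" ..
  then have w: "a' x y = (\<Sum>l\<in>I. w l x * cnj (w l y))" if "x \<in> I" "y \<in> I" for x y
    using that by simp
  \<comment> \<open>The new Gram vector is the pivot column divided by the root of the pivot; the
    earlier ones are extended by 0 at \<open>z\<close>.\<close>
  define w' where "w' l x = (if l = z then a x z / of_real (sqrt \<alpha>) else if x = z then 0 else w l x)" for l x
  have sq: "complex_of_real (sqrt \<alpha>) * complex_of_real (sqrt \<alpha>) = of_real \<alpha>"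
    using \<alpha>0 by (metis of_real_mult real_sqrt_mult_self abs_of_nonneg)
  have "a x y = (\<Sum>l\<in>insert z I. w' l x * cnj (w' l y))" if "x \<in> insert z I" "y \<in> insert z I" for x y
  proof -
    have "(\<Sum>l\<in>insert z I. w' l x * cnj (w' l y)) = w' z x * cnj (w' z y) + (\<Sum>l\<in>I. w' l x * cnj (w' l y))"
      using insert.hyps by simp
    also have "w' z x * cnj (w' z y) = a x z * a z y / of_real \<alpha>"
      using herm[of y z] that sq by (simp add: w'_def)
    also have "(\<Sum>l\<in>I. w' l x * cnj (w' l y)) = (if x = z \<or> y = z then 0 else a' x y)"
      using that insert.hyps by (auto simp: w'_def w intro!: sum.neutral sum.cong)
    also have "a x z * a z y / of_real \<alpha> + \<dots> = a x y"
      using that zero[of x] zero[of y] azz herm[of z x] by (auto simp: a'_def)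
    finally show ?thesis by simp
  qed
  then show ?case by (intro exI[of _ w']) simp
qed

lemma pos_semidef_gram:
  assumes psd: "pos_semidef A" and A: "A \<in> carrier_mat n n"
  shows "\<exists>w. \<forall>x<n. \<forall>y<n. A $$ (x, y) = (\<Sum>l<n. w l x * cnj (w l y))"
proof -
  have "\<exists>w. \<forall>x\<in>{..<n}. \<forall>y\<in>{..<n}. A $$ (x, y) = (\<Sum>l\<in>{..<n}. w l x * cnj (w l y))"
  proof (rule psd_gram[where a = "\<lambda>x y. A $$ (x, y)"])
    fix v :: "nat \<Rightarrow> complex"
    have "0 \<le> Re ((A *\<^sub>v vec n v) \<bullet>c vec n v)" using psd A by (auto simp: pos_semidef_def)
    also have "(A *\<^sub>v vec n v) \<bullet>c vec n v = (\<Sum>x<n. \<Sum>y<n. cnj (v x) * A $$ (x, y) * v y)"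
      using A by (subst inner_mult_mat_vec[of _ n]) auto
    finally show "0 \<le> Re (\<Sum>x<n. \<Sum>y<n. cnj (v x) * A $$ (x, y) * v y)" .
  next
    show "A $$ (y, x) = cnj (A $$ (x, y))" if "x \<in> {..<n}" "y \<in> {..<n}" for x y
      using pos_semidef_hermitian[OF psd A, of x y] that by simp
  qed simp
  then show ?thesis by auto
qed

section \<open>Bits and conjugation\<close>

lemma nat_less_two_power_iff: "x < 2 ^ m \<longleftrightarrow> (\<forall>p. bit x p \<longrightarrow> p < m)" for x :: nat
proof -
  have "x < 2 ^ m \<longleftrightarrow> take_bit m x = x" by (simp add: take_bit_nat_eq_self_iff)
  also have "\<dots> \<longleftrightarrow> (\<forall>p. bit x p \<longrightarrow> p < m)" by (auto simp: bit_eq_iff bit_take_bit_iff)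
  finally show ?thesis .
qed

lemma nat_eqI_bits:
  assumes "(x :: nat) < 2 ^ m" "y < 2 ^ m" "\<And>p. p < m \<Longrightarrow> bit x p = bit y p"
  shows "x = y"
  by (rule bit_eqI) (use assms in \<open>auto simp: nat_less_two_power_iff\<close>)

definition nat_of_bits :: "nat \<Rightarrow> (nat \<Rightarrow> bool) \<Rightarrow> nat" where
  "nat_of_bits m f = horner_sum of_bool 2 (map f [0..<m])"

lemma bit_nat_of_bits [simp]: "bit (nat_of_bits m f) p \<longleftrightarrow> p < m \<and> f p"
  by (auto simp: nat_of_bits_def bit_horner_sum_bit_iff)

lemma nat_of_bits_less [simp]: "nat_of_bits m f < 2 ^ m"
  by (simp add: nat_less_two_power_iff)

lemma conj_by_carrier [simp]:
  "K \<in> carrier_mat d d \<Longrightarrow> \<sigma> \<in> carrier_mat d d \<Longrightarrow> conj_by K \<sigma> \<in> carrier_mat d d"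
  by (auto simp: conj_by_def)

lemma conj_by_index:
  assumes "K \<in> carrier_mat d d" "\<sigma> \<in> carrier_mat d d" "x < d" "y < d"
  shows "conj_by K \<sigma> $$ (x, y) = (\<Sum>a<d. \<Sum>b<d. K $$ (x, a) * \<sigma> $$ (a, b) * cnj (K $$ (y, b)))"
proof -
  have "conj_by K \<sigma> $$ (x, y) = (\<Sum>b<d. (\<Sum>a<d. K $$ (x, a) * \<sigma> $$ (a, b)) * cnj (K $$ (y, b)))"
    unfolding conj_by_def using assms
    by (auto simp: index_mult_mat_sum simp del: index_mult_mat(1) intro!: sum.cong)
  also have "\<dots> = (\<Sum>a<d. \<Sum>b<d. K $$ (x, a) * \<sigma> $$ (a, b) * cnj (K $$ (y, b)))"
    by (subst sum.swap) (simp add: sum_distrib_right)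
  finally show ?thesis .
qed

lemma gate_mat_carrier [simp]: "gate_mat m U qs \<in> carrier_mat (2 ^ m) (2 ^ m)"
  and cswap_mat_carrier [simp]: "cswap_mat n m c r s \<in> carrier_mat (2 ^ m) (2 ^ m)"
  and proj_mat_carrier [simp]: "proj_mat m q b \<in> carrier_mat (2 ^ m) (2 ^ m)"
  by (simp_all add: gate_mat_def cswap_mat_def proj_mat_def)

section \<open>Positivity\<close>

text \<open>A Gram representation over the set of functions \<open>I\<close>; the index type accommodates the
  tensor power of a Gram representation.\<close>

definition has_gram :: "nat \<Rightarrow> complex mat \<Rightarrow> bool" where
  "has_gram d \<sigma> \<longleftrightarrow> (\<exists>(I :: (nat \<Rightarrow> nat) set) w. finite I \<and>
     (\<forall>x<d. \<forall>y<d. \<sigma> $$ (x, y) = (\<Sum>l\<in>I. w l x * cnj (w l y))))"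

text \<open>The Gram vectors are transformed by \<open>K\<close>.\<close>

lemma has_gram_conj_by:
  assumes K: "K \<in> carrier_mat d d" and \<sigma>: "\<sigma> \<in> carrier_mat d d" and g: "has_gram d \<sigma>"
  shows "has_gram d (conj_by K \<sigma>)"
proof -
  obtain I :: "(nat \<Rightarrow> nat) set" and w where I: "finite I"
    and w: "\<forall>x<d. \<forall>y<d. \<sigma> $$ (x, y) = (\<Sum>l\<in>I. w l x * cnj (w l y))"
    using g unfolding has_gram_def by (elim exE conjE)
  define w' where "w' l x = (\<Sum>a<d. K $$ (x, a) * w l a)" for l x
  have "conj_by K \<sigma> $$ (x, y) = (\<Sum>l\<in>I. w' l x * cnj (w' l y))" if "x < d" "y < d" for x y
  proof -
    have "conj_by K \<sigma> $$ (x, y) = (\<Sum>a<d. \<Sum>b<d. \<Sum>l\<in>I. (K $$ (x, a) * w l a) * cnj (K $$ (y, b) * w l b))"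
      unfolding conj_by_index[OF K \<sigma> that] using w
      by (intro sum.cong refl) (simp add: sum_distrib_left sum_distrib_right mult_ac)
    also have "\<dots> = (\<Sum>a<d. \<Sum>l\<in>I. \<Sum>b<d. (K $$ (x, a) * w l a) * cnj (K $$ (y, b) * w l b))"
      by (intro sum.cong refl sum.swap)
    also have "\<dots> = (\<Sum>l\<in>I. \<Sum>a<d. \<Sum>b<d. (K $$ (x, a) * w l a) * cnj (K $$ (y, b) * w l b))"
      by (rule sum.swap)
    also have "\<dots> = (\<Sum>l\<in>I. w' l x * cnj (w' l y))"
      unfolding w'_def cnj_sum sum_product ..
    finally show ?thesis .
  qed
  then show ?thesis unfolding has_gram_def using I by (intro exI[of _ I] exI[of _ w']) simp
qed

text \<open>Diagonal entries are sums of squared moduli; this makes the branch probabilities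
  nonnegative.\<close>

lemma has_gram_diag_nonneg:
  assumes "has_gram d \<sigma>" "x < d"
  shows "0 \<le> Re (\<sigma> $$ (x, x))"
proof -
  obtain I :: "(nat \<Rightarrow> nat) set" and w where
    w: "\<forall>x<d. \<forall>y<d. \<sigma> $$ (x, y) = (\<Sum>l\<in>I. w l x * cnj (w l y))"
    using assms(1) unfolding has_gram_def by (elim exE conjE)
  have "\<sigma> $$ (x, x) = (\<Sum>l\<in>I. complex_of_real ((cmod (w l x))\<^sup>2))"
    using w assms(2) by (simp only: complex_norm_square)
  then show ?thesis by (simp add: sum_nonneg flip: of_real_sum)
qed

section \<open>Controlled swaps\<close>

text \<open>The map on basis states whose permutation matrix is
  \<open>cswap_mat n m c r s\<close>.\<close>

definition cswap_index :: "nat \<Rightarrow> nat \<Rightarrow> nat \<Rightarrow> nat \<Rightarrow> nat \<Rightarrow> nat \<Rightarrow> nat" where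
  "cswap_index n m c r s x = nat_of_bits m (\<lambda>p. bit x (if bit x c then swap_pos n r s p else p))"

lemma cswap_index_less [simp]: "cswap_index n m c r s x < 2 ^ m"
  by (simp add: cswap_index_def)

lemma swap_pos_ancilla:
  assumes "r < j" "s < j" "j * n \<le> p"
  shows "swap_pos n r s p = p"
\<comment> \<open>For \<open>n = 0\<close> the conventions on division by zero give
  \<open>p mod n = p\<close>, so nothing moves.\<close>
proof (cases "n = 0")
  case False
  then have "j \<le> p div n" using assms by (simp add: less_eq_div_iff_mult_less_eq)
  then show ?thesis using assms by (simp add: swap_pos_def)
qed (simp add: swap_pos_def)

lemma swap_pos_register:
  assumes "i < n"
  shows "swap_pos n r s (r' * n + i) = Transposition.transpose r s r' * n + i"
  using assms by (auto simp: swap_pos_def Transposition.transpose_def)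

lemma position_cases:
  fixes n j p :: nat
  obtains "j * n \<le> p" | r i where "r < j" "i < n" "p = r * n + i"
proof (cases "j * n \<le> p")
  case False
  then have "0 < n" by (cases n) auto
  then have "p div n < j" "p mod n < n" "p = p div n * n + p mod n"
    using False by (auto simp: div_less_iff_less_mult)
  then show ?thesis using that(2) by blast
qed (use that(1) in blast)

lemma swap_pos_involutive: "r < j \<Longrightarrow> s < j \<Longrightarrow> swap_pos n r s (swap_pos n r s p) = p"
  by (rule position_cases[of j n p]) (auto simp: swap_pos_ancilla swap_pos_register)

lemma swap_pos_less:
  assumes "r < j" "s < j" "j * n \<le> m" "p < m"
  shows "swap_pos n r s p < m"
proof (rule position_cases[of j n p])
  fix r' i assume *: "r' < j" "i < n" "p = r' * n + i"
  let ?t = "Transposition.transpose r s r'"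
  have "?t < j" using * assms by (auto simp: Transposition.transpose_def)
  then have "Suc ?t * n \<le> j * n" by (intro mult_le_mono1) simp
  then have "?t * n + i < j * n" using * by simp
  then show ?thesis using * assms by (simp add: swap_pos_register)
qed (use assms in \<open>simp add: swap_pos_ancilla\<close>)

lemma bit_cswap_index_ancilla:
  assumes "r < j" "s < j" "j * n \<le> p" "p < m"
  shows "bit (cswap_index n m c r s x) p = bit x p"
  using assms by (simp add: cswap_index_def swap_pos_ancilla)

text \<open>The control is an ancilla, which the swap does not move, so the second application sees
  the same control bit.\<close>

lemma cswap_index_involutive:
  assumes "r < j" "s < j" "j * n \<le> c" "c < m" "x < 2 ^ m"
  shows "cswap_index n m c r s (cswap_index n m c r s x) = x"
proof (rule nat_eqI_bits[of _ m])
  fix p assume p: "p < m"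
  show "bit (cswap_index n m c r s (cswap_index n m c r s x)) p = bit x p"
  proof (cases "bit x c")
    case True
    have "bit (cswap_index n m c r s x) c" using True assms by (simp add: bit_cswap_index_ancilla)
    then have "bit (cswap_index n m c r s (cswap_index n m c r s x)) p = bit (cswap_index n m c r s x) (swap_pos n r s p)"
      using p by (simp add: cswap_index_def[of _ _ _ _ _ "cswap_index n m c r s x"])
    also have "\<dots> = bit x p"
      using True assms p swap_pos_less[of r j s n m p] by (simp add: cswap_index_def swap_pos_involutive[of r j s])
    finally show ?thesis .
  next
    case False
    have "\<not> bit (cswap_index n m c r s x) c" using False assms by (simp add: bit_cswap_index_ancilla)
    then show ?thesis using p False by (simp add: cswap_index_def)
  qed
qed (use assms in auto)

text \<open>Conjugation with a permutation matrix relabels the entries by the inverse permutation,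
  which here is the permutation itself.\<close>

lemma conj_by_cswap_index:
  assumes *: "r < j" "s < j" "j * n \<le> c" "c < m" and \<sigma>: "\<sigma> \<in> carrier_mat (2 ^ m) (2 ^ m)"
    and "x < 2 ^ m" "y < 2 ^ m"
  shows "conj_by (cswap_mat n m c r s) \<sigma> $$ (x, y) = \<sigma> $$ (cswap_index n m c r s x, cswap_index n m c r s y)"
proof -
  let ?k = "cswap_index n m c r s"
  have K: "cswap_mat n m c r s $$ (x, a) = (if a = ?k x then 1 else 0)" if "x < 2 ^ m" "a < 2 ^ m" for x a
  proof -
    have "(\<forall>p<m. bit x p = bit a (if bit a c then swap_pos n r s p else p)) \<longleftrightarrow> x = ?k a"
    proof
      assume "\<forall>p<m. bit x p = bit a (if bit a c then swap_pos n r s p else p)"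
      then show "x = ?k a"
        using that by (intro nat_eqI_bits[of _ m]) (simp_all only: cswap_index_def bit_nat_of_bits nat_of_bits_less simp_thms)
    next
      assume "x = ?k a"
      then show "\<forall>p<m. bit x p = bit a (if bit a c then swap_pos n r s p else p)"
        by (simp only: cswap_index_def bit_nat_of_bits) blast
    qed
    also have "\<dots> \<longleftrightarrow> a = ?k x" using cswap_index_involutive[OF *] that by metis
    finally show ?thesis using that by (simp add: cswap_mat_def)
  qed
  have "conj_by (cswap_mat n m c r s) \<sigma> $$ (x, y)
      = (\<Sum>a<2 ^ m. \<Sum>b<2 ^ m. if a = ?k x then if b = ?k y then \<sigma> $$ (a, b) else 0 else 0)"
    unfolding conj_by_index[OF cswap_mat_carrier \<sigma> assms(6,7)] using assms(6,7)
    by (intro sum.cong refl) (simp add: K)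
  also have "\<dots> = (\<Sum>a<2 ^ m. if a = ?k x then \<sigma> $$ (a, ?k y) else 0)" by (intro sum.cong refl) simp
  finally show ?thesis by simp
qed

section \<open>Contents of the registers\<close>

definition register :: "nat \<Rightarrow> nat \<Rightarrow> nat \<Rightarrow> nat" where
  "register n r x = take_bit n (drop_bit (r * n) x)"

lemma bit_register [simp]: "bit (register n r x) i \<longleftrightarrow> i < n \<and> bit x (r * n + i)"
  by (simp add: register_def bit_take_bit_iff bit_drop_bit_eq)

lemma register_less [simp]: "register n r x < 2 ^ n"
  by (simp add: register_def)

lemma register_cswap_index:
  assumes "r < j" "s < j" "j * n \<le> m" "r' < j"
  shows "register n r' (cswap_index n m c r s x) = register n (if bit x c then Transposition.transpose r s r' else r') x"
proof (rule bit_eqI)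
  fix i
  have "r' * n + i < m" if "i < n"
  proof -
    have "Suc r' * n \<le> j * n" using assms by (intro mult_le_mono1) simp
    then show ?thesis using that assms by simp
  qed
  then show "bit (register n r' (cswap_index n m c r s x)) i = bit (register n (if bit x c then Transposition.transpose r s r' else r') x) i"
    by (auto simp: cswap_index_def swap_pos_register)
qed

section \<open>Hadamard gates\<close>

definition hadamard :: "complex mat" where
  "hadamard = Matrix.mat 2 2 (\<lambda>(i, k). (if i = 1 \<and> k = 1 then - 1 else 1) / complex_of_real (sqrt 2))"

text \<open>Eigenvalue of the Pauli operator Z of qubit \<open>q\<close> at the basis state
  \<open>x\<close>.\<close>

definition sgn_bit :: "nat \<Rightarrow> nat \<Rightarrow> complex" where
  "sgn_bit q x = (if bit x q then - 1 else 1)"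

lemma flip_bit_less: "q < m \<Longrightarrow> x < 2 ^ m \<Longrightarrow> flip_bit q x < (2 ^ m :: nat)"
  by (auto simp: nat_less_two_power_iff bit_flip_bit_iff split: if_splits)

lemma flip_bit_neq: "flip_bit q x \<noteq> (x :: nat)"
  by (metis bit_flip_bit_iff possible_bit_nat)

lemma sgn_bit_flip_bit: "sgn_bit p (flip_bit q x) = (if p = q then - sgn_bit p x else sgn_bit p x)"
  by (auto simp: sgn_bit_def bit_flip_bit_iff)

lemma sgn_bit_square [simp]: "sgn_bit q x * sgn_bit q x = 1"
  by (simp add: sgn_bit_def)

lemma flip_bit_flip_bit [simp]: "flip_bit q (flip_bit q x) = (x :: nat)"
  by (rule bit_eqI) (auto simp: bit_flip_bit_iff)

lemma sum_flip_bit: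
  assumes "q < m"
  shows "(\<Sum>x<2 ^ m. f (flip_bit q x)) = (\<Sum>x<2 ^ m. f (x :: nat) :: complex)"
  by (rule sum.reindex_bij_witness[of _ "flip_bit q" "flip_bit q"]) (use assms in \<open>auto simp: flip_bit_less\<close>)

text \<open>A gate on one qubit links \<open>x\<close> only to itself and to its flip; the sign
  needs the bit set in both indices, so it can occur only on the diagonal.\<close>

lemma gate_mat_hadamard_index:
  assumes "q < m" "x < 2 ^ m" "a < 2 ^ m"
  shows "gate_mat m hadamard [q] $$ (x, a) =
    (if a = x then sgn_bit q x else if a = flip_bit q x then 1 else 0) / complex_of_real (sqrt 2)"
proof -
  have ax: "(\<forall>p<m. p \<notin> set [q] \<longrightarrow> bit x p = bit a p) \<longleftrightarrow> a = x \<or> a = flip_bit q x"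
  proof
    assume *: "\<forall>p<m. p \<notin> set [q] \<longrightarrow> bit x p = bit a p"
    show "a = x \<or> a = flip_bit q x"
    proof (cases "bit a q = bit x q")
      case True
      then show ?thesis using * assms nat_eqI_bits[of a m x] by auto
    next
      case False
      then show ?thesis
        using * assms flip_bit_less[of q m x] nat_eqI_bits[of a m "flip_bit q x"] by (auto simp: bit_flip_bit_iff)
    qed
  qed (auto simp: bit_flip_bit_iff)
  show ?thesis
    using assms flip_bit_neq[of q x] ax
    by (auto simp: gate_mat_def sub_index_def hadamard_def sgn_bit_def bit_flip_bit_iff)
qed

lemma sum_hadamard_row:
  assumes "q < m" "x < 2 ^ m"
  shows "(\<Sum>a<2 ^ m. gate_mat m hadamard [q] $$ (x, a) * g a) =
    (sgn_bit q x * g x + g (flip_bit q x)) / complex_of_real (sqrt 2)"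
proof -
  have "(\<Sum>a<2 ^ m. gate_mat m hadamard [q] $$ (x, a) * g a) =
      (\<Sum>a\<in>{x, flip_bit q x}. gate_mat m hadamard [q] $$ (x, a) * g a)"
    using assms by (intro sum.mono_neutral_right) (auto simp: gate_mat_hadamard_index flip_bit_less)
  also have "\<dots> = gate_mat m hadamard [q] $$ (x, x) * g x
      + gate_mat m hadamard [q] $$ (x, flip_bit q x) * g (flip_bit q x)"
    using flip_bit_neq[of q x] by (subst sum.insert) auto
  also have "\<dots> = (sgn_bit q x * g x + g (flip_bit q x)) / complex_of_real (sqrt 2)"
    using assms flip_bit_neq[of q x] by (simp add: gate_mat_hadamard_index flip_bit_less add_divide_distrib)
  finally show ?thesis .
qed

lemma conj_by_hadamard_index:
  assumes q: "q < m" and \<sigma>: "\<sigma> \<in> carrier_mat (2 ^ m) (2 ^ m)" and x: "x < 2 ^ m" and y: "y < 2 ^ m"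
  shows "conj_by (gate_mat m hadamard [q]) \<sigma> $$ (x, y) =
    (sgn_bit q x * sgn_bit q y * \<sigma> $$ (x, y) + sgn_bit q x * \<sigma> $$ (x, flip_bit q y)
      + sgn_bit q y * \<sigma> $$ (flip_bit q x, y) + \<sigma> $$ (flip_bit q x, flip_bit q y)) / 2"
proof -
  let ?K = "gate_mat m hadamard [q]" and ?h = "complex_of_real (sqrt 2)"
  have real: "cnj (?K $$ (y, b)) = ?K $$ (y, b)" if "b < 2 ^ m" for b
    using q y that by (simp add: gate_mat_hadamard_index sgn_bit_def)
  have "conj_by ?K \<sigma> $$ (x, y) = (\<Sum>a<2 ^ m. ?K $$ (x, a) * (\<Sum>b<2 ^ m. ?K $$ (y, b) * \<sigma> $$ (a, b)))"
    unfolding conj_by_index[OF gate_mat_carrier \<sigma> x y]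
    by (simp add: real sum_distrib_left mult_ac)
  also have "\<dots> = (sgn_bit q x * ((sgn_bit q y * \<sigma> $$ (x, y) + \<sigma> $$ (x, flip_bit q y)) / ?h)
      + (sgn_bit q y * \<sigma> $$ (flip_bit q x, y) + \<sigma> $$ (flip_bit q x, flip_bit q y)) / ?h) / ?h"
    unfolding sum_hadamard_row[OF q y] sum_hadamard_row[OF q x] ..
  also have "\<dots> = (sgn_bit q x * (sgn_bit q y * \<sigma> $$ (x, y) + \<sigma> $$ (x, flip_bit q y))
      + (sgn_bit q y * \<sigma> $$ (flip_bit q x, y) + \<sigma> $$ (flip_bit q x, flip_bit q y))) / (?h * ?h)"
    by (simp add: field_simps)
  also have "?h * ?h = 2" by (metis of_real_mult of_real_numeral real_sqrt_mult_self abs_numeral)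
  finally show ?thesis by (simp add: algebra_simps)
qed

definition hadamards :: "nat \<Rightarrow> nat list \<Rightarrow> complex mat \<Rightarrow> complex mat" where
  "hadamards m qs \<sigma> = fold (\<lambda>q. conj_by (gate_mat m hadamard [q])) qs \<sigma>"

lemma hadamards_carrier [simp]:
  "\<sigma> \<in> carrier_mat (2 ^ m) (2 ^ m) \<Longrightarrow> hadamards m qs \<sigma> \<in> carrier_mat (2 ^ m) (2 ^ m)"
  by (induction qs arbitrary: \<sigma>) (auto simp: hadamards_def)

lemma hadamards_snoc: "hadamards m (qs @ [q]) \<sigma> = conj_by (gate_mat m hadamard [q]) (hadamards m qs \<sigma>)"
  by (simp add: hadamards_def)

lemma has_gram_hadamards:
  "\<sigma> \<in> carrier_mat (2 ^ m) (2 ^ m) \<Longrightarrow> has_gram (2 ^ m) \<sigma> \<Longrightarrow> has_gram (2 ^ m) (hadamards m qs \<sigma>)"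
  by (induction qs rule: rev_induct) (auto simp: hadamards_snoc intro!: has_gram_conj_by, simp add: hadamards_def)

text \<open>Trace preservation: flipping qubit \<open>q\<close> in the summation variable turns one
  mixed term into minus the other, and the two diagonal terms have equal sums.\<close>

lemma sum_diag_hadamards:
  assumes \<sigma>: "\<sigma> \<in> carrier_mat (2 ^ m) (2 ^ m)" and "set qs \<subseteq> {..<m}"
  shows "(\<Sum>x<2 ^ m. hadamards m qs \<sigma> $$ (x, x)) = (\<Sum>x<2 ^ m. \<sigma> $$ (x, x))"
  using assms(2)
proof (induction qs rule: rev_induct)
  case Nil
  then show ?case by (simp add: hadamards_def)
next
  case (snoc q qs)
  let ?s = "hadamards m qs \<sigma>"
  have q: "q < m" using snoc.prems by simp
  have "(\<Sum>x<2 ^ m. sgn_bit q x * ?s $$ (flip_bit q x, x)) = (\<Sum>x<2 ^ m. sgn_bit q (flip_bit q x) * ?s $$ (x, flip_bit q x))"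
    by (subst sum_flip_bit[OF q, symmetric]) simp
  then have off: "(\<Sum>x<2 ^ m. sgn_bit q x * ?s $$ (flip_bit q x, x)) = - (\<Sum>x<2 ^ m. sgn_bit q x * ?s $$ (x, flip_bit q x))"
    by (simp add: sgn_bit_flip_bit sum_negf)
  have "(\<Sum>x<2 ^ m. hadamards m (qs @ [q]) \<sigma> $$ (x, x)) =
     (\<Sum>x<2 ^ m. (?s $$ (x, x) + sgn_bit q x * ?s $$ (x, flip_bit q x) + sgn_bit q x * ?s $$ (flip_bit q x, x)
       + ?s $$ (flip_bit q x, flip_bit q x)) / 2)"
    unfolding hadamards_snoc using q \<sigma> by (intro sum.cong refl) (simp add: conj_by_hadamard_index)
  also have "\<dots> = ((\<Sum>x<2 ^ m. ?s $$ (x, x)) + (\<Sum>x<2 ^ m. ?s $$ (flip_bit q x, flip_bit q x))) / 2"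
    by (simp add: sum.distrib off flip: sum_divide_distrib)
  also have "(\<Sum>x<2 ^ m. ?s $$ (flip_bit q x, flip_bit q x)) = (\<Sum>x<2 ^ m. ?s $$ (x, x))"
    by (rule sum_flip_bit[OF q])
  finally show ?case using snoc by simp
qed

text \<open>For distinct qubits, the mask whose \<open>xor\<close> flips all of them; it is built by
  flips so that one more qubit is one more \<open>flip_bit\<close>.\<close>

definition qubit_mask :: "nat list \<Rightarrow> nat" where
  "qubit_mask qs = fold flip_bit qs 0"

lemma qubit_mask_snoc: "qubit_mask (qs @ [q]) = flip_bit q (qubit_mask qs)"
  by (simp add: qubit_mask_def)

lemma bit_qubit_mask: "distinct qs \<Longrightarrow> bit (qubit_mask qs) p \<longleftrightarrow> p \<in> set qs"
  by (induction qs rule: rev_induct) (auto simp: qubit_mask_snoc bit_flip_bit_iff, simp add: qubit_mask_def)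

lemma xor_less: "x < 2 ^ m \<Longrightarrow> M < 2 ^ m \<Longrightarrow> xor x M < (2 ^ m :: nat)"
  by (auto simp: nat_less_two_power_iff bit_xor_iff)

lemma flip_bit_xor: "xor (flip_bit q x) M = flip_bit q (xor x M :: nat)" "xor x (flip_bit q M) = flip_bit q (xor x M :: nat)"
  by (rule bit_eqI, auto simp: bit_flip_bit_iff bit_xor_iff)+

text \<open>Conjugating with Hadamard gates turns \<open>Z\<close> observables into \<open>X\<close> observables.\<close>

lemma sum_sgn_hadamards:
  assumes \<sigma>: "\<sigma> \<in> carrier_mat (2 ^ m) (2 ^ m)" and "set qs \<subseteq> {..<m}" "distinct qs"
    and "M < 2 ^ m" "\<forall>q\<in>set qs. \<not> bit M q"
  shows "(\<Sum>x<2 ^ m. (\<Prod>q\<leftarrow>qs. sgn_bit q x) * hadamards m qs \<sigma> $$ (x, xor x M))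
    = (\<Sum>x<2 ^ m. \<sigma> $$ (x, xor x (xor M (qubit_mask qs))))"
  using assms(2-)
\<comment> \<open>\<open>M\<close> collects the qubits whose Hadamard gates have been removed
  already, so it has to vary.\<close>
proof (induction qs arbitrary: M rule: rev_induct)
  case Nil
  then show ?case by (simp add: hadamards_def qubit_mask_def)
next
  case (snoc q qs)
  let ?s = "hadamards m qs \<sigma>"
  define S where "S x = (\<Prod>q\<leftarrow>qs. sgn_bit q x)" for x
  have q: "q < m" "q \<notin> set qs" "\<not> bit M q" using snoc.prems by auto
  have S: "S (flip_bit q x) = S x" for x
    unfolding S_def using q by (intro arg_cong[of _ _ prod_list] map_cong) (auto simp: sgn_bit_flip_bit)
  have sM: "sgn_bit q (xor x M) = sgn_bit q x" for x
    using q by (simp add: sgn_bit_def bit_xor_iff)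
  \<comment> \<open>Of the four terms of a Hadamard conjugation, the two \<open>t1\<close> terms
    cancel and the two \<open>t2\<close> terms agree after summation, because flipping permutes the
    basis states.\<close>
  define t1 where "t1 x = S x * (sgn_bit q x * ?s $$ (x, xor x M))" for x
  define t2 where "t2 x = S x * ?s $$ (x, flip_bit q (xor x M))" for x
  have "(\<Sum>x<2 ^ m. (\<Prod>q\<leftarrow>qs @ [q]. sgn_bit q x) * hadamards m (qs @ [q]) \<sigma> $$ (x, xor x M)) =
     (\<Sum>x<2 ^ m. (t1 x + t2 x + t2 (flip_bit q x) - t1 (flip_bit q x)) / 2)"
  proof (intro sum.cong refl)
    fix x :: nat assume "x \<in> {..<2 ^ m}"
    then have x: "x < 2 ^ m" "xor x M < 2 ^ m" using xor_less snoc.prems by auto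
    have "(\<Prod>q\<leftarrow>qs @ [q]. sgn_bit q x) * hadamards m (qs @ [q]) \<sigma> $$ (x, xor x M)
      = S x * (sgn_bit q x * ((sgn_bit q x * sgn_bit q x * ?s $$ (x, xor x M) + sgn_bit q x * ?s $$ (x, flip_bit q (xor x M))
          + sgn_bit q x * ?s $$ (flip_bit q x, xor x M) + ?s $$ (flip_bit q x, flip_bit q (xor x M))) / 2))"
      unfolding hadamards_snoc conj_by_hadamard_index[OF q(1) hadamards_carrier[OF \<sigma>] x] sM by (simp add: S_def)
    also have "\<dots> = (t1 x + t2 x + t2 (flip_bit q x) - t1 (flip_bit q x)) / 2"
      unfolding t1_def t2_def S flip_bit_xor flip_bit_flip_bit
      by (cases "bit x q") (auto simp: sgn_bit_def bit_flip_bit_iff algebra_simps)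
    finally show "(\<Prod>q\<leftarrow>qs @ [q]. sgn_bit q x) * hadamards m (qs @ [q]) \<sigma> $$ (x, xor x M) = \<dots>" .
  qed
  also have "\<dots> = (\<Sum>x<2 ^ m. t2 x)"
    by (simp add: sum.distrib sum_subtractf sum_flip_bit[OF q(1)] flip: sum_divide_distrib)
  also have "\<dots> = (\<Sum>x<2 ^ m. S x * ?s $$ (x, xor x (flip_bit q M)))"
    unfolding t2_def flip_bit_xor ..
  also have "\<dots> = (\<Sum>x<2 ^ m. \<sigma> $$ (x, xor x (xor (flip_bit q M) (qubit_mask qs))))"
    unfolding S_def using snoc.prems q by (intro snoc.IH) (auto simp: flip_bit_less bit_flip_bit_iff)
  also have "xor (flip_bit q M) (qubit_mask qs) = xor M (qubit_mask (qs @ [q]))"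
    by (simp add: qubit_mask_snoc flip_bit_xor)
  finally show ?case .
qed

text \<open>A Hadamard gate turns a qubit in the state |0> into |+>, whose density matrix has all
  entries 1/2: the condition on this qubit disappears and a factor 1/2 appears. \<open>R\<close> is
  the rest of the state, independent of the qubits in \<open>Q\<close>.\<close>

lemma hadamards_ground_index:
  assumes \<sigma>: "\<sigma> \<in> carrier_mat (2 ^ m) (2 ^ m)" and "set qs \<subseteq> Q" "Q \<subseteq> {..<m}" "distinct qs"
    and R: "\<And>q x y. q \<in> Q \<Longrightarrow> R (flip_bit q x) y = R x y \<and> R x (flip_bit q y) = R x y"
    and init: "\<And>x y. x < 2 ^ m \<Longrightarrow> y < 2 ^ m \<Longrightarrow> \<sigma> $$ (x, y) = R x y * of_bool (\<forall>q\<in>Q. \<not> bit x q \<and> \<not> bit y q)"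
    and "x < 2 ^ m" "y < 2 ^ m"
  shows "hadamards m qs \<sigma> $$ (x, y) = R x y * of_bool (\<forall>q\<in>Q - set qs. \<not> bit x q \<and> \<not> bit y q) / 2 ^ length qs"
  using assms(2-4,7-)
proof (induction qs arbitrary: x y rule: rev_induct)
  case Nil
  then show ?case using init by (simp add: hadamards_def)
next
  case (snoc q qs)
  let ?s = "hadamards m qs \<sigma>"
  have q: "q < m" "q \<in> Q" "q \<notin> set qs" using snoc.prems by auto
  define P where "P x y \<longleftrightarrow> (\<forall>p\<in>Q - set (qs @ [q]). \<not> bit x p \<and> \<not> bit y p)" for x y :: nat
  have IH: "?s $$ (x, y) = (if bit x q \<or> bit y q then 0 else R x y * of_bool (P x y) / 2 ^ length qs)"
    if "x < 2 ^ m" "y < 2 ^ m" for x y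
  proof -
    have "(\<forall>p\<in>Q - set qs. \<not> bit x p \<and> \<not> bit y p) \<longleftrightarrow> P x y \<and> \<not> bit x q \<and> \<not> bit y q"
      using q by (auto simp: P_def)
    then show ?thesis using snoc.IH[OF _ _ _ that] snoc.prems by auto
  qed
  have P: "P (flip_bit q x) y = P x y" "P x (flip_bit q y) = P x y" for x y
    by (auto simp: P_def bit_flip_bit_iff)
  note f = flip_bit_less[OF q(1) snoc.prems(4)] flip_bit_less[OF q(1) snoc.prems(5)]
  have "hadamards m (qs @ [q]) \<sigma> $$ (x, y) = R x y * of_bool (P x y) / 2 ^ length qs / 2"
    unfolding hadamards_snoc conj_by_hadamard_index[OF q(1) hadamards_carrier[OF \<sigma>] snoc.prems(4,5)]
    using snoc.prems(4,5) f R[OF q(2)]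
    by (cases "bit x q"; cases "bit y q") (simp_all add: IH P sgn_bit_def bit_flip_bit_iff)
  then show ?case by (simp add: P_def)
qed

section \<open>Traces of powers and reflections\<close>

lemma sum_PiE_lessThan_Suc:
  fixes F :: "(nat \<Rightarrow> nat) \<Rightarrow> 'a :: comm_monoid_add"
  shows "(\<Sum>f\<in>PiE {..<Suc k} (\<lambda>_. {..<d}). F f) = (\<Sum>z<d. \<Sum>f\<in>PiE {..<k} (\<lambda>_. {..<d}). F (f(k := z)))"
proof -
  have inj: "inj_on (\<lambda>(z, f). f(k := z)) ({..<d} \<times> PiE {..<k} (\<lambda>_. {..<d}))"
    using inj_combinator[of k "{..<k}" "\<lambda>_. {..<d}"] by simp
  have eq: "PiE {..<Suc k} (\<lambda>_. {..<d}) = (\<lambda>(z, f). f(k := z)) ` ({..<d} \<times> PiE {..<k} (\<lambda>_. {..<d}))"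
    unfolding lessThan_Suc by (rule PiE_insert_eq)
  have "(\<Sum>f\<in>PiE {..<Suc k} (\<lambda>_. {..<d}). F f)
      = (\<Sum>p\<in>{..<d} \<times> PiE {..<k} (\<lambda>_. {..<d}). F (case p of (z, f) \<Rightarrow> f(k := z)))"
    unfolding eq by (subst sum.reindex[OF inj]) (simp only: o_def)
  then show ?thesis by (simp add: sum.cartesian_product split_def)
qed

text \<open>Sum over the paths from \<open>x\<close> to \<open>y\<close>: they have
  \<open>Suc k\<close> edges and the \<open>k\<close> intermediate points
  \<open>f 0, ..., f (k - 1)\<close>.\<close>

lemma index_pow_mat_paths:
  fixes A :: "complex mat"
  assumes A: "A \<in> carrier_mat d d" and "x < d" "y < d"
  shows "(A ^\<^sub>m Suc k) $$ (x, y) =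
    (\<Sum>f\<in>PiE {..<k} (\<lambda>_. {..<d}).
      \<Prod>s<Suc k. A $$ (if s = 0 then x else f (s - 1), if s = k then y else f s))"
  using assms(3)
proof (induction k arbitrary: y)
  case 0
  have "A ^\<^sub>m Suc 0 = A" using A by simp
  then show ?case by simp
next
  case (Suc k)
  let ?a = "\<lambda>f s. if s = 0 then x else f (s - 1)"
  have "A ^\<^sub>m Suc k \<in> carrier_mat d d" using A by (rule pow_carrier_mat)
  then have "(A ^\<^sub>m Suc (Suc k)) $$ (x, y) = (\<Sum>z<d. (A ^\<^sub>m Suc k) $$ (x, z) * A $$ (z, y))"
    using A assms(2) Suc.prems unfolding pow_mat.simps(2)[of A "Suc k"]
    by (simp add: scalar_prod_def atLeast0LessThan)
  also have "\<dots> = (\<Sum>z<d. \<Sum>f\<in>PiE {..<k} (\<lambda>_. {..<d}).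
      (\<Prod>s<Suc k. A $$ (?a f s, if s = k then z else f s)) * A $$ (z, y))"
    by (intro sum.cong refl) (simp add: Suc.IH sum_distrib_right del: pow_mat.simps prod.lessThan_Suc)
  also have "\<dots> = (\<Sum>z<d. \<Sum>f\<in>PiE {..<k} (\<lambda>_. {..<d}).
      \<Prod>s<Suc (Suc k). A $$ (?a (f(k := z)) s, if s = Suc k then y else (f(k := z)) s))"
  proof (intro sum.cong refl)
    fix z f
    have "(\<Prod>s<Suc k. A $$ (?a f s, if s = k then z else f s))
        = (\<Prod>s<Suc k. A $$ (?a (f(k := z)) s, if s = Suc k then y else (f(k := z)) s))"
      by (intro prod.cong refl) auto
    then show "(\<Prod>s<Suc k. A $$ (?a f s, if s = k then z else f s)) * A $$ (z, y)
        = (\<Prod>s<Suc (Suc k). A $$ (?a (f(k := z)) s, if s = Suc k then y else (f(k := z)) s))"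
      unfolding prod.lessThan_Suc[of _ "Suc k"] by simp
  qed
  also have "\<dots> = (\<Sum>f\<in>PiE {..<Suc k} (\<lambda>_. {..<d}).
      \<Prod>s<Suc (Suc k). A $$ (?a f s, if s = Suc k then y else f s))"
    by (rule sum_PiE_lessThan_Suc[symmetric])
  finally show ?case .
qed

text \<open>In the trace, the common endpoint \<open>z\<close> of the path becomes one more point
  \<open>f k\<close>, which closes the path into a cycle.\<close>

lemma mtrace_pow_eq_sum_cycles:
  fixes A :: "complex mat"
  assumes A: "A \<in> carrier_mat d d" and j: "1 \<le> j"
  shows "mtrace (A ^\<^sub>m j) = (\<Sum>f\<in>PiE {..<j} (\<lambda>_. {..<d}). \<Prod>s<j. A $$ (f s, f (Suc s mod j)))"
proof -
  obtain k where k: "j = Suc k" using j by (cases j) auto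
  let ?p = "\<lambda>s. if s = 0 then k else s - 1"
  have "A ^\<^sub>m j \<in> carrier_mat d d" using A by (rule pow_carrier_mat)
  then have "mtrace (A ^\<^sub>m j) = (\<Sum>z<d. (A ^\<^sub>m Suc k) $$ (z, z))" using carrier_matD(1)[OF A] unfolding mtrace_def k by simp
  also have "\<dots> = (\<Sum>z<d. \<Sum>f\<in>PiE {..<k} (\<lambda>_. {..<d}).
      \<Prod>s<Suc k. A $$ ((f(k := z)) (?p s), (f(k := z)) s))"
  proof (intro sum.cong refl)
    fix z assume "z \<in> {..<d}"
    then have z: "z < d" by simp
    show "(A ^\<^sub>m Suc k) $$ (z, z) = (\<Sum>f\<in>PiE {..<k} (\<lambda>_. {..<d}).
      \<Prod>s<Suc k. A $$ ((f(k := z)) (?p s), (f(k := z)) s))"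
      unfolding index_pow_mat_paths[OF A z z]
    proof (intro sum.cong prod.cong refl)
      fix f :: "nat \<Rightarrow> nat" and s assume "s \<in> {..<Suc k}"
      then have "(f(k := z)) (?p s) = (if s = 0 then z else f (s - 1))" by auto
      then show "A $$ (if s = 0 then z else f (s - 1), if s = k then z else f s) = A $$ ((f(k := z)) (?p s), (f(k := z)) s)"
        by (simp only: fun_upd_apply)
    qed
  qed
  also have "\<dots> = (\<Sum>f\<in>PiE {..<Suc k} (\<lambda>_. {..<d}). \<Prod>s<Suc k. A $$ (f (?p s), f s))"
    by (rule sum_PiE_lessThan_Suc[symmetric])
  also have "\<dots> = (\<Sum>f\<in>PiE {..<Suc k} (\<lambda>_. {..<d}). \<Prod>s<Suc k. A $$ (f s, f (Suc s mod Suc k)))"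
  proof (intro sum.cong refl)
    fix f :: "nat \<Rightarrow> nat"
    show "(\<Prod>s<Suc k. A $$ (f (?p s), f s)) = (\<Prod>s<Suc k. A $$ (f s, f (Suc s mod Suc k)))"
    \<comment> \<open>\<open>?p\<close> is the cyclic predecessor, inverse to
      \<open>Suc s mod Suc k\<close>.\<close>
    proof (rule prod.reindex_bij_witness[of _ "\<lambda>s. Suc s mod Suc k" ?p])
      fix s assume "s \<in> {..<Suc k}"
      then have s: "s \<le> k" by auto
      have suc: "Suc i mod Suc k = (if i = k then 0 else Suc i)" if "i \<le> k" for i using that by auto
      show "?p (Suc s mod Suc k) = s" "Suc s mod Suc k \<in> {..<Suc k}" using s by (auto simp: suc)
      have "?p s \<le> k" using s by auto
      then show p: "Suc (?p s) mod Suc k = s" "?p s \<in> {..<Suc k}" using s by (auto simp: suc[OF \<open>?p s \<le> k\<close>])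
      show "A $$ (f (?p s), f (Suc (?p s) mod Suc k)) = A $$ (f (?p s), f s)" unfolding p ..
    qed
  qed
  finally show ?thesis by (simp add: k)
qed

text \<open>A pair \<open>{r, N - r}\<close> is named by its smaller element.\<close>

definition partial_reflection :: "nat \<Rightarrow> (nat \<Rightarrow> bool) \<Rightarrow> nat \<Rightarrow> nat" where
  "partial_reflection N b r = (if b (min r (N - r)) then N - r else r)"

lemma partial_reflection_le: "r \<le> N \<Longrightarrow> partial_reflection N b r \<le> N"
  by (simp add: partial_reflection_def)

text \<open>Each pair is preserved, so a second partial reflection consults its selection at the
  same name; the next two lemmas rest on this.\<close>

lemma min_partial_reflection:
  "r \<le> N \<Longrightarrow> min (partial_reflection N b r) (N - partial_reflection N b r) = min r (N - r)"
  by (auto simp: partial_reflection_def)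

lemma partial_reflection_involutive:
  assumes "r \<le> N"
  shows "partial_reflection N b (partial_reflection N b r) = r"
  using min_partial_reflection[OF assms, of b] assms
  by (subst partial_reflection_def, simp only:) (auto simp: partial_reflection_def)

lemma partial_reflection_complement:
  assumes "r \<le> N" "c (min r (N - r)) \<longleftrightarrow> \<not> b (min r (N - r))"
  shows "partial_reflection N c (partial_reflection N b r) = N - r"
  using min_partial_reflection[OF assms(1), of b] assms
  by (subst partial_reflection_def, simp only:) (auto simp: partial_reflection_def)

text \<open>The complementary selections \<open>a\<close> and \<open>a'\<close> of one reflection, and likewise \<open>b\<close> and \<open>b'\<close>, compose to the
  full reflections, and the product of these is the cyclic shift.\<close>

lemma cyclic_reflections:
  assumes j: "1 \<le> j" and A: "\<rho> \<in> carrier_mat d d"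
    and a: "\<And>i. i < j \<Longrightarrow> a' i \<longleftrightarrow> \<not> a i" and b: "\<And>i. i < j \<Longrightarrow> b' i \<longleftrightarrow> \<not> b i"
  defines "\<alpha> \<equiv> partial_reflection (j - 1)" and "\<beta> \<equiv> \<lambda>b. partial_reflection j (\<lambda>i. i \<noteq> 0 \<and> b i)"
  shows "(\<Sum>f\<in>PiE {..<j} (\<lambda>_. {..<d}). \<Prod>r<j. \<rho> $$ (f (\<beta> b (\<alpha> a r)), f (\<beta> b' (\<alpha> a' r)))) = mtrace (\<rho> ^\<^sub>m j)"
proof -
  have \<alpha>: "\<alpha> a r < j" "\<alpha> a (\<alpha> a r) = r" "\<alpha> a' (\<alpha> a r) = j - 1 - r" if "r < j" for r
  proof -
    have r: "r \<le> j - 1" using that by simp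
    have "a' (min r (j - 1 - r)) \<longleftrightarrow> \<not> a (min r (j - 1 - r))" by (rule a) (use that in auto)
    with r show "\<alpha> a' (\<alpha> a r) = j - 1 - r" unfolding \<alpha>_def by (rule partial_reflection_complement)
    show "\<alpha> a (\<alpha> a r) = r" unfolding \<alpha>_def by (rule partial_reflection_involutive[OF r])
    have "\<alpha> a r \<le> j - 1" unfolding \<alpha>_def by (rule partial_reflection_le[OF r])
    then show "\<alpha> a r < j" using j by linarith
  qed
  have \<alpha>': "j - 1 - \<alpha> a r = \<alpha> a' r" if "r < j" for r
    using \<alpha>(3)[OF \<alpha>(1)[OF that]] \<alpha>(2)[OF that] by simp
  \<comment> \<open>The partner of 0 in the pairs of sum \<open>j\<close> would be \<open>j\<close>,
    outside the registers; the selection excludes 0, which is a fixed point of negation modulo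
    \<open>j\<close>.\<close>
  have \<beta>0: "\<beta> c 0 = 0" for c by (simp add: \<beta>_def partial_reflection_def)
  have \<beta>_less: "\<beta> c r < j" if "r < j" for r c
    using that by (auto simp: \<beta>_def partial_reflection_def min_def)
  have \<beta>: "\<beta> b (\<beta> b r) = r" if "r < j" for r
    using that partial_reflection_involutive[of r j] by (simp add: \<beta>_def)
  have \<beta>': "\<beta> b (\<beta> b' r) = (if r = 0 then 0 else j - r)" if "r < j" for r
  proof (cases "r = 0")
    case False
    then have "min r (j - r) \<noteq> 0" "min r (j - r) < j" using that by auto
    then show ?thesis
      using that False partial_reflection_complement[of r j] b[of "min r (j - r)"] by (simp add: \<beta>_def)
  qed (simp add: \<beta>0)
  \<comment> \<open>Reindexing the product by \<open>\<alpha> a\<close> merges the two selections of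
    the first reflection into the full one.\<close>
  have "(\<Sum>f\<in>PiE {..<j} (\<lambda>_. {..<d}). \<Prod>r<j. \<rho> $$ (f (\<beta> b (\<alpha> a r)), f (\<beta> b' (\<alpha> a' r))))
      = (\<Sum>f\<in>PiE {..<j} (\<lambda>_. {..<d}). \<Prod>s<j. \<rho> $$ (f (\<beta> b s), f (\<beta> b' (j - 1 - s))))"
    (is "_ = sum ?g _")
  proof (intro sum.cong refl)
    fix f :: "nat \<Rightarrow> nat"
    show "(\<Prod>r<j. \<rho> $$ (f (\<beta> b (\<alpha> a r)), f (\<beta> b' (\<alpha> a' r)))) = ?g f"
      by (rule prod.reindex_bij_witness[of _ "\<alpha> a" "\<alpha> a"]) (simp_all add: \<alpha>(1,2) \<alpha>' del: One_nat_def diff_diff_left)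
  qed
  \<comment> \<open>Relabelling the summation variable \<open>f\<close> by \<open>\<beta> b\<close>
    does the same for the second reflection.\<close>
  also have "\<dots> = (\<Sum>f\<in>PiE {..<j} (\<lambda>_. {..<d}). \<Prod>s<j. \<rho> $$ (f s, f (Suc s mod j)))"
    (is "_ = sum ?h _")
  proof (rule sum.reindex_bij_witness[of _ "\<lambda>f. restrict (f \<circ> \<beta> b) {..<j}" "\<lambda>f. restrict (f \<circ> \<beta> b) {..<j}"])
    fix f :: "nat \<Rightarrow> nat" assume f: "f \<in> PiE {..<j} (\<lambda>_. {..<d})"
    have f_less: "f r < d" if "r < j" for r using PiE_mem[OF f, of r] that by simp
    show *: "restrict (restrict (f \<circ> \<beta> b) {..<j} \<circ> \<beta> b) {..<j} = f"
    proof
      fix r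
      show "restrict (restrict (f \<circ> \<beta> b) {..<j} \<circ> \<beta> b) {..<j} r = f r"
        using PiE_arb[OF f, of r] by (cases "r < j") (simp_all add: \<beta> \<beta>_less)
    qed
    show "restrict (restrict (f \<circ> \<beta> b) {..<j} \<circ> \<beta> b) {..<j} = f" by (rule *)
    show *: "restrict (f \<circ> \<beta> b) {..<j} \<in> PiE {..<j} (\<lambda>_. {..<d})"
      by (simp add: restrict_PiE_iff f_less \<beta>_less)
    show "restrict (f \<circ> \<beta> b) {..<j} \<in> PiE {..<j} (\<lambda>_. {..<d})" by (rule *)
    show "?h (restrict (f \<circ> \<beta> b) {..<j}) = ?g f"
    proof (intro prod.cong refl)
      fix s assume "s \<in> {..<j}"
      then have s: "s < j" by simp
      \<comment> \<open>\<open>j - (j - 1 - s)\<close> is \<open>Suc s\<close>; at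
        \<open>s = j - 1\<close> the fixed point 0 supplies the reduction modulo
        \<open>j\<close>.\<close>
      have "\<beta> b (Suc s mod j) = \<beta> b' (j - 1 - s)"
      proof -
        have "\<beta> b (\<beta> b' (j - 1 - s)) = Suc s mod j"
          using \<beta>'[of "j - 1 - s"] s by (cases "Suc s = j") auto
        then show ?thesis using \<beta>[of "\<beta> b' (j - 1 - s)"] \<beta>_less[of "j - 1 - s" b'] s by simp
      qed
      then show "\<rho> $$ (restrict (f \<circ> \<beta> b) {..<j} s, restrict (f \<circ> \<beta> b) {..<j} (Suc s mod j))
          = \<rho> $$ (f (\<beta> b s), f (\<beta> b' (j - 1 - s)))"
        using s by simp
    qed
  qed
  also have "\<dots> = mtrace (\<rho> ^\<^sub>m j)" using mtrace_pow_eq_sum_cycles[OF A j] by simp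
  finally show ?thesis .
qed

section \<open>Controlled swaps that realise the partial reflections\<close>

definition reflection_swaps :: "nat \<Rightarrow> nat \<Rightarrow> nat \<Rightarrow> nat \<Rightarrow> (nat \<times> nat \<times> nat) list" where
  "reflection_swaps c N lo hi = map (\<lambda>i. (c + i, i, N - i)) [lo..<hi]"

text \<open>The permutation of register names for the control bits in \<open>x\<close>;
  \<open>fold\<close> lets the head of the list act first.\<close>

definition cswap_perm :: "nat \<Rightarrow> (nat \<times> nat \<times> nat) list \<Rightarrow> nat \<Rightarrow> nat" where
  "cswap_perm x gs = fold (\<lambda>(c, r, s). if bit x c then Transposition.transpose r s else id) gs"

text \<open>By induction on \<open>hi\<close>: \<open>2 * hi \<le> Suc N\<close> makes
  \<open>i < N - i\<close> in all pairs, so the transpositions are disjoint and the one for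
  \<open>k\<close> touches only the pair named \<open>k\<close>.\<close>

lemma cswap_perm_reflection_swaps:
  assumes "2 * hi \<le> Suc N" "r \<le> N"
  shows "cswap_perm x (reflection_swaps c N lo hi) r =
    partial_reflection N (\<lambda>i. lo \<le> i \<and> i < hi \<and> bit x (c + i)) r"
  using assms(1)
proof (induction hi)
  case 0
  then show ?case by (simp add: cswap_perm_def reflection_swaps_def partial_reflection_def)
next
  case (Suc k)
  let ?pr = "\<lambda>h. partial_reflection N (\<lambda>i. lo \<le> i \<and> i < h \<and> bit x (c + i)) r"
  show ?case
  proof (cases "lo \<le> k")
    case True
    have "cswap_perm x (reflection_swaps c N lo (Suc k)) r
        = (if bit x (c + k) then Transposition.transpose k (N - k) else id) (?pr k)"
      using Suc True by (simp add: cswap_perm_def reflection_swaps_def)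
    also have "\<dots> = ?pr (Suc k)"
    proof (cases "min r (N - r) = k")
      case True
      then show ?thesis using \<open>lo \<le> k\<close> assms(2)
        by (auto simp: partial_reflection_def Transposition.transpose_def min_def split: if_splits)
    next
      case False
      then have "r \<noteq> k" "r \<noteq> N - k" "N - r \<noteq> k" "N - r \<noteq> N - k" using assms(2) Suc.prems by auto
      then have "Transposition.transpose k (N - k) (?pr k) = ?pr k"
        by (auto simp: partial_reflection_def Transposition.transpose_def)
      moreover have "?pr (Suc k) = ?pr k" using False by (auto simp: partial_reflection_def less_Suc_eq)
      ultimately show ?thesis by simp
    qed
    finally show ?thesis .
  next
    case False
    then have "\<not> (lo \<le> i \<and> i < Suc k \<and> bit x (c + i))" for i by linarith
    then have "partial_reflection N (\<lambda>i. lo \<le> i \<and> i < Suc k \<and> bit x (c + i)) r = r"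
      by (simp only: partial_reflection_def if_False)
    then show ?thesis using False by (simp add: reflection_swaps_def cswap_perm_def)
  qed
qed

text \<open>A name from \<open>j div 2\<close> on belongs to the middle register, which is its own
  partner, so its control bit has no effect.\<close>

lemma cswap_perm_swaps_1:
  assumes "r < j"
  shows "cswap_perm x (reflection_swaps c (j - 1) 0 (j div 2)) r = partial_reflection (j - 1) (\<lambda>i. bit x (c + i)) r"
proof -
  have "cswap_perm x (reflection_swaps c (j - 1) 0 (j div 2)) r
      = partial_reflection (j - 1) (\<lambda>i. 0 \<le> i \<and> i < j div 2 \<and> bit x (c + i)) r"
    using assms by (intro cswap_perm_reflection_swaps) auto
  also have "\<dots> = partial_reflection (j - 1) (\<lambda>i. bit x (c + i)) r"
  proof (cases "min r (j - 1 - r) < j div 2")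
    case False
    then have "j - 1 - r = r" using assms by linarith
    then show ?thesis by (simp only: partial_reflection_def if_cancel)
  qed (simp add: partial_reflection_def)
  finally show ?thesis .
qed

text \<open>As for the first reflection; the register that is its own partner is now
  \<open>j / 2\<close>, for even \<open>j\<close>.\<close>

lemma cswap_perm_swaps_2:
  assumes "r < j"
  shows "cswap_perm x (reflection_swaps c j 1 ((j + 1) div 2)) r = partial_reflection j (\<lambda>i. i \<noteq> 0 \<and> bit x (c + i)) r"
proof -
  have "cswap_perm x (reflection_swaps c j 1 ((j + 1) div 2)) r
      = partial_reflection j (\<lambda>i. 1 \<le> i \<and> i < (j + 1) div 2 \<and> bit x (c + i)) r"
    using assms by (intro cswap_perm_reflection_swaps) auto
  also have "\<dots> = partial_reflection j (\<lambda>i. i \<noteq> 0 \<and> bit x (c + i)) r"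
  proof (cases "min r (j - r) < (j + 1) div 2")
    case False
    then have "j - r = r" using assms by linarith
    then show ?thesis by (simp only: partial_reflection_def if_cancel)
  qed (simp add: partial_reflection_def Suc_le_eq)
  finally show ?thesis .
qed

section \<open>Sequences of controlled swaps\<close>

definition valid_swap :: "nat \<Rightarrow> nat \<Rightarrow> nat \<Rightarrow> nat \<times> nat \<times> nat \<Rightarrow> bool" where
  "valid_swap n j m = (\<lambda>(c, r, s). r < j \<and> s < j \<and> r \<noteq> s \<and> j * n \<le> c \<and> c < m)"

definition cswaps :: "nat \<Rightarrow> nat \<Rightarrow> (nat \<times> nat \<times> nat) list \<Rightarrow> complex mat \<Rightarrow> complex mat" where
  "cswaps n m gs = fold (\<lambda>(c, r, s). conj_by (cswap_mat n m c r s)) gs"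

text \<open>\<open>foldr\<close>, because entries are pulled back: the last gate acts first on an
  index.\<close>

definition cswaps_index :: "nat \<Rightarrow> nat \<Rightarrow> (nat \<times> nat \<times> nat) list \<Rightarrow> nat \<Rightarrow> nat" where
  "cswaps_index n m gs = foldr (\<lambda>(c, r, s). cswap_index n m c r s) gs"

lemma cswaps_carrier [simp]:
  "\<sigma> \<in> carrier_mat (2 ^ m) (2 ^ m) \<Longrightarrow> cswaps n m gs \<sigma> \<in> carrier_mat (2 ^ m) (2 ^ m)"
  by (induction gs arbitrary: \<sigma>) (simp_all add: cswaps_def split_def)

lemma has_gram_cswaps:
  "\<sigma> \<in> carrier_mat (2 ^ m) (2 ^ m) \<Longrightarrow> has_gram (2 ^ m) \<sigma> \<Longrightarrow> has_gram (2 ^ m) (cswaps n m gs \<sigma>)"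
proof (induction gs arbitrary: \<sigma>)
  case (Cons g gs)
  obtain c r s where g: "g = (c, r, s)" by (cases g)
  have "cswaps n m (g # gs) \<sigma> = cswaps n m gs (conj_by (cswap_mat n m c r s) \<sigma>)" by (simp add: cswaps_def g)
  then show ?case using Cons.IH[of "conj_by (cswap_mat n m c r s) \<sigma>"] Cons.prems has_gram_conj_by[OF cswap_mat_carrier Cons.prems]
    by simp
qed (simp add: cswaps_def)

lemma cswaps_index_less: "x < 2 ^ m \<Longrightarrow> cswaps_index n m gs x < 2 ^ m"
  by (cases gs) (auto simp: cswaps_index_def split_def)

lemma cswaps_eq_index:
  assumes "\<forall>g\<in>set gs. valid_swap n j m g" "\<sigma> \<in> carrier_mat (2 ^ m) (2 ^ m)" "x < 2 ^ m" "y < 2 ^ m"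
  shows "cswaps n m gs \<sigma> $$ (x, y) = \<sigma> $$ (cswaps_index n m gs x, cswaps_index n m gs y)"
  using assms(1,2)
proof (induction gs arbitrary: \<sigma>)
  case (Cons g gs)
  obtain c r s where g: "g = (c, r, s)" by (cases g)
  have v: "r < j" "s < j" "j * n \<le> c" "c < m" using Cons.prems by (auto simp: g valid_swap_def)
  have "cswaps n m (g # gs) \<sigma> $$ (x, y) = cswaps n m gs (conj_by (cswap_mat n m c r s) \<sigma>) $$ (x, y)"
    by (simp add: cswaps_def g)
  also have "\<dots> = conj_by (cswap_mat n m c r s) \<sigma> $$ (cswaps_index n m gs x, cswaps_index n m gs y)"
    using Cons.prems by (intro Cons.IH) auto
  also have "\<dots> = \<sigma> $$ (cswaps_index n m (g # gs) x, cswaps_index n m (g # gs) y)"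
    using conj_by_cswap_index[OF v Cons.prems(2) cswaps_index_less[OF assms(3)] cswaps_index_less[OF assms(4)]]
    by (simp add: cswaps_index_def g)
  finally show ?case .
qed (simp add: cswaps_def cswaps_index_def)

lemma sum_diag_cswaps:
  assumes "\<forall>g\<in>set gs. valid_swap n j m g" "\<sigma> \<in> carrier_mat (2 ^ m) (2 ^ m)"
  shows "(\<Sum>x<2 ^ m. cswaps n m gs \<sigma> $$ (x, x)) = (\<Sum>x<2 ^ m. \<sigma> $$ (x, x))"
  using assms
proof (induction gs arbitrary: \<sigma>)
  case (Cons g gs)
  obtain c r s where g: "g = (c, r, s)" by (cases g)
  have v: "r < j" "s < j" "j * n \<le> c" "c < m" using Cons.prems by (auto simp: g valid_swap_def)
  have "(\<Sum>x<2 ^ m. cswaps n m (g # gs) \<sigma> $$ (x, x)) = (\<Sum>x<2 ^ m. cswaps n m gs (conj_by (cswap_mat n m c r s) \<sigma>) $$ (x, x))"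
    by (simp add: cswaps_def g)
  also have "\<dots> = (\<Sum>x<2 ^ m. conj_by (cswap_mat n m c r s) \<sigma> $$ (x, x))"
    using Cons.prems by (intro Cons.IH) auto
  also have "\<dots> = (\<Sum>x<2 ^ m. \<sigma> $$ (x, x))"
    by (rule sum.reindex_bij_witness[of _ "cswap_index n m c r s" "cswap_index n m c r s"])
      (use Cons.prems in \<open>simp_all add: cswap_index_involutive[OF v] conj_by_cswap_index[OF v]\<close>)
  finally show ?case .
qed (simp add: cswaps_def)

lemma bit_cswaps_index_ancilla:
  assumes "\<forall>g\<in>set gs. valid_swap n j m g" "j * n \<le> p" "p < m"
  shows "bit (cswaps_index n m gs x) p = bit x p"
  using assms(1) by (induction gs) (auto simp: cswaps_index_def valid_swap_def bit_cswap_index_ancilla assms(2,3))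

text \<open>Controls never move, so every control bit may be read off \<open>x\<close>. The head of
  the list acts last on the index and therefore first on the register name.\<close>

lemma register_cswaps_index:
  assumes "\<forall>g\<in>set gs. valid_swap n j m g" "j * n \<le> m" "r' < j"
  shows "register n r' (cswaps_index n m gs x) = register n (cswap_perm x gs r') x"
  using assms(1,3)
proof (induction gs arbitrary: r')
  case (Cons g gs)
  obtain c r s where g: "g = (c, r, s)" by (cases g)
  have v: "r < j" "s < j" "j * n \<le> c" "c < m" using Cons.prems by (auto simp: g valid_swap_def)
  let ?t = "if bit x c then Transposition.transpose r s r' else r'"
  have t: "?t < j" using v Cons.prems by (auto simp: Transposition.transpose_def)
  have "register n r' (cswaps_index n m (g # gs) x) = register n r' (cswap_index n m c r s (cswaps_index n m gs x))"
    by (simp add: cswaps_index_def g)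
  also have "\<dots> = register n ?t (cswaps_index n m gs x)"
    using register_cswap_index[OF v(1,2) assms(2) Cons.prems(2)] bit_cswaps_index_ancilla[of gs n j m c] Cons.prems v
    by simp
  also have "\<dots> = register n (cswap_perm x gs ?t) x" using Cons t by simp
  also have "cswap_perm x gs ?t = cswap_perm x (g # gs) r'" by (simp add: cswap_perm_def g)
  finally show ?case .
qed (simp add: cswaps_index_def cswap_perm_def)

lemma cswap_perm_less:
  assumes "\<forall>g\<in>set gs. valid_swap n j m g" "r < j"
  shows "cswap_perm x gs r < j"
  using assms
proof (induction gs arbitrary: r)
  case (Cons g gs)
  obtain c a b where g: "g = (c, a, b)" by (cases g)
  let ?t = "if bit x c then Transposition.transpose a b r else r"
  have "?t < j" using Cons.prems by (auto simp: Transposition.transpose_def g valid_swap_def)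
  then have "cswap_perm x gs ?t < j" using Cons by simp
  moreover have "cswap_perm x (g # gs) r = cswap_perm x gs ?t" by (simp add: cswap_perm_def g)
  ultimately show ?case by simp
qed (simp add: cswap_perm_def)

lemma cswap_perm_cong:
  assumes "\<forall>(c, r, s)\<in>set gs. bit x c = bit y c"
  shows "cswap_perm x gs = cswap_perm y gs"
  using assms unfolding cswap_perm_def by (induction gs) auto

section \<open>The initial state: tensor powers indexed by register contents\<close>

lemma sum_registers:
  fixes F :: "nat \<Rightarrow> (nat \<Rightarrow> nat) \<Rightarrow> complex"
  shows "(\<Sum>x<2 ^ (j * n + a). F (drop_bit (j * n) x) (restrict (\<lambda>r. register n r x) {..<j})) =
    (\<Sum>c<2 ^ a. \<Sum>f\<in>PiE {..<j} (\<lambda>_. {..<2 ^ n}). F c f)"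
proof -
  let ?m = "j * n + a"
  let ?h = "\<lambda>x. (drop_bit (j * n) x, restrict (\<lambda>r. register n r x) {..<j})"
  let ?P = "{..<2 ^ a :: nat} \<times> PiE {..<j} (\<lambda>_. {..<2 ^ n :: nat})"
  have inj: "inj_on ?h {..<2 ^ ?m}"
  proof (rule inj_onI)
    fix x y assume x: "x \<in> {..<2 ^ ?m}" and y: "y \<in> {..<2 ^ ?m}" and e: "?h x = ?h y"
    have d: "drop_bit (j * n) x = drop_bit (j * n) y" using e by simp
    have reg: "register n r x = register n r y" if "r < j" for r
      using fun_cong[of _ _ r, OF arg_cong[OF e, of snd]] that by simp
    show "x = y"
    proof (rule nat_eqI_bits[of x ?m y])
      fix p
      show "bit x p = bit y p"
      proof (rule position_cases[of j n p])
        assume "j * n \<le> p"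
        then show ?thesis using arg_cong[OF d, of "\<lambda>z. bit z (p - j * n)"] by (simp add: bit_drop_bit_eq)
      next
        fix r i assume "r < j" "i < n" "p = r * n + i"
        then show ?thesis using arg_cong[OF reg, of r "\<lambda>z. bit z i"] by simp
      qed
    qed (use x y in auto)
  qed
  have fin: "finite ?P" by (intro finite_cartesian_product finite_PiE) auto
  \<comment> \<open>Surjectivity follows from injectivity by counting.\<close>
  have "card ?P = 2 ^ ?m"
    by (simp add: card_cartesian_product card_PiE power_add mult.commute flip: power_mult)
  moreover have "card (?h ` {..<2 ^ ?m}) = 2 ^ ?m" by (subst card_image[OF inj]) simp
  moreover have "?h ` {..<2 ^ ?m} \<subseteq> ?P"
  proof (intro image_subsetI SigmaI)
    fix x :: nat assume "x \<in> {..<2 ^ ?m}"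
    then show "drop_bit (j * n) x \<in> {..<2 ^ a}" by (auto simp: nat_less_two_power_iff bit_drop_bit_eq)
    show "restrict (\<lambda>r. register n r x) {..<j} \<in> PiE {..<j} (\<lambda>_. {..<2 ^ n})"
      by (simp add: restrict_PiE_iff)
  qed
  ultimately have "?h ` {..<2 ^ ?m} = ?P" using fin by (intro card_subset_eq) auto
  then have "(\<Sum>p\<in>?P. F (fst p) (snd p)) = (\<Sum>x<2 ^ ?m. F (fst (?h x)) (snd (?h x)))"
    using sum.reindex[OF inj, of "\<lambda>p. F (fst p) (snd p)"] by (simp add: o_def)
  then show ?thesis by (simp add: sum.cartesian_product split_def)
qed

definition tensor_entry :: "nat \<Rightarrow> nat \<Rightarrow> complex mat \<Rightarrow> nat \<Rightarrow> nat \<Rightarrow> complex" where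
  "tensor_entry n j \<rho> x y = (\<Prod>r<j. \<rho> $$ (register n r x, register n r y))"

lemma init_state_carrier [simp]: "init_state n j a \<rho> \<in> carrier_mat (2 ^ (j * n + a)) (2 ^ (j * n + a))"
  by (simp add: init_state_def)

lemma drop_bit_eq_0_iff_ancillas:
  assumes "x < (2 :: nat) ^ (j * n + a)"
  shows "drop_bit (j * n) x = 0 \<longleftrightarrow> (\<forall>q\<in>{j * n..<j * n + a}. \<not> bit x q)"
proof
  assume d: "drop_bit (j * n) x = 0"
  show "\<forall>q\<in>{j * n..<j * n + a}. \<not> bit x q"
  proof
    fix q assume "q \<in> {j * n..<j * n + a}"
    then have "bit x q = bit (drop_bit (j * n) x) (q - j * n)" by (simp add: bit_drop_bit_eq)
    then show "\<not> bit x q" by (simp add: d)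
  qed
next
  assume *: "\<forall>q\<in>{j * n..<j * n + a}. \<not> bit x q"
  show "drop_bit (j * n) x = 0"
    by (rule bit_eqI) (use * assms in \<open>auto simp: nat_less_two_power_iff bit_drop_bit_eq\<close>)
qed

lemma init_state_index:
  assumes "x < 2 ^ (j * n + a)" "y < 2 ^ (j * n + a)"
  shows "init_state n j a \<rho> $$ (x, y) = tensor_entry n j \<rho> x y * of_bool (drop_bit (j * n) x = 0 \<and> drop_bit (j * n) y = 0)"
  using assms by (simp add: init_state_def tensor_entry_def register_def)

lemma register_flip_ancilla:
  assumes "r < j" "j * n \<le> q"
  shows "register n r (flip_bit q x) = register n r x"
proof (rule bit_eqI)
  fix i
  have "r * n + i \<noteq> q" if "i < n"
  proof -
    have "Suc r * n \<le> j * n" using assms by (intro mult_le_mono1) simp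
    then show ?thesis using that assms by simp
  qed
  then show "bit (register n r (flip_bit q x)) i = bit (register n r x) i" by (auto simp: bit_flip_bit_iff)
qed

text \<open>Expanding the product of the Gram sums over choice functions \<open>L\<close> yields
  tensor products of Gram vectors, restricted to ancillas in the zero state.\<close>

lemma has_gram_init_state:
  assumes "quantum_state n \<rho>"
  shows "has_gram (2 ^ (j * n + a)) (init_state n j a \<rho>)"
proof -
  have \<rho>: "\<rho> \<in> carrier_mat (2 ^ n) (2 ^ n)" "pos_semidef \<rho>" using assms by (auto simp: quantum_state_def)
  obtain w :: "nat \<Rightarrow> nat \<Rightarrow> complex" where w: "\<forall>x<2 ^ n. \<forall>y<2 ^ n. \<rho> $$ (x, y) = (\<Sum>l<2 ^ n. w l x * cnj (w l y))"
    using pos_semidef_gram[OF \<rho>(2,1)] by (elim exE)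
  let ?I = "PiE {..<j} (\<lambda>_. {..<2 ^ n} :: nat set)"
  define v where "v L x = (\<Prod>r<j. w (L r) (register n r x)) * of_bool (drop_bit (j * n) x = 0)" for L :: "nat \<Rightarrow> nat" and x
  have "init_state n j a \<rho> $$ (x, y) = (\<Sum>L\<in>?I. v L x * cnj (v L y))"
    if "x < 2 ^ (j * n + a)" "y < 2 ^ (j * n + a)" for x y
  proof -
    have "tensor_entry n j \<rho> x y = (\<Prod>r<j. \<Sum>l<2 ^ n. w l (register n r x) * cnj (w l (register n r y)))"
      unfolding tensor_entry_def using w by (intro prod.cong refl) simp
    also have "\<dots> = (\<Sum>L\<in>?I. \<Prod>r<j. w (L r) (register n r x) * cnj (w (L r) (register n r y)))"
      by (rule prod_sum_PiE) auto
    finally show ?thesis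
      unfolding init_state_index[OF that]
      by (simp add: v_def sum_distrib_right prod.distrib of_bool_conj mult_ac)
  qed
  then show ?thesis
    unfolding has_gram_def by (intro exI[of _ ?I] exI[of _ v] conjI finite_PiE) auto
qed

lemma sum_diag_init_state:
  assumes "quantum_state n \<rho>"
  shows "(\<Sum>x<2 ^ (j * n + a). init_state n j a \<rho> $$ (x, x)) = 1"
proof -
  have tr: "(\<Sum>z<2 ^ n. \<rho> $$ (z, z)) = 1"
    using assms by (auto simp: quantum_state_def mtrace_def)
  have "(\<Sum>x<2 ^ (j * n + a). init_state n j a \<rho> $$ (x, x))
      = (\<Sum>x<2 ^ (j * n + a). (\<lambda>c f. (\<Prod>r<j. \<rho> $$ (f r, f r)) * of_bool (c = 0)) (drop_bit (j * n) x) (restrict (\<lambda>r. register n r x) {..<j}))"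
    by (intro sum.cong refl) (simp add: init_state_index tensor_entry_def)
  also have "\<dots> = (\<Sum>c<2 ^ a. \<Sum>f\<in>PiE {..<j} (\<lambda>_. {..<2 ^ n}). (\<Prod>r<j. \<rho> $$ (f r, f r)) * of_bool (c = (0 :: nat)))"
    by (rule sum_registers)
  also have "\<dots> = (\<Sum>c<2 ^ a. of_bool (c = (0 :: nat)) * (\<Prod>r<j. \<Sum>z<2 ^ n. \<rho> $$ (z, z)))"
    by (intro sum.cong refl) (subst prod_sum_PiE, auto simp: sum_distrib_left mult.commute)
  also have "\<dots> = 1" by (simp add: tr of_bool_def sum.delta)
  finally show ?thesis .
qed

section \<open>The circuit\<close>

definition ancilla_qubits :: "nat \<Rightarrow> nat \<Rightarrow> nat list" where
  "ancilla_qubits n j = [j * n..<j * n + 2 * j]"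

definition swaps_1 :: "nat \<Rightarrow> nat \<Rightarrow> (nat \<times> nat \<times> nat) list" where
  "swaps_1 n j = reflection_swaps (j * n) (j - 1) 0 (j div 2)"

definition swaps_2 :: "nat \<Rightarrow> nat \<Rightarrow> (nat \<times> nat \<times> nat) list" where
  "swaps_2 n j = reflection_swaps (j * n + j) j 1 ((j + 1) div 2)"

text \<open>The ancillas \<open>j * n + i\<close> control the first reflection and \<open>j * n + j + i\<close> the second one; some of them
  stay unused, and their outcome is always \<open>0\<close>.\<close>

definition swap_test_circuit :: "nat \<Rightarrow> nat \<Rightarrow> circuit" where
  "swap_test_circuit n j = Circuit (2 * j)
     (map (\<lambda>L _. L)
       [map (\<lambda>q. Gate hadamard [q]) (ancilla_qubits n j),
        map (\<lambda>(c, r, s). CSwap c r s) (swaps_1 n j),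
        map (\<lambda>(c, r, s). CSwap c r s) (swaps_2 n j),
        map (\<lambda>q. Gate hadamard [q]) (ancilla_qubits n j),
        map Meas (ancilla_qubits n j)])"

lemma valid_swaps_1: "\<forall>g\<in>set (swaps_1 n j). valid_swap n j (j * n + 2 * j) g"
  by (auto simp: swaps_1_def reflection_swaps_def valid_swap_def)

lemma valid_swaps_2: "\<forall>g\<in>set (swaps_2 n j). valid_swap n j (j * n + 2 * j) g"
  by (auto simp: swaps_2_def reflection_swaps_def valid_swap_def)

definition swapped_state :: "nat \<Rightarrow> nat \<Rightarrow> complex mat \<Rightarrow> complex mat" where
  "swapped_state n j \<rho> = (let m = j * n + 2 * j in
     cswaps n m (swaps_2 n j) (cswaps n m (swaps_1 n j) (hadamards m (ancilla_qubits n j) (init_state n j (2 * j) \<rho>))))"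

definition final_state :: "nat \<Rightarrow> nat \<Rightarrow> complex mat \<Rightarrow> complex mat" where
  "final_state n j \<rho> = hadamards (j * n + 2 * j) (ancilla_qubits n j) (swapped_state n j \<rho>)"

lemma swapped_state_carrier [simp]:
    "swapped_state n j \<rho> \<in> carrier_mat (2 ^ (j * n + 2 * j)) (2 ^ (j * n + 2 * j))"
  and final_state_carrier [simp]: "final_state n j \<rho> \<in> carrier_mat (2 ^ (j * n + 2 * j)) (2 ^ (j * n + 2 * j))"
  by (simp_all add: swapped_state_def final_state_def Let_def)

lemma has_gram_final_state:
  "quantum_state n \<rho> \<Longrightarrow> has_gram (2 ^ (j * n + 2 * j)) (final_state n j \<rho>)"
  unfolding final_state_def swapped_state_def Let_def
  by (intro has_gram_hadamards has_gram_cswaps has_gram_init_state cswaps_carrier hadamards_carrier init_state_carrier)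

lemma sum_diag_final_state:
  assumes "quantum_state n \<rho>"
  shows "(\<Sum>x<2 ^ (j * n + 2 * j). final_state n j \<rho> $$ (x, x)) = 1"
proof -
  let ?m = "j * n + 2 * j"
  have anc: "set (ancilla_qubits n j) \<subseteq> {..<?m}" by (auto simp: ancilla_qubits_def)
  have "(\<Sum>x<2 ^ ?m. final_state n j \<rho> $$ (x, x)) = (\<Sum>x<2 ^ ?m. init_state n j (2 * j) \<rho> $$ (x, x))"
    unfolding final_state_def swapped_state_def Let_def
    by (simp only: sum_diag_hadamards[OF _ anc] sum_diag_cswaps[OF valid_swaps_1] sum_diag_cswaps[OF valid_swaps_2]
        cswaps_carrier hadamards_carrier init_state_carrier)
  then show ?thesis using sum_diag_init_state[OF assms] by simp
qed

text \<open>The first Hadamard layer makes all control strings coherent with equal weight. The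
  controls in the row index \<open>x\<close> select the permutation on the left, those in the column
  index \<open>y\<close> the one on the right.\<close>

lemma swapped_state_index:
  assumes x: "x < 2 ^ (j * n + 2 * j)" and y: "y < 2 ^ (j * n + 2 * j)"
  shows "swapped_state n j \<rho> $$ (x, y) = (\<Prod>r<j. \<rho> $$
     (register n (cswap_perm x (swaps_2 n j) (cswap_perm x (swaps_1 n j) r)) x,
      register n (cswap_perm y (swaps_2 n j) (cswap_perm y (swaps_1 n j) r)) y)) / 2 ^ (2 * j)"
proof -
  let ?m = "j * n + 2 * j" and ?Q = "{j * n..<j * n + 2 * j}"
  let ?T1 = "cswaps_index n ?m (swaps_1 n j)" and ?T2 = "cswaps_index n ?m (swaps_2 n j)"
  have H: "hadamards ?m (ancilla_qubits n j) (init_state n j (2 * j) \<rho>) $$ (x, y) = tensor_entry n j \<rho> x y / 2 ^ (2 * j)"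
    if "x < 2 ^ ?m" "y < 2 ^ ?m" for x y
  proof -
    have "hadamards ?m (ancilla_qubits n j) (init_state n j (2 * j) \<rho>) $$ (x, y) =
      tensor_entry n j \<rho> x y * of_bool (\<forall>q\<in>?Q - set (ancilla_qubits n j). \<not> bit x q \<and> \<not> bit y q)
        / 2 ^ length (ancilla_qubits n j)"
    proof (rule hadamards_ground_index)
      show "init_state n j (2 * j) \<rho> $$ (x, y) = tensor_entry n j \<rho> x y * of_bool (\<forall>q\<in>?Q. \<not> bit x q \<and> \<not> bit y q)"
        if "x < 2 ^ ?m" "y < 2 ^ ?m" for x y
        using that by (auto simp: init_state_index drop_bit_eq_0_iff_ancillas)
      show "tensor_entry n j \<rho> (flip_bit q x) y = tensor_entry n j \<rho> x y \<and>
          tensor_entry n j \<rho> x (flip_bit q y) = tensor_entry n j \<rho> x y" if "q \<in> ?Q" for q x y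
        using that by (simp add: tensor_entry_def register_flip_ancilla)
    qed (use that in \<open>auto simp: ancilla_qubits_def\<close>)
    then show ?thesis by (simp add: ancilla_qubits_def)
  qed
  have reg: "register n r (?T1 (?T2 x)) = register n (cswap_perm x (swaps_2 n j) (cswap_perm x (swaps_1 n j) r)) x"
    if r: "r < j" for r x
  proof -
    \<comment> \<open>The controls are ancilla bits, which \<open>?T2\<close> leaves alone.\<close>
    have "cswap_perm (?T2 x) (swaps_1 n j) = cswap_perm x (swaps_1 n j)"
      using valid_swaps_1[of n j]
      by (intro cswap_perm_cong) (auto simp: valid_swap_def bit_cswaps_index_ancilla[OF valid_swaps_2])
    then show ?thesis
      using r by (simp add: register_cswaps_index[OF valid_swaps_1] register_cswaps_index[OF valid_swaps_2]
          cswap_perm_less[OF valid_swaps_1])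
  qed
  have "swapped_state n j \<rho> $$ (x, y) = tensor_entry n j \<rho> (?T1 (?T2 x)) (?T1 (?T2 y)) / 2 ^ (2 * j)"
    unfolding swapped_state_def Let_def using x y
    by (simp add: cswaps_eq_index[OF valid_swaps_1] cswaps_eq_index[OF valid_swaps_2] cswaps_index_less H)
  then show ?thesis by (simp add: tensor_entry_def reg)
qed

text \<open>By \<open>sum_sgn_hadamards\<close> the parity reads off the entries at \<open>x\<close>
  and \<open>xor x ?M\<close>, whose control strings are complementary.
  \<open>cyclic_reflections\<close> evaluates the sum over register contents for each control
  string, always to the same trace.\<close>

lemma sum_sgn_final_state:
  assumes \<rho>: "\<rho> \<in> carrier_mat (2 ^ n) (2 ^ n)" and j: "1 \<le> j"
  shows "(\<Sum>x<2 ^ (j * n + 2 * j). (\<Prod>q\<leftarrow>ancilla_qubits n j. sgn_bit q x) * final_state n j \<rho> $$ (x, x)) = mtrace (\<rho> ^\<^sub>m j)"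
proof -
  let ?m = "j * n + 2 * j" and ?anc = "ancilla_qubits n j"
  let ?M = "qubit_mask ?anc"
  let ?\<alpha> = "partial_reflection (j - 1)" and ?\<beta> = "\<lambda>b. partial_reflection j (\<lambda>i. i \<noteq> 0 \<and> b i)"
  have M: "bit ?M p \<longleftrightarrow> j * n \<le> p \<and> p < ?m" for p
    by (subst bit_qubit_mask) (auto simp: ancilla_qubits_def)
  have M_less: "?M < 2 ^ ?m" by (auto simp: nat_less_two_power_iff M)
  \<comment> \<open>The summand as a function of the control string \<open>c\<close> and the
    register contents \<open>f\<close>; row and column have complementary selections.\<close>
  define F :: "nat \<Rightarrow> (nat \<Rightarrow> nat) \<Rightarrow> complex" where
    "F c f = (\<Prod>r<j. \<rho> $$ (f (?\<beta> (\<lambda>i. bit c (j + i)) (?\<alpha> (bit c) r)),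
       f (?\<beta> (\<lambda>i. \<not> bit c (j + i)) (?\<alpha> (\<lambda>i. \<not> bit c i) r)))) / 2 ^ (2 * j)" for c f
  have less1: "?\<alpha> b r < j" if "r < j" for b r
  proof -
    have "r \<le> j - 1" using that by simp
    then have "?\<alpha> b r \<le> j - 1" by (rule partial_reflection_le)
    then show ?thesis using j by linarith
  qed
  have less2: "?\<beta> b r < j" if "r < j" for b r
    using that by (auto simp: partial_reflection_def min_def)
  have perm: "cswap_perm x (swaps_2 n j) (cswap_perm x (swaps_1 n j) r) = ?\<beta> (\<lambda>i. bit x (j * n + (j + i))) (?\<alpha> (\<lambda>i. bit x (j * n + i)) r)"
    if "r < j" for x r
    unfolding swaps_1_def swaps_2_def cswap_perm_swaps_1[OF that]
    unfolding add.assoc[symmetric] by (rule cswap_perm_swaps_2) (rule less1[OF that])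
  have entry: "swapped_state n j \<rho> $$ (x, xor x ?M) = F (drop_bit (j * n) x) (restrict (\<lambda>r. register n r x) {..<j})"
    if x: "x < 2 ^ ?m" for x
  proof -
    have reg: "register n r (xor x ?M) = register n r x" if "r < j" for r
    proof (rule bit_eqI)
      fix i
      have "r * n + i < j * n" if "i < n"
      proof -
        have "Suc r * n \<le> j * n" using \<open>r < j\<close> by (intro mult_le_mono1) simp
        then show ?thesis using that by simp
      qed
      then show "bit (register n r (xor x ?M)) i = bit (register n r x) i" by (auto simp: bit_xor_iff M)
    qed
    \<comment> \<open>Every name is below \<open>j\<close>, so its control lies in the range of the
      mask and is negated.\<close>
    have a: "?\<alpha> (\<lambda>i. bit (xor x ?M) (j * n + i)) r = ?\<alpha> (\<lambda>i. \<not> bit x (j * n + i)) r" if "r < j" for r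
      using that by (simp add: partial_reflection_def bit_xor_iff M min_def)
    have b: "?\<beta> (\<lambda>i. bit (xor x ?M) (j * n + (j + i))) r = ?\<beta> (\<lambda>i. \<not> bit x (j * n + (j + i))) r" if "r < j" for r
      using that by (simp add: partial_reflection_def bit_xor_iff M min_def)
    have D: "bit (drop_bit (j * n) x) = (\<lambda>i. bit x (j * n + i))" by (auto simp: bit_drop_bit_eq)
    show ?thesis
      unfolding swapped_state_index[OF x xor_less[OF x M_less]] F_def D
    proof (intro arg_cong2[of _ _ _ _ "(/)"] prod.cong refl)
      fix r assume "r \<in> {..<j}"
      then have r: "r < j" by simp
      show "\<rho> $$ (register n (cswap_perm x (swaps_2 n j) (cswap_perm x (swaps_1 n j) r)) x,
          register n (cswap_perm (xor x ?M) (swaps_2 n j) (cswap_perm (xor x ?M) (swaps_1 n j) r)) (xor x ?M)) =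
        \<rho> $$ (restrict (\<lambda>r. register n r x) {..<j} (?\<beta> (\<lambda>i. bit x (j * n + (j + i))) (?\<alpha> (\<lambda>i. bit x (j * n + i)) r)),
          restrict (\<lambda>r. register n r x) {..<j} (?\<beta> (\<lambda>i. \<not> bit x (j * n + (j + i))) (?\<alpha> (\<lambda>i. \<not> bit x (j * n + i)) r)))"
        unfolding perm[OF r] a[OF r] b[OF less1[OF r]] reg[OF less2[OF less1[OF r]]]
        using less2[OF less1[OF r]] by (simp only: restrict_apply lessThan_iff if_True)
    qed
  qed
  have "(\<Sum>x<2 ^ ?m. (\<Prod>q\<leftarrow>?anc. sgn_bit q x) * final_state n j \<rho> $$ (x, x))
      = (\<Sum>x<2 ^ ?m. swapped_state n j \<rho> $$ (x, xor x (xor 0 ?M)))"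
    unfolding final_state_def
    using sum_sgn_hadamards[OF swapped_state_carrier[of n j \<rho>], of ?anc 0] by (simp add: ancilla_qubits_def subset_iff)
  also have "\<dots> = (\<Sum>x<2 ^ ?m. F (drop_bit (j * n) x) (restrict (\<lambda>r. register n r x) {..<j}))"
    by (intro sum.cong refl) (simp add: entry)
  also have "\<dots> = (\<Sum>c<2 ^ (2 * j). \<Sum>f\<in>PiE {..<j} (\<lambda>_. {..<2 ^ n}). F c f)"
    by (rule sum_registers)
  also have "\<dots> = (\<Sum>c<(2 :: nat) ^ (2 * j). mtrace (\<rho> ^\<^sub>m j) / 2 ^ (2 * j))"
    unfolding F_def sum_divide_distrib[symmetric] using j
    by (intro sum.cong refl arg_cong2[of _ _ _ _ "(/)"] cyclic_reflections[OF j \<rho>])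
  also have "\<dots> = mtrace (\<rho> ^\<^sub>m j)" by simp
  finally show ?thesis .
qed

section \<open>Outcome statistics\<close>

text \<open>\<open>s = - 1\<close> gives the parity and \<open>s = 1\<close> the constant 1, so that
  one computation covers expectation and normalisation.\<close>

definition outcome_weight :: "real \<Rightarrow> bool list \<Rightarrow> real" where
  "outcome_weight s h = (\<Prod>b\<leftarrow>h. if b then s else 1)"

lemma exec_layer_hadamards:
  "exec_layer n m (map (\<lambda>q. Gate hadamard [q]) qs) (h, \<sigma>) = [(h, hadamards m qs \<sigma>)]"
  by (induction qs arbitrary: \<sigma>) (simp_all add: hadamards_def)

lemma exec_layer_cswaps:
  "exec_layer n m (map (\<lambda>(c, r, s). CSwap c r s) gs) (h, \<sigma>) = [(h, cswaps n m gs \<sigma>)]"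
  by (induction gs arbitrary: \<sigma>) (simp_all add: cswaps_def split_def)

lemma conj_by_proj_mat_diag:
  assumes \<sigma>: "\<sigma> \<in> carrier_mat (2 ^ m) (2 ^ m)" and x: "x < 2 ^ m"
  shows "conj_by (proj_mat m q b) \<sigma> $$ (x, x) = (if bit x q = b then \<sigma> $$ (x, x) else 0)"
proof -
  have "conj_by (proj_mat m q b) \<sigma> $$ (x, x)
      = (\<Sum>k<2 ^ m. \<Sum>l<2 ^ m. if k = x then if l = x then if bit x q = b then \<sigma> $$ (x, x) else 0 else 0 else 0)"
    unfolding conj_by_index[OF proj_mat_carrier \<sigma> x x] using x
    by (intro sum.cong refl) (auto simp: proj_mat_def)
  also have "\<dots> = (\<Sum>k<2 ^ m. if k = x then if bit x q = b then \<sigma> $$ (x, x) else 0 else 0)"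
    using x by (intro sum.cong refl) simp
  finally show ?thesis using x by simp
qed

lemma exec_layer_Meas_nonneg:
  assumes "\<sigma> \<in> carrier_mat (2 ^ m) (2 ^ m)" "\<forall>x<2 ^ m. 0 \<le> Re (\<sigma> $$ (x, x))"
    and "(h', \<sigma>') \<in> set (exec_layer n m (map Meas qs) (h, \<sigma>))"
  shows "0 \<le> Re (mtrace \<sigma>')"
  using assms
proof (induction qs arbitrary: h \<sigma>)
  case Nil
  then show ?case by (auto simp: mtrace_def intro!: sum_nonneg)
next
  case (Cons q qs)
  obtain b where b: "(h', \<sigma>') \<in> set (exec_layer n m (map Meas qs) (h @ [b], conj_by (proj_mat m q b) \<sigma>))"
    using Cons.prems(3) by auto
  show ?case
    by (rule Cons.IH[OF _ _ b]) (use Cons.prems in \<open>auto simp: conj_by_proj_mat_diag\<close>)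
qed

text \<open>Each diagonal entry survives in exactly one branch, the one whose new outcomes are its
  bits.\<close>

lemma exec_layer_Meas_sum:
  assumes "\<sigma> \<in> carrier_mat (2 ^ m) (2 ^ m)"
  shows "(\<Sum>(h', \<sigma>')\<leftarrow>exec_layer n m (map Meas qs) (h, \<sigma>). outcome_weight s h' * Re (mtrace \<sigma>'))
    = outcome_weight s h * Re (\<Sum>x<2 ^ m. (\<Prod>q\<leftarrow>qs. if bit x q then of_real s else 1) * \<sigma> $$ (x, x))"
  using assms
proof (induction qs arbitrary: h \<sigma>)
  case Nil
  then show ?case by (auto simp: mtrace_def)
next
  case (Cons q qs)
  let ?P = "\<lambda>x. \<Prod>q\<leftarrow>qs. if bit x q then of_real s else 1 :: complex"
  let ?S = "\<lambda>b. \<Sum>x<2 ^ m. ?P x * conj_by (proj_mat m q b) \<sigma> $$ (x, x)"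
  have "(\<Sum>(h', \<sigma>')\<leftarrow>exec_layer n m (map Meas (q # qs)) (h, \<sigma>). outcome_weight s h' * Re (mtrace \<sigma>'))
    = outcome_weight s (h @ [False]) * Re (?S False) + outcome_weight s (h @ [True]) * Re (?S True)"
    using Cons by simp
  also have "\<dots> = outcome_weight s h * Re (?S False + of_real s * ?S True)"
    by (simp add: outcome_weight_def algebra_simps)
  also have "?S False + of_real s * ?S True
      = (\<Sum>x<2 ^ m. (\<Prod>q\<leftarrow>q # qs. if bit x q then of_real s else 1) * \<sigma> $$ (x, x))"
    unfolding sum_distrib_left sum.distrib[symmetric] using Cons.prems
    by (intro sum.cong refl) (simp add: conj_by_proj_mat_diag)
  finally show ?case .
qed

lemma exec_swap_test_circuit:
  "exec_layers n (j * n + 2 * j) (layers (swap_test_circuit n j)) ([], init_state n j (2 * j) \<rho>)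
    = exec_layer n (j * n + 2 * j) (map Meas (ancilla_qubits n j)) ([], final_state n j \<rho>)"
proof -
  have "exec_layers n m [] = (\<lambda>br. [br])" for m by auto
  then show ?thesis
    by (simp add: swap_test_circuit_def exec_layer_hadamards exec_layer_cswaps final_state_def
        swapped_state_def Let_def concat_map_singleton)
qed

section \<open>Expectation of the parity of a run\<close>

lemma sum_filter_pmf_list:
  assumes "finite A" "fst ` set xs \<subseteq> A"
  shows "(\<Sum>a\<in>A. f a * sum_list (map snd (filter (\<lambda>z. fst z = a) xs))) = (\<Sum>(a, p)\<leftarrow>xs. f a * p :: real)"
  using assms(2)
proof (induction xs)
  case (Cons z xs)
  obtain a p where z: "z = (a, p)" by (cases z)
  have "(\<Sum>b\<in>A. f b * sum_list (map snd (filter (\<lambda>z. fst z = b) (z # xs))))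
      = (\<Sum>b\<in>A. (if b = a then f a * p else 0) + f b * sum_list (map snd (filter (\<lambda>z. fst z = b) xs)))"
    by (intro sum.cong refl) (auto simp: z algebra_simps)
  also have "\<dots> = f a * p + (\<Sum>(a, p)\<leftarrow>xs. f a * p)"
    using Cons assms(1) by (simp add: sum.distrib z)
  finally show ?case by (simp add: z)
qed simp

text \<open>A value may occur several times in the list; its weights are collected by
  \<open>sum_filter_pmf_list\<close>.\<close>

lemma expectation_pmf_of_list:
  assumes "pmf_of_list_wf xs"
  shows "measure_pmf.expectation (pmf_of_list xs) f = (\<Sum>(a, p)\<leftarrow>xs. f a * p :: real)"
proof -
  have "measure_pmf.expectation (pmf_of_list xs) f = (\<Sum>a\<in>fst ` set xs. f a * pmf (pmf_of_list xs) a)"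
    using set_pmf_of_list[OF assms] by (intro integral_measure_pmf_real) auto
  also have "\<dots> = (\<Sum>(a, p)\<leftarrow>xs. f a * p)"
    unfolding pmf_pmf_of_list[OF assms] by (rule sum_filter_pmf_list) auto
  finally show ?thesis .
qed

text \<open>The branches form a probability distribution by positivity and trace one of the final
  state (\<open>s = 1\<close>); for \<open>s = - 1\<close> the weighted sum is that of
  \<open>sum_sgn_final_state\<close>.\<close>

lemma expectation_run_pmf:
  assumes \<rho>: "quantum_state n \<rho>" and j: "1 \<le> j"
  shows "measure_pmf.expectation (run_pmf n j (swap_test_circuit n j) \<rho>) (outcome_weight (- 1)) = Re (mtrace (\<rho> ^\<^sub>m j))"
proof -
  let ?m = "j * n + 2 * j"
  define br where "br = exec_layer n ?m (map Meas (ancilla_qubits n j)) ([], final_state n j \<rho>)"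
  define xs where "xs = map (\<lambda>(h, \<sigma>). (h, Re (mtrace \<sigma>))) br"
  have run: "run_pmf n j (swap_test_circuit n j) \<rho> = pmf_of_list xs"
    by (simp add: run_pmf_def num_qubits_def xs_def br_def flip: exec_swap_test_circuit)
       (simp add: swap_test_circuit_def)
  have sum: "(\<Sum>(h, p)\<leftarrow>xs. outcome_weight s h * p)
      = Re (\<Sum>x<2 ^ ?m. (\<Prod>q\<leftarrow>ancilla_qubits n j. if bit x q then of_real s else 1) * final_state n j \<rho> $$ (x, x))" for s
    using exec_layer_Meas_sum[OF final_state_carrier[of n j \<rho>], of s n "ancilla_qubits n j" "[]"]
    by (simp add: xs_def br_def o_def split_def outcome_weight_def)
  have wf: "pmf_of_list_wf xs"
  proof (rule pmf_of_list_wfI)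
    show "0 \<le> p" if p: "p \<in> set (map snd xs)" for p
    proof -
      obtain h \<sigma> where b: "(h, \<sigma>) \<in> set br" and p: "p = Re (mtrace \<sigma>)" using p by (auto simp: xs_def)
      have "\<forall>x<2 ^ ?m. 0 \<le> Re (final_state n j \<rho> $$ (x, x))"
        using has_gram_diag_nonneg[OF has_gram_final_state[OF \<rho>]] by blast
      then show ?thesis unfolding p by (rule exec_layer_Meas_nonneg[OF final_state_carrier _ b[unfolded br_def]])
    qed
    have "outcome_weight 1 h = 1" for h by (induction h) (simp_all add: outcome_weight_def)
    moreover have "(\<Prod>q\<leftarrow>qs. if bit x q then of_real 1 else 1 :: complex) = 1" for qs and x :: nat
      by (induction qs) auto
    ultimately show "sum_list (map snd xs) = 1"
      using sum[of 1] sum_diag_final_state[OF \<rho>, of j] by (simp add: split_def)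
  qed
  have "(if bit x q then of_real (- 1) else 1) = sgn_bit q x" for q x
    by (simp add: sgn_bit_def)
  then have "(\<Sum>(h, p)\<leftarrow>xs. outcome_weight (- 1) h * p) = Re (mtrace (\<rho> ^\<^sub>m j))"
    unfolding sum using sum_sgn_final_state[OF _ j, of \<rho> n] \<rho> by (simp only: quantum_state_def)
  then show ?thesis unfolding run expectation_pmf_of_list[OF wf] .
qed

lemma abs_outcome_weight: "\<bar>outcome_weight (- 1) h\<bar> = 1"
  by (induction h) (auto simp: outcome_weight_def abs_mult)

section \<open>Well-formedness and size of the circuit\<close>

lemma wf_qop_hadamard: "wf_qop j (Gate hadamard [q])"
proof -
  have "hadamard * mat_adjoint hadamard = 1\<^sub>m 2"
  proof (rule eq_matI)
    fix i k assume "i < dim_row (1\<^sub>m 2 :: complex mat)" "k < dim_col (1\<^sub>m 2 :: complex mat)"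
    then have ik: "i < 2" "k < 2" by auto
    have s: "complex_of_real (sqrt 2) * complex_of_real (sqrt 2) = 2"
      by (metis of_real_mult of_real_numeral real_sqrt_mult_self abs_numeral)
    have "(hadamard * mat_adjoint hadamard) $$ (i, k) = (\<Sum>l<2. hadamard $$ (i, l) * cnj (hadamard $$ (k, l)))"
      using ik by (subst index_mult_mat_sum) (auto simp: hadamard_def intro!: sum.cong)
    also have "\<dots> = 1\<^sub>m 2 $$ (i, k)"
      using ik s by (auto simp: hadamard_def numeral_2_eq_2 less_Suc_eq)
    finally show "(hadamard * mat_adjoint hadamard) $$ (i, k) = 1\<^sub>m 2 $$ (i, k)" .
  qed (auto simp: hadamard_def)
  then show ?thesis by (simp add: hadamard_def)
qed

lemma disjoint_registers:
  assumes "r \<noteq> (r' :: nat)"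
  shows "{r * n..<r * n + n} \<inter> {r' * n..<r' * n + n} = {}"
proof -
  have "r * n + n \<le> r' * n \<or> r' * n + n \<le> r * n"
    using assms mult_le_mono1[of "Suc r" r' n] mult_le_mono1[of "Suc r'" r n] by (cases "r < r'") auto
  then show ?thesis by auto
qed

text \<open>\<open>2 * hi \<le> Suc N\<close> makes the pairs disjoint, and
  \<open>0 < lo \<or> N < j\<close> keeps \<open>N - i\<close> below \<open>j\<close>, also for
  \<open>N = j\<close>.\<close>

lemma wf_layer_reflection_swaps:
  assumes N: "N \<le> j" "2 * hi \<le> Suc N" "0 < lo \<or> N < j" and c: "j * n \<le> c" "c + hi \<le> m"
  shows "wf_layer n j m (map (\<lambda>(c, r, s). CSwap c r s) (reflection_swaps c N lo hi))"
proof -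
  let ?g = "\<lambda>i. CSwap (c + i) i (N - i)"
  let ?R = "\<lambda>r. {r * n..<r * n + n}"
  have eq: "map (\<lambda>(c, r, s). CSwap c r s) (reflection_swaps c N lo hi) = map ?g [lo..<hi]"
    by (simp add: reflection_swaps_def)
  have i: "i < j" "N - i < j" "i < N - i" if "lo \<le> i" "i < hi" for i using that N by auto
  have R: "?R r \<subseteq> {..<j * n}" if "r < j" for r
    using mult_le_mono1[of "Suc r" j n] that by auto
  have qs: "set (qop_qubits n (?g i)) = insert (c + i) (?R i \<union> ?R (N - i))" for i by auto
  have dist: "distinct (qop_qubits n (?g i))" if "lo \<le> i" "i < hi" for i
    using i[OF that] disjoint_registers[of i "N - i" n] R[of i] R[of "N - i"] c by auto
  have disj: "set (qop_qubits n (?g i)) \<inter> set (qop_qubits n (?g i')) = {}"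
    if "lo \<le> i" "i < hi" "lo \<le> i'" "i' < hi" "i \<noteq> i'" for i i'
  proof -
    have "(?R i \<union> ?R (N - i)) \<inter> (?R i' \<union> ?R (N - i')) = {}"
    proof -
      have "i \<noteq> N - i'" "N - i \<noteq> i'" "N - i \<noteq> N - i'"
        using that(2,4,5) i[OF that(1,2)] i[OF that(3,4)] N(2) by linarith+
      then show ?thesis
        using disjoint_registers[of i i' n] disjoint_registers[of i "N - i'" n] disjoint_registers[of "N - i" i' n]
          disjoint_registers[of "N - i" "N - i'" n] that(5) by blast
    qed
    moreover have "c + i \<notin> ?R i' \<union> ?R (N - i')" "c + i' \<notin> ?R i \<union> ?R (N - i)"
      using R[of i] R[of "N - i"] R[of i'] R[of "N - i'"] i[OF that(1,2)] i[OF that(3,4)] c by auto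
    ultimately show ?thesis unfolding qs using that(5) by auto
  qed
  have "distinct (concat (map (qop_qubits n) (map ?g [lo..<hi])))"
  proof (rule distinct_concat)
    \<comment> \<open>The control qubits at the head tell these lists apart, also for
      \<open>n = 0\<close>.\<close>
    show "distinct (map (qop_qubits n) (map ?g [lo..<hi]))"
      by (auto simp: distinct_map inj_on_def)
    show "distinct ys" if "ys \<in> set (map (qop_qubits n) (map ?g [lo..<hi]))" for ys
      using that dist by (auto simp del: qop_qubits.simps)
    show "set ys \<inter> set zs = {}" if y: "ys \<in> set (map (qop_qubits n) (map ?g [lo..<hi]))"
      and z: "zs \<in> set (map (qop_qubits n) (map ?g [lo..<hi]))" and ne: "ys \<noteq> zs" for ys zs
    proof -
      obtain i i' where "ys = qop_qubits n (?g i)" "zs = qop_qubits n (?g i')" "lo \<le> i" "i < hi" "lo \<le> i'" "i' < hi"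
        using y z by (auto simp del: qop_qubits.simps)
      then show ?thesis using disj[of i i'] ne by (cases "i = i'") simp_all
    qed
  qed
  moreover have "wf_qop j (?g i) \<and> set (qop_qubits n (?g i)) \<subseteq> {..<m}" if "lo \<le> i" "i < hi" for i
    unfolding qs using i[OF that] R[of i] R[of "N - i"] c that by auto
  ultimately show ?thesis unfolding eq wf_layer_def by (auto simp del: qop_qubits.simps)
qed

lemma wf_swap_test_circuit:
  assumes "1 \<le> j"
  shows "wf_circuit n j (swap_test_circuit n j)"
proof -
  let ?m = "j * n + 2 * j"
  have anc: "distinct (ancilla_qubits n j)" "set (ancilla_qubits n j) \<subseteq> {..<?m}" "ancilla_qubits n j \<noteq> []"
    using assms by (auto simp: ancilla_qubits_def)
  have "concat (map (\<lambda>q. [q]) qs) = qs" for qs :: "nat list" by (induction qs) auto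
  then have H: "wf_layer n j ?m (map (\<lambda>q. Gate hadamard [q]) (ancilla_qubits n j))"
    and M: "wf_layer n j ?m (map Meas (ancilla_qubits n j))"
    using anc by (auto simp: wf_layer_def wf_qop_hadamard o_def simp del: wf_qop.simps(1))
  have A: "wf_layer n j ?m (map (\<lambda>(c, r, s). CSwap c r s) (swaps_1 n j))"
    unfolding swaps_1_def by (rule wf_layer_reflection_swaps) (use assms in auto)
  have B: "wf_layer n j ?m (map (\<lambda>(c, r, s). CSwap c r s) (swaps_2 n j))"
    unfolding swaps_2_def by (rule wf_layer_reflection_swaps) (use assms in auto)
  show ?thesis
    using H M A B anc by (auto simp: wf_circuit_def swap_test_circuit_def num_qubits_def)
qed

lemma swap_test_circuit_size:
  shows "depth (swap_test_circuit n j) \<le> 5"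
    and "num_qubits n j (swap_test_circuit n j) \<le> 2 * (n + 1) * j"
    and "num_cswaps_le (swap_test_circuit n j) (2 * j)"
proof -
  show "depth (swap_test_circuit n j) \<le> 5" by (simp add: depth_def swap_test_circuit_def)
  show "num_qubits n j (swap_test_circuit n j) \<le> 2 * (n + 1) * j"
    by (simp add: num_qubits_def swap_test_circuit_def algebra_simps)
  have "length (swaps_1 n j) + length (swaps_2 n j) \<le> 2 * j"
    by (simp add: swaps_1_def swaps_2_def reflection_swaps_def)
  moreover have "filter is_cswap (map (\<lambda>q. Gate hadamard [q]) qs) = []" "filter is_cswap (map Meas qs) = []" for qs
    by (auto simp: filter_empty_conv is_cswap_def)
  ultimately show "num_cswaps_le (swap_test_circuit n j) (2 * j)"
    by (simp add: num_cswaps_le_def swap_test_circuit_def eval_nat_numeral)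
      (auto intro: order_trans[OF add_mono[OF length_filter_le length_filter_le]])
qed

section \<open>Concentration\<close>

text \<open>Hoeffding's inequality for independent coordinates with values in an interval of length
  2, whence the factor 1/2 in the exponent.\<close>

lemma Pi_pmf_average_concentration:
  fixes p :: "'i \<Rightarrow> 'a pmf" and w :: "'a \<Rightarrow> real" and \<eta> \<mu> :: real
  assumes A: "finite A" and I: "I \<subseteq> A" "I \<noteq> {}"
    and w: "\<And>x. \<bar>w x\<bar> \<le> 1" and \<mu>: "\<And>i. i \<in> I \<Longrightarrow> measure_pmf.expectation (p i) w = \<mu>" and \<eta>: "0 \<le> \<eta>"
  shows "measure_pmf.prob (Pi_pmf A d p) {\<omega>. \<eta> \<le> \<bar>(\<Sum>i\<in>I. w (\<omega> i)) / card I - \<mu>\<bar>} \<le> 2 * exp (- (card I * \<eta>\<^sup>2 / 2))"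
proof -
  let ?M = "measure_pmf (Pi_pmf A d p)"
  let ?X = "\<lambda>i \<omega>. w (\<omega> i)"
  have fin: "finite I" using A I finite_subset by blast
  then have card: "0 < card I" using I by auto
  have E: "measure_pmf.expectation (Pi_pmf A d p) (?X i) = \<mu>" if "i \<in> I" for i
  proof -
    have "measure_pmf.expectation (Pi_pmf A d p) (?X i) = measure_pmf.expectation (map_pmf (\<lambda>\<omega>. \<omega> i) (Pi_pmf A d p)) w"
      by simp
    also have "map_pmf (\<lambda>\<omega>. \<omega> i) (Pi_pmf A d p) = p i" using that I A by (subst Pi_pmf_component) auto
    finally show ?thesis using \<mu> that by simp
  qed
  interpret Hoeffding_ineq ?M I ?X "\<lambda>_. - 1" "\<lambda>_. 1" "card I * \<mu>"
  proof unfold_locales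
    have "prob_space.indep_vars ?M (\<lambda>_. count_space UNIV) (\<lambda>i \<omega>. \<omega> i) I"
      by (rule prob_space.indep_vars_subset[OF prob_space_measure_pmf indep_vars_Pi_pmf[OF A] I(1)])
    then show "prob_space.indep_vars ?M (\<lambda>_. borel) ?X I"
      by (rule prob_space.indep_vars_compose2[OF prob_space_measure_pmf]) auto
    show "AE \<omega> in ?M. ?X i \<omega> \<in> {- 1..1}" if "i \<in> I" for i
      using w by (auto simp: abs_le_iff minus_le_iff intro!: AE_I2)
    show "card I * \<mu> \<equiv> (\<Sum>i\<in>I. measure_pmf.expectation (Pi_pmf A d p) (?X i))" using E by simp
  qed (use fin in auto)
  have "measure_pmf.prob (Pi_pmf A d p) {\<omega>. \<eta> \<le> \<bar>(\<Sum>i\<in>I. w (\<omega> i)) / card I - \<mu>\<bar>}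
      = measure_pmf.prob (Pi_pmf A d p) {\<omega> \<in> space ?M. card I * \<eta> \<le> \<bar>(\<Sum>i\<in>I. w (\<omega> i)) - card I * \<mu>\<bar>}"
  proof (intro arg_cong[of _ _ "measure_pmf.prob _"] Collect_cong)
    fix \<omega>
    have "\<bar>(\<Sum>i\<in>I. w (\<omega> i)) - card I * \<mu>\<bar> = card I * \<bar>(\<Sum>i\<in>I. w (\<omega> i)) / card I - \<mu>\<bar>"
      using card by (simp add: field_simps flip: abs_mult_pos')
    then show "\<eta> \<le> \<bar>(\<Sum>i\<in>I. w (\<omega> i)) / card I - \<mu>\<bar> \<longleftrightarrow>
        \<omega> \<in> space ?M \<and> card I * \<eta> \<le> \<bar>(\<Sum>i\<in>I. w (\<omega> i)) - card I * \<mu>\<bar>"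
      using card by simp
  qed
  also have "\<dots> \<le> 2 * exp (- 2 * (card I * \<eta>)\<^sup>2 / (\<Sum>i\<in>I. (1 - (- 1 :: real))\<^sup>2))"
    using card \<eta> by (intro Hoeffding_ineq_abs_ge) auto
  also have "- 2 * (card I * \<eta>)\<^sup>2 / (\<Sum>i\<in>I. (1 - (- 1 :: real))\<^sup>2) = - (card I * \<eta>\<^sup>2 / 2)"
    using card by (simp add: power2_eq_square field_simps)
  finally show ?thesis .
qed

section \<open>Success probability of the estimators\<close>

definition sample_mean :: "(nat \<Rightarrow> nat) \<Rightarrow> nat \<Rightarrow> (nat \<Rightarrow> bool list) \<Rightarrow> real" where
  "sample_mean N j f = (\<Sum>r<N j. outcome_weight (- 1) (f r)) / N j"

lemma approx_power_trace_iff: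
  "mtrace (\<rho> ^\<^sub>m i) = complex_of_real p \<Longrightarrow> approx_power_trace \<rho> i e q \<longleftrightarrow> \<bar>q - p\<bar> \<le> e"
  by (simp add: approx_power_trace_def flip: of_real_diff)

text \<open>Union bound: the size of \<open>N j\<close> makes each estimate fail with probability at
  most \<open>\<delta> / K\<close>.\<close>

lemma sample_mean_success:
  assumes \<rho>: "quantum_state n \<rho>" and J: "J \<subseteq> {1..t}" and \<delta>: "0 < \<delta>" "\<delta> < 1" and K: "card J \<le> K" and \<eta>: "0 < \<eta>"
    and N: "\<And>j. j \<in> J \<Longrightarrow> 2 * ln (2 * real K / \<delta>) / \<eta>\<^sup>2 \<le> real (N j)"
  shows "1 - \<delta> \<le> measure_pmf.prob (runs_pmf n (swap_test_circuit n) \<rho> t N)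
    {\<omega>. \<forall>j\<in>J. approx_power_trace \<rho> j \<eta> (sample_mean N j (\<lambda>r. \<omega> (j, r)))}"
proof -
  let ?P = "runs_pmf n (swap_test_circuit n) \<rho> t N"
  obtain l where tr: "\<And>i. mtrace (\<rho> ^\<^sub>m i) = complex_of_real (power_sum l i)"
    using quantum_state_spectrum[OF \<rho>] by blast
  define bad where "bad j = {\<omega>. \<eta> \<le> \<bar>sample_mean N j (\<lambda>r. \<omega> (j, r)) - power_sum l j\<bar>}" for j
  have finJ: "finite J" using J finite_subset by blast
  have bad: "measure_pmf.prob ?P (bad j) \<le> \<delta> / K" if j: "j \<in> J" for j
  proof -
    let ?I = "Pair j ` {..<N j}"
    have card: "card ?I = N j" by (simp add: card_image inj_on_def)
    have K0: "0 < K" using K j finJ by (metis card_gt_0_iff empty_iff order_less_le_trans)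
    have "\<delta> < 2 * real K" using K0 \<delta> by linarith
    then have "0 < 2 * ln (2 * real K / \<delta>) / \<eta>\<^sup>2" using \<delta> \<eta> by simp
    then have Nj: "0 < N j" "2 * ln (2 * real K / \<delta>) / \<eta>\<^sup>2 \<le> real (N j)" using N[OF j] by auto
    have "bad j = {\<omega>. \<eta> \<le> \<bar>(\<Sum>i\<in>?I. outcome_weight (- 1) (\<omega> i)) / card ?I - power_sum l j\<bar>}"
      by (simp add: bad_def sample_mean_def card sum.reindex inj_on_def)
    also have "measure_pmf.prob ?P \<dots> \<le> 2 * exp (- (card ?I * \<eta>\<^sup>2 / 2))"
      unfolding runs_pmf_def
    proof (rule Pi_pmf_average_concentration)
      show "?I \<subseteq> (SIGMA j:{1..t}. {..<N j})" using j J by auto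
      show "?I \<noteq> {}" using Nj by (auto simp: lessThan_empty_iff)
      show "measure_pmf.expectation (case i of (j, r) \<Rightarrow> run_pmf n j (swap_test_circuit n j) \<rho>) (outcome_weight (- 1)) = power_sum l j"
        if "i \<in> ?I" for i
        using that expectation_run_pmf[OF \<rho>, of j] j J tr[of j] by auto
    qed (use \<eta> in \<open>auto simp: abs_outcome_weight\<close>)
    also have "\<dots> \<le> 2 * exp (- ln (2 * real K / \<delta>))"
      using Nj(2) \<eta> unfolding card by (simp add: field_simps)
    also have "\<dots> = \<delta> / K" using K0 \<delta> by (simp add: exp_minus)
    finally show ?thesis .
  qed
  have "measure_pmf.prob ?P (\<Union>j\<in>J. bad j) \<le> (\<Sum>j\<in>J. measure_pmf.prob ?P (bad j))"
    by (rule measure_pmf.finite_measure_subadditive_finite[OF finJ]) auto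
  also have "\<dots> \<le> (\<Sum>j\<in>J. \<delta> / K)" by (intro sum_mono bad)
  also have "\<dots> = card J * (\<delta> / K)" by simp
  also have "\<dots> \<le> \<delta>" using K \<delta> by (cases "K = 0") (auto simp: field_simps)
  finally have "1 - \<delta> \<le> 1 - measure_pmf.prob ?P (\<Union>j\<in>J. bad j)" by simp
  also have "\<dots> = measure_pmf.prob ?P (- (\<Union>j\<in>J. bad j))"
    using measure_pmf.prob_compl[of "\<Union>j\<in>J. bad j" ?P] by (simp add: Compl_eq_Diff_UNIV)
  also have "\<dots> \<le> measure_pmf.prob ?P {\<omega>. \<forall>j\<in>J. approx_power_trace \<rho> j \<eta> (sample_mean N j (\<lambda>r. \<omega> (j, r)))}"
  proof (intro measure_pmf.finite_measure_mono subsetI CollectI ballI)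
    fix \<omega> j assume "\<omega> \<in> - (\<Union>j\<in>J. bad j)" "j \<in> J"
    then have "\<omega> \<notin> bad j" by blast
    then show "approx_power_trace \<rho> j \<eta> (sample_mean N j (\<lambda>r. \<omega> (j, r)))"
      by (simp add: bad_def approx_power_trace_iff[OF tr])
  qed simp
  finally show ?thesis .
qed

text \<open>The multiplier of the error is nonnegative, also for \<open>t = 0\<close>, where
  \<open>ln 0 = 0\<close>.\<close>

lemma admissible_error_antimono:
  assumes "admissible_error k \<epsilon> e'" "e \<le> e'"
  shows "admissible_error k \<epsilon> e"
proof -
  have "0 \<le> ln (real (trunc_index k \<epsilon>))" by (cases "trunc_index k \<epsilon>") auto
  then have "e * (2 * real k * real (trunc_index k \<epsilon>) * ln (real (trunc_index k \<epsilon>)))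
      \<le> e' * (2 * real k * real (trunc_index k \<epsilon>) * ln (real (trunc_index k \<epsilon>)))"
    using assms(2) by (intro mult_right_mono) auto
  then show ?thesis using assms(1) unfolding admissible_error_def by (rule order_le_less_trans)
qed

text \<open>The recovery tests admissibility instead of the bounds \<open>err j\<close>, so it
  depends only on \<open>k\<close>, \<open>\<epsilon>\<close> and the estimates.\<close>

lemma sufficient_estimation:
  assumes \<rho>: "quantum_state n \<rho>" and k: "1 \<le> k" and \<epsilon>: "0 < \<epsilon>"
    and err: "\<forall>j\<in>{1..trunc_index k \<epsilon>}. admissible_error k \<epsilon> (err j)"
    and q: "\<forall>j\<in>{1..trunc_index k \<epsilon>}. approx_power_trace \<rho> j (err j) (q j)" and i: "i \<in> {1..k}"
  shows "approx_power_trace \<rho> i \<epsilon> (central_power_sum {1..trunc_index k \<epsilon>} (\<lambda>_. admissible_error k \<epsilon>) q i)"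
proof -
  obtain l where l: "state_spectrum l" and tr: "\<And>i. mtrace (\<rho> ^\<^sub>m i) = complex_of_real (power_sum l i)"
    using quantum_state_spectrum[OF \<rho>] by blast
  have "\<forall>j\<in>{1..trunc_index k \<epsilon>}. admissible_error k \<epsilon> \<bar>q j - power_sum l j\<bar>"
    using err q by (auto simp: approx_power_trace_iff[OF tr] intro: admissible_error_antimono)
  then have "\<bar>central_power_sum {1..trunc_index k \<epsilon>} (\<lambda>_. admissible_error k \<epsilon>) q i - power_sum l i\<bar> \<le> \<epsilon>"
    using i \<epsilon> by (intro central_power_sum_close[OF l] power_sum_diff_le_admissible[of _ _ _ k]) auto
  then show ?thesis by (simp add: approx_power_trace_iff[OF tr])
qed

text \<open>Two consistent spectra differ by up to twice the tolerance; the 6 here, against 3 in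
  \<open>power_sum_diff_le_min\<close>, makes up for this.\<close>

lemma polylog_estimation:
  assumes \<rho>: "quantum_state n \<rho>" and k: "1 \<le> k" and \<epsilon>: "0 < \<epsilon>"
    and q: "\<forall>j\<in>{1..min k (trunc_index k \<epsilon>)}. approx_power_trace \<rho> j (\<epsilon> / (6 * real k * (1 + ln (real k)))) (q j)"
    and i: "i \<in> {1..k}"
  shows "approx_power_trace \<rho> i \<epsilon> (central_power_sum {1..min k (trunc_index k \<epsilon>)}
    (\<lambda>_ d. d \<le> \<epsilon> / (6 * real k * (1 + ln (real k)))) q i)"
proof -
  let ?\<eta> = "\<epsilon> / (6 * real k * (1 + ln (real k)))"
  obtain l where l: "state_spectrum l" and tr: "\<And>i. mtrace (\<rho> ^\<^sub>m i) = complex_of_real (power_sum l i)"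
    using quantum_state_spectrum[OF \<rho>] by blast
  have two: "2 * ?\<eta> = \<epsilon> / (3 * real k * (1 + ln (real k)))" by simp
  have "\<bar>central_power_sum {1..min k (trunc_index k \<epsilon>)} (\<lambda>_ d. d \<le> ?\<eta>) q i - power_sum l i\<bar> \<le> \<epsilon>"
  proof (rule central_power_sum_close[OF l])
    show "\<forall>j\<in>{1..min k (trunc_index k \<epsilon>)}. \<bar>q j - power_sum l j\<bar> \<le> ?\<eta>"
      using q by (simp add: approx_power_trace_iff[OF tr])
    fix l l' assume ll: "state_spectrum l" "state_spectrum l'"
      and a: "\<forall>j\<in>{1..min k (trunc_index k \<epsilon>)}. \<bar>q j - power_sum l j\<bar> \<le> ?\<eta>"
      and b: "\<forall>j\<in>{1..min k (trunc_index k \<epsilon>)}. \<bar>q j - power_sum l' j\<bar> \<le> ?\<eta>"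
    show "\<bar>power_sum l i - power_sum l' i\<bar> \<le> 2 * \<epsilon>"
    proof (rule power_sum_diff_le_min[OF ll _ _ \<epsilon>])
      fix j assume j: "j \<in> {1..min k (trunc_index k \<epsilon>)}"
      have "\<bar>q j - power_sum l j\<bar> \<le> ?\<eta>" "\<bar>q j - power_sum l' j\<bar> \<le> ?\<eta>" using a b j by blast+
      then have "\<bar>power_sum l j - power_sum l' j\<bar> \<le> 2 * ?\<eta>" by linarith
      then show "\<bar>power_sum l j - power_sum l' j\<bar> \<le> \<epsilon> / (3 * real k * (1 + ln (real k)))" unfolding two .
    qed (use i in auto)
  qed
  then show ?thesis by (simp add: approx_power_trace_iff[OF tr])
qed

section \<open>Number of runs\<close>

lemma nat_ceiling_le_double: "1 \<le> x \<Longrightarrow> real (nat \<lceil>x\<rceil>) \<le> 2 * x"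
  by linarith

text \<open>Common to both run counts, with tolerance \<open>\<epsilon> / (c * real k * s)\<close>
  and \<open>m\<close> in the union bound. The ceiling costs a factor 2, as its argument is at least
  1; \<open>ln (2 * real m)\<close> is absorbed into \<open>ln (1 / \<delta>)\<close>, which is at
  least \<open>l0\<close>.\<close>

lemma runs_bound:
  assumes k: "1 \<le> k" and \<epsilon>: "0 < \<epsilon>" "\<epsilon> < 2 * real k" and m: "1 \<le> m" and s: "1 \<le> s" and c: "4 \<le> c"
    and \<delta>: "0 < \<delta>" "l0 \<le> ln (1 / \<delta>)" "0 < l0" and u: "ln (2 * real m) \<le> 2 * u" "1 \<le> u"
  shows "real (nat \<lceil>2 * ln (2 * real m / \<delta>) / (\<epsilon> / (c * real k * s))\<^sup>2\<rceil>)
    \<le> 4 * c\<^sup>2 * (1 + 2 / l0) * (s\<^sup>2 * u) * (real k ^ 2 * ln (1 / \<delta>) / \<epsilon> ^ 2)" (is "real (nat \<lceil>?x\<rceil>) \<le> _")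
proof -
  have L: "0 < ln (1 / \<delta>)" using \<delta> by linarith
  have lnm: "ln (2 * real m / \<delta>) = ln (2 * real m) + ln (1 / \<delta>)"
    using m \<delta> by (simp add: ln_div ln_mult)
  have l2: "1 / 2 \<le> ln (2 * real m)"
  proof -
    have "ln 2 \<le> ln (2 * real m)" using m by (subst ln_le_cancel_iff) auto
    then show ?thesis using ln2_ge_two_thirds by linarith
  qed
  have x: "?x = 2 * c\<^sup>2 * s\<^sup>2 * (real k / \<epsilon>)\<^sup>2 * ln (2 * real m / \<delta>)"
    by (simp add: power_divide power_mult_distrib mult_ac)
  have "1 / 2 \<le> real k / \<epsilon>" using \<epsilon> by (simp add: field_simps)
  then have "(1 / 2)\<^sup>2 \<le> (real k / \<epsilon>)\<^sup>2" by (intro power_mono) auto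
  moreover have "4\<^sup>2 \<le> c\<^sup>2" "1\<^sup>2 \<le> s\<^sup>2" using c s by (intro power_mono; simp)+
  \<comment> \<open>The left side equals 4.\<close>
  ultimately have "(2 * 4\<^sup>2) * 1\<^sup>2 * (1 / 2)\<^sup>2 * (1 / 2) \<le> 2 * c\<^sup>2 * s\<^sup>2 * (real k / \<epsilon>)\<^sup>2 * ln (2 * real m / \<delta>)"
    using l2 L unfolding lnm by (intro mult_mono) auto
  then have "1 \<le> ?x" unfolding x by (simp add: power2_eq_square)
  then have "real (nat \<lceil>?x\<rceil>) \<le> 2 * ?x" by (rule nat_ceiling_le_double)
  also have "\<dots> = 4 * c\<^sup>2 * s\<^sup>2 * (real k / \<epsilon>)\<^sup>2 * ln (2 * real m / \<delta>)" unfolding x by simp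
  also have "\<dots> \<le> 4 * c\<^sup>2 * s\<^sup>2 * (real k / \<epsilon>)\<^sup>2 * ((1 + 2 / l0) * u * ln (1 / \<delta>))"
  proof (intro mult_left_mono)
    have "2 * u * 1 \<le> 2 * u * (ln (1 / \<delta>) / l0)" using \<delta> u by (intro mult_left_mono) (auto simp: field_simps)
    moreover have "1 * ln (1 / \<delta>) \<le> u * ln (1 / \<delta>)" using u L by (intro mult_right_mono) auto
    ultimately have "ln (2 * real m / \<delta>) \<le> 2 * u * (ln (1 / \<delta>) / l0) + u * ln (1 / \<delta>)" using u unfolding lnm by linarith
    then show "ln (2 * real m / \<delta>) \<le> (1 + 2 / l0) * u * ln (1 / \<delta>)" by (simp add: algebra_simps)
  qed auto
  finally show ?thesis by (simp add: power_divide mult_ac)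
qed

lemma polylog_runs:
  assumes k: "1 \<le> k" and \<epsilon>: "0 < \<epsilon>" and \<delta>: "0 < \<delta>" "\<delta> < 1" "l0 \<le> ln (1 / \<delta>)" "0 < l0"
  shows "\<exists>(N :: nat \<Rightarrow> nat) (est :: nat \<Rightarrow> (nat \<Rightarrow> bool list) \<Rightarrow> real) (post :: (nat \<Rightarrow> real) \<Rightarrow> nat \<Rightarrow> real).
    (\<forall>j \<in> {1..trunc_index k \<epsilon>}.
       real (N j) \<le> 144 * (1 + 2 / l0) * (1 + ln (real k)) ^ 5 * (real k ^ 2 * ln (1 / \<delta>) / \<epsilon> ^ 2)) \<and>
    (\<forall>\<rho>. quantum_state n \<rho> \<longrightarrow>
       measure_pmf.prob (runs_pmf n (swap_test_circuit n) \<rho> (trunc_index k \<epsilon>) N)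
         {\<omega>. \<forall>i \<in> {1..k}. approx_power_trace \<rho> i \<epsilon> (post (\<lambda>j. est j (\<lambda>r. \<omega> (j, r))) i)} \<ge> 1 - \<delta>)"
proof -
  define t where "t = trunc_index k \<epsilon>"
  define \<eta> where "\<eta> = \<epsilon> / (6 * real k * (1 + ln (real k)))"
  define x where "x = 2 * ln (2 * real k / \<delta>) / \<eta>\<^sup>2"
  \<comment> \<open>The recovery reads only the estimates for \<open>j \<le> min k t\<close>; the
    union bound thus has at most \<open>k\<close> terms and \<open>t\<close> does not enter.\<close>
  define N where "N j = (if j \<le> k then nat \<lceil>x\<rceil> else 0)" for j
  define post where "post = central_power_sum {1..min k t} (\<lambda>_ d. d \<le> \<eta>)"
  have lnk: "0 \<le> ln (real k)" using k by simp
  have "0 < 6 * real k * (1 + ln (real k))" using k lnk by (intro mult_pos_pos) linarith+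
  then have \<eta>: "0 < \<eta>" using \<epsilon> by (simp add: \<eta>_def)
  have L: "0 < ln (1 / \<delta>)" using \<delta> by linarith
  have "real (N j) \<le> 144 * (1 + 2 / l0) * (1 + ln (real k)) ^ 5 * (real k ^ 2 * ln (1 / \<delta>) / \<epsilon> ^ 2)"
    if j: "j \<in> {1..t}" for j
  proof (cases "j \<le> k")
    case True
    \<comment> \<open>A \<open>j\<close> in the range makes \<open>t\<close> positive, hence
      \<open>\<epsilon> < 2 * real k\<close>, as \<open>runs_bound\<close> requires.\<close>
    have "0 < t" using j by simp
    then have "0 < ln (2 * real k / \<epsilon>)" by (simp add: t_def trunc_index_def)
    then have small: "\<epsilon> < 2 * real k" using \<epsilon> k by (simp add: ln_gt_zero_iff)
    have "ln (2 * real k) = ln 2 + ln (real k)" using k by (simp add: ln_mult)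
    moreover have "ln 2 \<le> (1 :: real)" using ln_le_minus_one[of "2 :: real"] by simp
    ultimately have u: "ln (2 * real k) \<le> 2 * (1 + ln (real k))" using lnk by argo
    have "real (N j) \<le> 4 * 6\<^sup>2 * (1 + 2 / l0) * ((1 + ln (real k))\<^sup>2 * (1 + ln (real k))) * (real k ^ 2 * ln (1 / \<delta>) / \<epsilon> ^ 2)"
      using True u lnk k \<epsilon> small \<delta> unfolding N_def x_def \<eta>_def by (simp only: if_True) (intro runs_bound; simp)
    also have "\<dots> = 144 * (1 + 2 / l0) * (1 + ln (real k)) ^ 3 * (real k ^ 2 * ln (1 / \<delta>) / \<epsilon> ^ 2)"
      by (simp add: power2_eq_square power3_eq_cube)
    \<comment> \<open>The exponent is raised to that of \<open>admissible_runs\<close>, so that both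
      counts share their constants.\<close>
    also have "\<dots> \<le> 144 * (1 + 2 / l0) * (1 + ln (real k)) ^ 5 * (real k ^ 2 * ln (1 / \<delta>) / \<epsilon> ^ 2)"
      using lnk L \<delta> by (intro mult_right_mono mult_left_mono power_increasing) auto
    finally show ?thesis .
  next
    case False
    then show ?thesis using lnk L \<delta> by (simp add: N_def)
  qed
  moreover have "1 - \<delta> \<le> measure_pmf.prob (runs_pmf n (swap_test_circuit n) \<rho> t N)
      {\<omega>. \<forall>i\<in>{1..k}. approx_power_trace \<rho> i \<epsilon> (post (\<lambda>j. sample_mean N j (\<lambda>r. \<omega> (j, r))) i)}"
    if \<rho>: "quantum_state n \<rho>" for \<rho>
  proof -
    have "1 - \<delta> \<le> measure_pmf.prob (runs_pmf n (swap_test_circuit n) \<rho> t N)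
        {\<omega>. \<forall>j\<in>{1..min k t}. approx_power_trace \<rho> j \<eta> (sample_mean N j (\<lambda>r. \<omega> (j, r)))}"
    proof (rule sample_mean_success[OF \<rho> _ \<delta>(1,2) _ \<eta>, where K = k])
      show "2 * ln (2 * real k / \<delta>) / \<eta>\<^sup>2 \<le> real (N j)" if "j \<in> {1..min k t}" for j
        using that unfolding x_def[symmetric] N_def by (simp add: real_nat_ceiling_ge)
    qed auto
    also have "\<dots> \<le> measure_pmf.prob (runs_pmf n (swap_test_circuit n) \<rho> t N)
      {\<omega>. \<forall>i\<in>{1..k}. approx_power_trace \<rho> i \<epsilon> (post (\<lambda>j. sample_mean N j (\<lambda>r. \<omega> (j, r))) i)}"
    proof (intro measure_pmf.finite_measure_mono subsetI CollectI ballI)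
      fix \<omega> i assume "\<omega> \<in> {\<omega>. \<forall>j\<in>{1..min k t}. approx_power_trace \<rho> j \<eta> (sample_mean N j (\<lambda>r. \<omega> (j, r)))}"
        and i: "i \<in> {1..k}"
      then show "approx_power_trace \<rho> i \<epsilon> (post (\<lambda>j. sample_mean N j (\<lambda>r. \<omega> (j, r))) i)"
        unfolding post_def \<eta>_def t_def by (intro polylog_estimation[OF \<rho> k \<epsilon> _ i]) simp
    qed simp
    finally show ?thesis .
  qed
  ultimately show ?thesis unfolding t_def by blast
qed

lemma admissible_runs:
  assumes k: "1 \<le> k" and \<epsilon>: "0 < \<epsilon>" and \<delta>: "0 < \<delta>" "\<delta> < 1" "l0 \<le> ln (1 / \<delta>)" "0 < l0"
  shows "\<exists>(N :: nat \<Rightarrow> nat) (est :: nat \<Rightarrow> (nat \<Rightarrow> bool list) \<Rightarrow> real) (err :: nat \<Rightarrow> real).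
    (\<forall>j \<in> {1..trunc_index k \<epsilon>}. admissible_error k \<epsilon> (err j) \<and>
       real (N j) \<le> 144 * (1 + 2 / l0) * real (trunc_index k \<epsilon>) ^ 5 * (real k ^ 2 * ln (1 / \<delta>) / \<epsilon> ^ 2)) \<and>
    (\<forall>\<rho>. quantum_state n \<rho> \<longrightarrow>
       measure_pmf.prob (runs_pmf n (swap_test_circuit n) \<rho> (trunc_index k \<epsilon>) N)
         {\<omega>. \<forall>j \<in> {1..trunc_index k \<epsilon>}. approx_power_trace \<rho> j (err j) (est j (\<lambda>r. \<omega> (j, r)))} \<ge> 1 - \<delta>)"
proof -
  define t where "t = trunc_index k \<epsilon>"
  \<comment> \<open>Admissible because \<open>2 * k * t * ln t\<close> times this is
    \<open>\<epsilon> * ln t / (2 * t)\<close>; the square stands in for \<open>t * ln t\<close>,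
    which vanishes at \<open>t = 1\<close>.\<close>
  define \<eta> where "\<eta> = \<epsilon> / (4 * real k * (real t)\<^sup>2)"
  define N :: "nat \<Rightarrow> nat" where "N j = nat \<lceil>2 * ln (2 * real t / \<delta>) / \<eta>\<^sup>2\<rceil>" for j
  have L: "0 < ln (1 / \<delta>)" using \<delta> by linarith
  have bounds: "admissible_error k \<epsilon> \<eta> \<and>
      real (N j) \<le> 144 * (1 + 2 / l0) * real t ^ 5 * (real k ^ 2 * ln (1 / \<delta>) / \<epsilon> ^ 2)" if t: "1 \<le> t" for j
  proof
    have "0 < t" using t by simp
    then have "0 < ln (2 * real k / \<epsilon>)" by (simp add: t_def trunc_index_def)
    then have small: "\<epsilon> < 2 * real k" using \<epsilon> k by (simp add: ln_gt_zero_iff)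
    have "ln (real t) \<le> real t - 1" using t by (intro ln_le_minus_one) simp
    then have "ln (real t) / (2 * real t) * \<epsilon> < 1 * \<epsilon>" using t \<epsilon> by (intro mult_strict_right_mono) auto
    then show "admissible_error k \<epsilon> \<eta>"
      using k t unfolding admissible_error_def \<eta>_def t_def[symmetric] by (simp add: field_simps power2_eq_square)
    have u: "ln (2 * real t) \<le> 2 * real t" using ln_le_minus_one[of "2 * real t"] t by simp
    \<comment> \<open>\<open>runs_bound\<close> with \<open>c = 4\<close>, \<open>s = t ^ 2\<close>
      and \<open>u = t\<close>.\<close>
    have "real (N j) \<le> 4 * 4\<^sup>2 * (1 + 2 / l0) * (((real t)\<^sup>2)\<^sup>2 * real t) * (real k ^ 2 * ln (1 / \<delta>) / \<epsilon> ^ 2)"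
      using u t k \<epsilon> small \<delta> unfolding N_def \<eta>_def by (intro runs_bound; simp)
    also have "\<dots> = 64 * (1 + 2 / l0) * real t ^ 5 * (real k ^ 2 * ln (1 / \<delta>) / \<epsilon> ^ 2)"
      by (simp add: eval_nat_numeral)
    also have "\<dots> \<le> 144 * (1 + 2 / l0) * real t ^ 5 * (real k ^ 2 * ln (1 / \<delta>) / \<epsilon> ^ 2)"
      using L \<delta> by (intro mult_right_mono) auto
    finally show "real (N j) \<le> \<dots>" .
  qed
  have "1 - \<delta> \<le> measure_pmf.prob (runs_pmf n (swap_test_circuit n) \<rho> t N)
      {\<omega>. \<forall>j\<in>{1..t}. approx_power_trace \<rho> j \<eta> (sample_mean N j (\<lambda>r. \<omega> (j, r)))}" if \<rho>: "quantum_state n \<rho>" for \<rho>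
  proof (cases "1 \<le> t")
    case True
    then have "0 < \<eta>" using \<epsilon> k by (simp add: \<eta>_def)
    then show ?thesis
      by (intro sample_mean_success[OF \<rho> _ \<delta>(1,2), where K = t]) (auto simp: N_def real_nat_ceiling_ge)
  next
    \<comment> \<open>For \<open>t = 0\<close> there is nothing to estimate.\<close>
    case False
    then show ?thesis using \<delta> by simp
  qed
  with bounds show ?thesis unfolding t_def by (intro exI[of _ N] exI[of _ "sample_mean N"] exI[of _ "\<lambda>_. \<eta>"]) auto
qed

text \<open>The circuits are chosen before \<open>k\<close>, \<open>\<epsilon>\<close> and
  \<open>\<delta>\<close>, and the estimators before \<open>\<rho>\<close>. Since
  \<open>ln (1 / \<delta>)\<close> tends to 0 as \<open>\<delta>\<close> tends to 1, the constant
  \<open>A\<close> depends on an upper bound \<open>\<delta>0\<close>. The first count is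
  polylogarithmic in \<open>k\<close> alone; the second has a power of \<open>t\<close>, which
  involves \<open>ln (1 / \<epsilon>)\<close>, and provides errors as the first half demands
  them.\<close>

theorem corollary3p2:
  shows
    "(\<exists>post :: nat \<Rightarrow> real \<Rightarrow> (nat \<Rightarrow> real) \<Rightarrow> nat \<Rightarrow> real.
        \<forall>(n :: nat) (\<rho> :: complex mat) (k :: nat) (\<epsilon> :: real) (\<delta> :: real)
          (err :: nat \<Rightarrow> real) (M :: (nat \<Rightarrow> real) pmf).
          quantum_state n \<rho> \<longrightarrow> 1 \<le> k \<longrightarrow> 0 < \<epsilon> \<longrightarrow> 0 < \<delta> \<longrightarrow> \<delta> < 1 \<longrightarrow>
          (\<forall>j \<in> {1..trunc_index k \<epsilon>}. admissible_error k \<epsilon> (err j)) \<longrightarrow>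
          measure_pmf.prob M
            {q. \<forall>j \<in> {1..trunc_index k \<epsilon>}. approx_power_trace \<rho> j (err j) (q j)} \<ge> 1 - \<delta> \<longrightarrow>
          measure_pmf.prob M
            {q. \<forall>i \<in> {1..k}. approx_power_trace \<rho> i \<epsilon> (post k \<epsilon> q i)} \<ge> 1 - \<delta>)
     \<and>
     (\<exists>(circ :: nat \<Rightarrow> nat \<Rightarrow> circuit) (C :: nat) (D :: nat).
        (\<forall>n j. 1 \<le> j \<longrightarrow>
           wf_circuit n j (circ n j) \<and>
           depth (circ n j) \<le> D \<and>
           num_qubits n j (circ n j) \<le> C * (n + 1) * j \<and>
           num_cswaps_le (circ n j) (C * j))
        \<and>
        (\<forall>\<delta>0 < (1 :: real). \<exists>(A :: real) (c :: nat).
           \<forall>(n :: nat) (k :: nat) (\<epsilon> :: real) (\<delta> :: real).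
             1 \<le> k \<longrightarrow> 0 < \<epsilon> \<longrightarrow> 0 < \<delta> \<longrightarrow> \<delta> \<le> \<delta>0 \<longrightarrow>
             (\<exists>(N :: nat \<Rightarrow> nat) (est :: nat \<Rightarrow> (nat \<Rightarrow> bool list) \<Rightarrow> real)
                (post :: (nat \<Rightarrow> real) \<Rightarrow> nat \<Rightarrow> real).
                (\<forall>j \<in> {1..trunc_index k \<epsilon>}.
                   real (N j) \<le> A * (1 + ln (real k)) ^ c * (real k ^ 2 * ln (1 / \<delta>) / \<epsilon> ^ 2)) \<and>
                (\<forall>\<rho>. quantum_state n \<rho> \<longrightarrow>
                   measure_pmf.prob (runs_pmf n (circ n) \<rho> (trunc_index k \<epsilon>) N)
                     {\<omega>. \<forall>i \<in> {1..k}. approx_power_trace \<rho> i \<epsilon>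
                            (post (\<lambda>j. est j (\<lambda>r. \<omega> (j, r))) i)} \<ge> 1 - \<delta>))
             \<and>
             (\<exists>(N :: nat \<Rightarrow> nat) (est :: nat \<Rightarrow> (nat \<Rightarrow> bool list) \<Rightarrow> real) (err :: nat \<Rightarrow> real).
                (\<forall>j \<in> {1..trunc_index k \<epsilon>}.
                   admissible_error k \<epsilon> (err j) \<and>
                   real (N j) \<le> A * real (trunc_index k \<epsilon>) ^ c
                                  * (real k ^ 2 * ln (1 / \<delta>) / \<epsilon> ^ 2)) \<and>
                (\<forall>\<rho>. quantum_state n \<rho> \<longrightarrow>
                   measure_pmf.prob (runs_pmf n (circ n) \<rho> (trunc_index k \<epsilon>) N)
                     {\<omega>. \<forall>j \<in> {1..trunc_index k \<epsilon>}. approx_power_trace \<rho> j (err j)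
                            (est j (\<lambda>r. \<omega> (j, r)))} \<ge> 1 - \<delta>))))"
proof
  show "\<exists>post :: nat \<Rightarrow> real \<Rightarrow> (nat \<Rightarrow> real) \<Rightarrow> nat \<Rightarrow> real.
        \<forall>(n :: nat) (\<rho> :: complex mat) (k :: nat) (\<epsilon> :: real) (\<delta> :: real)
          (err :: nat \<Rightarrow> real) (M :: (nat \<Rightarrow> real) pmf).
          quantum_state n \<rho> \<longrightarrow> 1 \<le> k \<longrightarrow> 0 < \<epsilon> \<longrightarrow> 0 < \<delta> \<longrightarrow> \<delta> < 1 \<longrightarrow>
          (\<forall>j \<in> {1..trunc_index k \<epsilon>}. admissible_error k \<epsilon> (err j)) \<longrightarrow>
          measure_pmf.prob M
            {q. \<forall>j \<in> {1..trunc_index k \<epsilon>}. approx_power_trace \<rho> j (err j) (q j)} \<ge> 1 - \<delta> \<longrightarrow>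
          measure_pmf.prob M
            {q. \<forall>i \<in> {1..k}. approx_power_trace \<rho> i \<epsilon> (post k \<epsilon> q i)} \<ge> 1 - \<delta>"
  proof (intro exI allI impI)
    fix n \<rho> k \<epsilon> \<delta> err and M :: "(nat \<Rightarrow> real) pmf"
    assume \<rho>: "quantum_state n \<rho>" and k: "1 \<le> k" and \<epsilon>: "0 < \<epsilon>"
      and err: "\<forall>j\<in>{1..trunc_index k \<epsilon>}. admissible_error k \<epsilon> (err j)"
      and "1 - \<delta> \<le> measure_pmf.prob M {q. \<forall>j\<in>{1..trunc_index k \<epsilon>}. approx_power_trace \<rho> j (err j) (q j)}"
    note this(5)
    \<comment> \<open>Good estimates imply good recovered values, so the success probability is
      inherited for every joint distribution \<open>M\<close>.\<close>
    also have "measure_pmf.prob M {q. \<forall>j\<in>{1..trunc_index k \<epsilon>}. approx_power_trace \<rho> j (err j) (q j)}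
      \<le> measure_pmf.prob M {q. \<forall>i\<in>{1..k}. approx_power_trace \<rho> i \<epsilon>
          ((\<lambda>k \<epsilon>. central_power_sum {1..trunc_index k \<epsilon>} (\<lambda>_. admissible_error k \<epsilon>)) k \<epsilon> q i)}"
      by (intro measure_pmf.finite_measure_mono subsetI CollectI ballI)
        (simp_all only: mem_Collect_eq sufficient_estimation[OF \<rho> k \<epsilon> err] sets_measure_pmf UNIV_I)
    finally show "1 - \<delta> \<le> measure_pmf.prob M {q. \<forall>i\<in>{1..k}. approx_power_trace \<rho> i \<epsilon>
          ((\<lambda>k \<epsilon>. central_power_sum {1..trunc_index k \<epsilon>} (\<lambda>_. admissible_error k \<epsilon>)) k \<epsilon> q i)}" .
  qed
  show "\<exists>(circ :: nat \<Rightarrow> nat \<Rightarrow> circuit) (C :: nat) (D :: nat).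
        (\<forall>n j. 1 \<le> j \<longrightarrow>
           wf_circuit n j (circ n j) \<and>
           depth (circ n j) \<le> D \<and>
           num_qubits n j (circ n j) \<le> C * (n + 1) * j \<and>
           num_cswaps_le (circ n j) (C * j))
        \<and>
        (\<forall>\<delta>0 < (1 :: real). \<exists>(A :: real) (c :: nat).
           \<forall>(n :: nat) (k :: nat) (\<epsilon> :: real) (\<delta> :: real).
             1 \<le> k \<longrightarrow> 0 < \<epsilon> \<longrightarrow> 0 < \<delta> \<longrightarrow> \<delta> \<le> \<delta>0 \<longrightarrow>
             (\<exists>(N :: nat \<Rightarrow> nat) (est :: nat \<Rightarrow> (nat \<Rightarrow> bool list) \<Rightarrow> real)
                (post :: (nat \<Rightarrow> real) \<Rightarrow> nat \<Rightarrow> real).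
                (\<forall>j \<in> {1..trunc_index k \<epsilon>}.
                   real (N j) \<le> A * (1 + ln (real k)) ^ c * (real k ^ 2 * ln (1 / \<delta>) / \<epsilon> ^ 2)) \<and>
                (\<forall>\<rho>. quantum_state n \<rho> \<longrightarrow>
                   measure_pmf.prob (runs_pmf n (circ n) \<rho> (trunc_index k \<epsilon>) N)
                     {\<omega>. \<forall>i \<in> {1..k}. approx_power_trace \<rho> i \<epsilon>
                            (post (\<lambda>j. est j (\<lambda>r. \<omega> (j, r))) i)} \<ge> 1 - \<delta>))
             \<and>
             (\<exists>(N :: nat \<Rightarrow> nat) (est :: nat \<Rightarrow> (nat \<Rightarrow> bool list) \<Rightarrow> real) (err :: nat \<Rightarrow> real).
                (\<forall>j \<in> {1..trunc_index k \<epsilon>}.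
                   admissible_error k \<epsilon> (err j) \<and>
                   real (N j) \<le> A * real (trunc_index k \<epsilon>) ^ c
                                  * (real k ^ 2 * ln (1 / \<delta>) / \<epsilon> ^ 2)) \<and>
                (\<forall>\<rho>. quantum_state n \<rho> \<longrightarrow>
                   measure_pmf.prob (runs_pmf n (circ n) \<rho> (trunc_index k \<epsilon>) N)
                     {\<omega>. \<forall>j \<in> {1..trunc_index k \<epsilon>}. approx_power_trace \<rho> j (err j)
                            (est j (\<lambda>r. \<omega> (j, r)))} \<ge> 1 - \<delta>)))"
  proof (rule exI[of _ swap_test_circuit], rule exI[of _ 2], rule exI[of _ 5], intro conjI allI impI)
    fix n j :: nat assume "1 \<le> j"
    then show "wf_circuit n j (swap_test_circuit n j)" by (rule wf_swap_test_circuit)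
    show "depth (swap_test_circuit n j) \<le> 5" "num_qubits n j (swap_test_circuit n j) \<le> 2 * (n + 1) * j"
      "num_cswaps_le (swap_test_circuit n j) (2 * j)" by (rule swap_test_circuit_size)+
  next
    fix \<delta>0 :: real assume \<delta>0: "\<delta>0 < 1"
    \<comment> \<open>The maximum with 1/2 keeps the argument of the logarithm positive for
      \<open>\<delta>0 \<le> 0\<close>.\<close>
    define l0 where "l0 = ln (1 / max \<delta>0 (1 / 2))"
    have l0: "0 < l0" using \<delta>0 by (simp add: l0_def)
    have l0_le: "l0 \<le> ln (1 / \<delta>)" "\<delta> < 1" if "0 < \<delta>" "\<delta> \<le> \<delta>0" for \<delta>
      using that \<delta>0 by (auto simp: l0_def ln_div)
    show "\<exists>(A :: real) (c :: nat). \<forall>(n :: nat) (k :: nat) (\<epsilon> :: real) (\<delta> :: real).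
             1 \<le> k \<longrightarrow> 0 < \<epsilon> \<longrightarrow> 0 < \<delta> \<longrightarrow> \<delta> \<le> \<delta>0 \<longrightarrow>
             (\<exists>(N :: nat \<Rightarrow> nat) (est :: nat \<Rightarrow> (nat \<Rightarrow> bool list) \<Rightarrow> real)
                (post :: (nat \<Rightarrow> real) \<Rightarrow> nat \<Rightarrow> real).
                (\<forall>j \<in> {1..trunc_index k \<epsilon>}.
                   real (N j) \<le> A * (1 + ln (real k)) ^ c * (real k ^ 2 * ln (1 / \<delta>) / \<epsilon> ^ 2)) \<and>
                (\<forall>\<rho>. quantum_state n \<rho> \<longrightarrow>
                   measure_pmf.prob (runs_pmf n (swap_test_circuit n) \<rho> (trunc_index k \<epsilon>) N)
                     {\<omega>. \<forall>i \<in> {1..k}. approx_power_trace \<rho> i \<epsilon>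
                            (post (\<lambda>j. est j (\<lambda>r. \<omega> (j, r))) i)} \<ge> 1 - \<delta>))
             \<and>
             (\<exists>(N :: nat \<Rightarrow> nat) (est :: nat \<Rightarrow> (nat \<Rightarrow> bool list) \<Rightarrow> real) (err :: nat \<Rightarrow> real).
                (\<forall>j \<in> {1..trunc_index k \<epsilon>}.
                   admissible_error k \<epsilon> (err j) \<and>
                   real (N j) \<le> A * real (trunc_index k \<epsilon>) ^ c
                                  * (real k ^ 2 * ln (1 / \<delta>) / \<epsilon> ^ 2)) \<and>
                (\<forall>\<rho>. quantum_state n \<rho> \<longrightarrow>
                   measure_pmf.prob (runs_pmf n (swap_test_circuit n) \<rho> (trunc_index k \<epsilon>) N)
                     {\<omega>. \<forall>j \<in> {1..trunc_index k \<epsilon>}. approx_power_trace \<rho> j (err j)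
                            (est j (\<lambda>r. \<omega> (j, r)))} \<ge> 1 - \<delta>))"
      (is "\<exists>A c. \<forall>n k \<epsilon> \<delta>. _ \<longrightarrow> _ \<longrightarrow> _ \<longrightarrow> _ \<longrightarrow> ?first A c n k \<epsilon> \<delta> \<and> ?second A c n k \<epsilon> \<delta>")
    proof (rule exI[of _ "144 * (1 + 2 / l0)"], rule exI[of _ 5], intro allI impI conjI)
      fix n k :: nat and \<epsilon> \<delta> :: real
      assume k: "1 \<le> k" and \<epsilon>: "0 < \<epsilon>" and \<delta>: "0 < \<delta>" "\<delta> \<le> \<delta>0"
      note * = k \<epsilon> \<delta>(1) l0_le(2,1)[OF \<delta>] l0
      from polylog_runs[OF *] show "?first (144 * (1 + 2 / l0)) 5 n k \<epsilon> \<delta>" .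
      from admissible_runs[OF *] show "?second (144 * (1 + 2 / l0)) 5 n k \<epsilon> \<delta>" .
    qed
  qed
qed

end
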